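(* Let $2<\alpha<3$. Suppose that $\mu>0$ and that conditions (R1) and (R2) of the context hold. Assume that for some $\beta\in(0,\alpha-2)$ $$\sum_{n\ge t}n^{-1-\beta}\,\mathbf P(N=n)=o\bigl(\mathbf P(N=t)\bigr)\quad\text{as } t\to+\infty.$$ Assume that $\mathbf P(X_1=t)=t^{-\alpha}L_1(t)$ for $t=1,2,\dots$, where $L_1$ is slowly varying at infinity and satisfies $L_1\bigl(tL_1^{1/(\alpha-1)}(t)\bigr)\sim L_1(t)$, and that the limit $\lim_{t\to+\infty}\mathbf P(X_1<-t)/\mathbf P(X_1>t)$ exists and is finite. Then, as $t\to+\infty$ through the integers: (a) $\mathbf E N<\infty$ implies $$\mathbf P(S_N=t)=(\mathbf E N)\,\mathbf P(X_1=t)(1+o(1))+\mu^{-1}\,\mathbf P\bigl(N=\lfloor t/\mu\rfloor\bigr)(1+o(1)).$$ (b) If in addition $\mathbf P(X_1=t)=o\bigl(\mathbf P(N=t)\bigr)$ as $t\to+\infty$, then either of the conditions $\mathbf E N<\infty$ or (P) implies $$\mathbf P(S_N=t)\sim\mu^{-1}\,\mathbf P\bigl(N=\lfloor t/\mu\rfloor\bigr).$$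
   Context: $X_1,X_2,\dots$ are i.i.d. integer valued random variables (not necessarily non-negative); $N$ is a non-negative integer valued random variable independent of $\{X_i\}$; $S_N=X_1+\dots+X_N$ (with $S_0=0$). $\mu=\mathbf E X_1$. $f(t)\sim g(t)$ means $f(t)/g(t)\to1$ as $t\to+\infty$. Conditions on $N$ (with $t,s,t_1,t_2$ positive integers): (R1) There exist $c_1>1$ and $c_2,c_3>0$ such that $c_2\le\mathbf P(N=t_2)/\mathbf P(N=t_1)\le c_3$ for any $t_1,t_2$ with $1\le t_2/t_1\le c_1$. (R2) There exists $\varkappa>\max\{(\alpha-1)^{-1},\,0.5\}$ such that $\displaystyle\lim_{t\to+\infty}\ \sup_{s:\,|t-s|\le t^{\varkappa}}\frac{\mathbf P(N=t)}{\mathbf P(N=s)}=1$. (P) For some $\gamma>1$, $\mathbf P(N=t)=t^{-\gamma}L_2(t)$ for $t=1,2,\dots$, where $L_2$ is slowly varying at infinity. *)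

theory Defs
  imports "HOL-Probability.Probability" "HOL-Library.Landau_Symbols"
begin

(* Karamata's notion; as usual, only the behaviour on a neighbourhood of infinity matters. *)
definition slowly_varying :: "(real \<Rightarrow> real) \<Rightarrow> bool" where
  "slowly_varying L \<longleftrightarrow>
     (\<exists>a. (\<forall>x\<ge>a. L x > 0) \<and> set_borel_measurable borel {a..} L) \<and>
     (\<forall>c>0. ((\<lambda>x. L (c * x) / L x) \<longlongrightarrow> 1) at_top)"

definition random_sum :: "(nat \<Rightarrow> 'a \<Rightarrow> int) \<Rightarrow> ('a \<Rightarrow> nat) \<Rightarrow> 'a \<Rightarrow> int" where
  "random_sum X N \<omega> = (\<Sum>i = 1..N \<omega>. X i \<omega>)"

(* The i.i.d. sequence is X 1, X 2, ...; the value X 0 is never used. *)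
definition iid_seq :: "'a measure \<Rightarrow> (nat \<Rightarrow> 'a \<Rightarrow> int) \<Rightarrow> bool" where
  "iid_seq M X \<longleftrightarrow>
     prob_space.indep_vars M (\<lambda>_. count_space UNIV) X {1..} \<and>
     (\<forall>i\<ge>1. distr M (count_space UNIV) (X i) = distr M (count_space UNIV) (X 1))"

(* The library's indep_var requires both random variables to have the same type, hence
   independence of the generated sigma-algebras. *)
definition indep_of_seq :: "'a measure \<Rightarrow> ('a \<Rightarrow> nat) \<Rightarrow> (nat \<Rightarrow> 'a \<Rightarrow> int) \<Rightarrow> bool" where
  "indep_of_seq M N X \<longleftrightarrow>
     N \<in> measurable M (count_space UNIV) \<and>
     prob_space.indep_set M
       {N -` A \<inter> space M | A. A \<in> sets (count_space UNIV)}
       {(\<lambda>\<omega>. \<lambda>i\<in>{1..}. X i \<omega>) -` B \<inter> space M | B. B \<in> sets (PiM {1..} (\<lambda>_. count_space UNIV))}"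

(* In the following conditions p t stands for the probability that N = t.
   Since c2 > 0 and x / 0 = 0, condition R1 (with t1 = t2) entails p t > 0 for all t \<ge> 1. *)
definition cond_R1 :: "(nat \<Rightarrow> real) \<Rightarrow> bool" where
  "cond_R1 p \<longleftrightarrow>
     (\<exists>c1 c2 c3. c1 > 1 \<and> c2 > 0 \<and> c3 > 0 \<and>
        (\<forall>t1 t2. t1 \<ge> 1 \<and> t2 \<ge> 1 \<and> 1 \<le> real t2 / real t1 \<and> real t2 / real t1 \<le> c1 \<longrightarrow>
           c2 \<le> p t2 / p t1 \<and> p t2 / p t1 \<le> c3))"

(* For t \<ge> 1 the supremum is over a finite set containing s = t. *)
definition cond_R2 :: "real \<Rightarrow> (nat \<Rightarrow> real) \<Rightarrow> bool" where
  "cond_R2 \<alpha> p \<longleftrightarrow>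
     (\<exists>\<kappa>. \<kappa> > max (1 / (\<alpha> - 1)) (1 / 2) \<and>
        (\<lambda>t. SUP s\<in>{s. s \<ge> 1 \<and> \<bar>real t - real s\<bar> \<le> real t powr \<kappa>}. p t / p s) \<longlonglongrightarrow> 1)"

definition cond_P :: "(nat \<Rightarrow> real) \<Rightarrow> bool" where
  "cond_P p \<longleftrightarrow>
     (\<exists>\<gamma> L2. \<gamma> > 1 \<and> slowly_varying L2 \<and> (\<forall>t\<ge>1. p t = real t powr (-\<gamma>) * L2 (real t)))"

end

theory Submission
  imports Defs "HOL-Real_Asymp.Real_Asymp"
begin

text \<open>Put $w_n(t) = P(S_n = t)$ and $p_n = P(N = n)$, so that $P(S_N = t) = \sum_n p_n w_n(t)$.

  For $n \le t/(2\mu)$ the walk can only reach $t$ by one big jump: $w_n(t) \le C n P(X_1 = t)$ and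
  $w_n(t) \sim n P(X_1 = t)$ for fixed $n$, so by dominated convergence these terms contribute
  $E N \cdot P(X_1 = t)$ if $E N$ is finite.

  The terms with $|t - n\mu| < t^\kappa$, where $1/(\alpha-1) < \kappa < 1$ is chosen so that (R2) makes $p_n$
  asymptotically constant, contribute $p_{\lfloor t/\mu\rfloor} \sum_n w_n(t)$, and $\sum_n w_n(t) \to 1/\mu$
  by the renewal theorem.

  The remaining terms are negligible because, for $q < \alpha - 1$, the expected number of visits to $t$
  at times $n \le M$ with $|t - n\mu| \ge Y$ is $O(M Y^{-q})$, by a Chernoff bound for the walk with
  truncated steps. With (R1) this handles $n$ of order $t$; for larger $n$, dyadic blocks of indices
  reduce the sum to $\sum_{n \ge t} n^{-q} p_n$ with $q > 1 + \beta$.\<close>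

section \<open>Slowly varying functions\<close>

text \<open>The steps have no second moment and may be negative, so neither a Gaussian local limit
  theorem nor the monotonicity of ordinary renewal processes is at hand. What helps is that p_n
  varies slowly in n: only sums of w_n(t) over ranges of n matter, and these are parts of the Green
  function sum_n w_n(t), which is bounded because the drift is positive. The Green function is
  controlled without Fourier analysis. As P charges all large integers, a power of the step operator
  flattens bounded functions at unit scale; a telescoping identity for the summed distribution
  functions then fixes the level 1/mu. The tail-ratio hypothesis enters through moments of all
  orders q < alpha - 1, and the exponents come from such q. A window of width t^kappa needs kappa q
  > 1 for some q, hence kappa > 1/(alpha - 1); the far sum needs q > 1 + beta, hence beta < alpha -
  2. When E N is infinite in (b), the majorant n p_n for n <= t/(2 mu) is lost; (P) then forces
  gamma <= 2 < alpha, and the truncated means of N grow too slowly to compete.\<close>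

lemma translation_limit_uniform:
  fixes h :: "real \<Rightarrow> real"
  assumes meas[measurable]: "h \<in> borel_measurable borel"
    and lim: "\<And>u. ((\<lambda>x. h (x + u) - h x) \<longlongrightarrow> 0) at_top"
    and \<epsilon>: "\<epsilon> > 0"
  shows "\<exists>x0. \<forall>x\<ge>x0. \<forall>u\<in>{0..1}. \<bar>h (x + u) - h x\<bar> < \<epsilon>"
proof (rule ccontr)
  assume "\<not> ?thesis"
  then have "\<forall>n::nat. \<exists>x u. x \<ge> real n \<and> u \<in> {0..1} \<and> \<bar>h (x + u) - h x\<bar> \<ge> \<epsilon>"
    by (meson linorder_not_less)
  then obtain x u where xu: "\<And>n::nat. x n \<ge> real n" "\<And>n::nat. u n \<in> {0..1}"
    "\<And>n::nat. \<bar>h (x n + u n) - h (x n)\<bar> \<ge> \<epsilon>"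
    by metis
  txt \<open>The good shifts for the base points $x_m$, and those for the base points $x_m + u_m$
    translated by $u_n$, are two subsets of $[0, 5]$ of measure more than 3, hence they meet.\<close>
  define V where "V y n = {l\<in>{0..4}. \<forall>m\<ge>n. \<bar>h (y m + l) - h (y m)\<bar> < \<epsilon> / 2}" for y :: "nat \<Rightarrow> real" and n
  have V_sets[measurable]: "V y n \<in> sets borel" for y n
    unfolding V_def by measurable
  have large: "eventually (\<lambda>n. emeasure lborel (V y n) > 3) sequentially" if y: "\<And>n::nat. y n \<ge> real n" for y
  proof -
    have "incseq (V y)" unfolding V_def incseq_def by auto
    then have "(\<lambda>n. emeasure lborel (V y n)) \<longlonglongrightarrow> emeasure lborel (\<Union>n. V y n)"
      using V_sets by (intro Lim_emeasure_incseq) auto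
    moreover have "(\<Union>n. V y n) = {0..4}"
    proof (intro equalityI subsetI)
      fix l :: real assume l: "l \<in> {0..4}"
      have "filterlim y at_top sequentially"
        by (rule filterlim_at_top_mono[OF filterlim_real_sequentially]) (use y in auto)
      from filterlim_compose[OF lim[of l] this]
      have "eventually (\<lambda>m. dist (h (y m + l) - h (y m)) 0 < \<epsilon> / 2) sequentially"
        using \<epsilon> by (intro tendstoD) auto
      then show "l \<in> (\<Union>n. V y n)"
        using l by (auto simp: V_def eventually_sequentially dist_norm)
    qed (auto simp: V_def)
    ultimately have "(\<lambda>n. emeasure lborel (V y n)) \<longlonglongrightarrow> 4" by simp
    then show ?thesis by (rule order_tendstoD) simp
  qed
  have "x m + u m \<ge> real m" for m using xu(1,2)[of m] by auto
  from eventually_conj[OF large[of x, OF xu(1)] large[OF this]]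
  obtain n where V3: "emeasure lborel (V x n) > 3" and W3: "emeasure lborel (V (\<lambda>m. x m + u m) n) > 3"
    by (auto dest: eventually_happens)
  define W where "W = V (\<lambda>m. x m + u m) n"
  define W' where "W' = (\<lambda>l. - u n + l) -` W"
  have W_sets[measurable]: "W \<in> sets borel" by (simp add: W_def)
  have [measurable]: "W' \<in> sets borel"
    unfolding W'_def by (rule measurable_sets_borel[OF _ W_sets]) measurable
  have "emeasure lborel W' = emeasure (distr lborel borel ((+) (- u n))) W"
    unfolding W'_def by (subst emeasure_distr) auto
  also have "\<dots> = emeasure lborel W"
    by (subst lborel_distr_plus) simp
  finally have W'3: "emeasure lborel W' > 3" using W3 by (simp add: W_def)
  \<comment> \<open>A common shift \<open>l\<close> would put \<open>h (x n + l)\<close> within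
    \<open>\<epsilon> / 2\<close> of both \<open>h (x n)\<close> and \<open>h (x n + u n)\<close>,
    against the choice of \<open>u n\<close>.\<close>
  have "V x n \<inter> W' = {}"
  proof (rule ccontr)
    assume "V x n \<inter> W' \<noteq> {}"
    then obtain l where "l \<in> V x n" "l \<in> W'" by blast
    then have "\<bar>h (x n + l) - h (x n)\<bar> < \<epsilon> / 2" "\<bar>h (x n + u n + (- u n + l)) - h (x n + u n)\<bar> < \<epsilon> / 2"
      by (auto simp: V_def W_def W'_def)
    moreover have "x n + u n + (- u n + l) = x n + l" by simp
    ultimately show False using xu(3)[of n] by (simp only:)
  qed
  then have "emeasure lborel (V x n) + emeasure lborel W' = emeasure lborel (V x n \<union> W')"
    by (intro plus_emeasure) auto
  also have "\<dots> \<le> emeasure lborel {0..5::real}"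
    by (rule emeasure_mono) (use xu(2)[of n] in \<open>auto simp: V_def W_def W'_def\<close>)
  also have "\<dots> = 5" by simp
  finally have "emeasure lborel (V x n) + emeasure lborel W' \<le> 5" .
  moreover have "3 + 3 \<le> emeasure lborel (V x n) + emeasure lborel W'"
    using V3 W'3 by (intro add_mono less_imp_le)
  ultimately have "(3::ennreal) + 3 \<le> 5" by (rule order_trans[rotated])
  then show False by simp
qed

text \<open>Potter bounds in logarithmic form. For \<open>h = ln o L o exp\<close> slow variation
  says that translation increments vanish; Karamata's uniform convergence theorem, proved above,
  bounds them by \<open>\<delta>\<close> over one unit, and chaining unit steps costs
  \<open>\<delta>\<close> each. The \<open>+ 1\<close> pays for the fractional last step; the last
  claim is the unchained estimate.\<close>

lemma slowly_varying_potter: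
  assumes L: "slowly_varying L" and \<delta>: "\<delta> > 0"
  obtains x0 where "x0 \<ge> 1" "\<And>x. x \<ge> x0 \<Longrightarrow> L x > 0"
    "\<And>x y. x0 \<le> x \<Longrightarrow> x \<le> y \<Longrightarrow> \<bar>ln (L y) - ln (L x)\<bar> \<le> \<delta> * (ln (y / x) + 1)"
    "\<And>x y. x0 \<le> x \<Longrightarrow> x \<le> y \<Longrightarrow> y \<le> exp 1 * x \<Longrightarrow> \<bar>ln (L y) - ln (L x)\<bar> \<le> \<delta>"
proof -
  from L obtain a0 where a0: "\<And>x. x \<ge> a0 \<Longrightarrow> L x > 0" "set_borel_measurable borel {a0..} L"
    and lim: "\<And>c. c > 0 \<Longrightarrow> ((\<lambda>x. L (c * x) / L x) \<longlongrightarrow> 1) at_top"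
    unfolding slowly_varying_def by blast
  define a where "a = max a0 1"
  \<comment> \<open>Below \<open>ln a\<close> nothing is known about the sign of \<open>L\<close>;
    cutting \<open>h\<close> to 0 there keeps it measurable and does not affect limits at
    infinity.\<close>
  define h where "h x = (if x \<ge> ln a then ln (L (exp x)) else 0)" for x
  have a0_le: "a0 \<le> exp x" if "x \<ge> ln a" for x
  proof -
    have "a \<le> exp x" using that unfolding a_def by (metis exp_ln exp_le_cancel_iff less_max_iff_disj zero_less_one)
    then show ?thesis by (simp add: a_def)
  qed
  then have pos: "L (exp x) > 0" if "x \<ge> ln a" for x using that a0 by blast
  have hmeas: "h \<in> borel_measurable borel"
  proof -
    have [measurable]: "(\<lambda>x. indicator {a0..} x *\<^sub>R L x) \<in> borel_measurable borel"
      using a0(2) unfolding set_borel_measurable_def .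
    have "h = (\<lambda>x. if x \<ge> ln a then ln ((\<lambda>x. indicator {a0..} x *\<^sub>R L x) (exp x)) else 0)"
      using a0_le by (auto simp: h_def)
    also have "\<dots> \<in> borel_measurable borel" by measurable
    finally show ?thesis .
  qed
  have hlim: "((\<lambda>x. h (x + u) - h x) \<longlongrightarrow> 0) at_top" for u
  proof -
    have "((\<lambda>x. ln (L (exp u * exp x) / L (exp x))) \<longlongrightarrow> ln 1) at_top"
      by (intro tendsto_ln filterlim_compose[OF lim exp_at_top]) auto
    then have "((\<lambda>x. ln (L (exp u * exp x) / L (exp x))) \<longlongrightarrow> 0) at_top" by simp
    moreover have "eventually (\<lambda>x. ln (L (exp u * exp x) / L (exp x)) = h (x + u) - h x) at_top"
    proof -
      have "eventually (\<lambda>x. x \<ge> max (ln a) (ln a - u)) at_top" by (rule eventually_ge_at_top)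
      then show ?thesis
      proof eventually_elim
        case (elim x)
        then have "L (exp x) > 0" "L (exp (x + u)) > 0" by (auto intro!: pos)
        then show ?case using elim
          by (auto simp: h_def ln_div exp_add mult.commute)
      qed
    qed
    ultimately show ?thesis by (rule Lim_transform_eventually)
  qed
  obtain x1 where x1: "\<And>x u. x \<ge> x1 \<Longrightarrow> u \<in> {0..1} \<Longrightarrow> \<bar>h (x + u) - h x\<bar> < \<delta>"
    using translation_limit_uniform[OF hmeas hlim \<delta>] by blast
  have steps: "\<bar>h (x + real n) - h x\<bar> \<le> \<delta> * real n" if "x \<ge> x1" for x n
  proof (induction n)
    case (Suc n)
    have "\<bar>h (x + real n + 1) - h (x + real n)\<bar> < \<delta>" using that by (intro x1) auto
    with Suc show ?case by (auto simp: algebra_simps)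
  qed simp
  have gen: "\<bar>h (x + u) - h x\<bar> \<le> \<delta> * (u + 1)" if "x \<ge> x1" "u \<ge> 0" for x u
  proof -
    define n where "n = nat \<lfloor>u\<rfloor>"
    have n: "real n \<le> u" "u - real n \<le> 1" using that(2) by (auto simp: n_def) linarith
    have "\<bar>h (x + real n + (u - real n)) - h (x + real n)\<bar> < \<delta>"
      using that n by (intro x1) auto
    moreover have "\<bar>h (x + real n) - h x\<bar> \<le> \<delta> * real n" using steps that by blast
    moreover have "\<delta> * real n \<le> \<delta> * u" using n \<delta> by auto
    moreover have "x + real n + (u - real n) = x + u" by simp
    ultimately show ?thesis by (simp add: distrib_left)
  qed
  define x0 where "x0 = max a (exp x1)"
  have x0: "x0 \<ge> 1" "x0 > 0" by (auto simp: x0_def a_def)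
  have lnx0: "ln x \<ge> x1" "ln x \<ge> ln a" "exp (ln x) = x" "h (ln x) = ln (L x)" if "x \<ge> x0" for x
  proof -
    have x: "x > 0" using x0 that by linarith
    show "exp (ln x) = x" using x by simp
    show "ln x \<ge> x1" using that x by (simp add: ln_ge_iff x0_def)
    have "a \<le> x" "a > 0" using that by (auto simp: x0_def a_def)
    then show "ln x \<ge> ln a" by simp
    then show "h (ln x) = ln (L x)" using x by (simp add: h_def)
  qed
  show ?thesis
  proof (rule that[of x0])
    show "x0 \<ge> 1" by (fact x0)
    show "L x > 0" if "x \<ge> x0" for x using pos[of "ln x"] lnx0[OF that] by simp
    fix x y assume xy: "x0 \<le> x" "x \<le> y"
    then have "y \<ge> x0" "x > 0" "y > 0" using x0 by linarith+
    have eq: "\<bar>ln (L y) - ln (L x)\<bar> = \<bar>h (ln x + ln (y / x)) - h (ln x)\<bar>"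
      using lnx0[OF xy(1)] lnx0[OF \<open>y \<ge> x0\<close>] \<open>x > 0\<close> \<open>y > 0\<close> by (simp add: ln_div)
    have nn: "ln (y / x) \<ge> 0" using xy \<open>x > 0\<close> by simp
    show "\<bar>ln (L y) - ln (L x)\<bar> \<le> \<delta> * (ln (y / x) + 1)"
      unfolding eq using nn lnx0(1)[OF xy(1)] by (intro gen) auto
    show "\<bar>ln (L y) - ln (L x)\<bar> \<le> \<delta>" if "y \<le> exp 1 * x"
    proof -
      have "ln (y / x) \<le> 1"
        using that \<open>x > 0\<close> \<open>y > 0\<close> ln_le_cancel_iff[of "y / x" "exp 1"] by (simp add: field_simps)
      then show ?thesis
        unfolding eq using nn lnx0(1)[OF xy(1)] x1[of "ln x" "ln (y / x)"] by auto
    qed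
  qed
qed

lemma regularly_varying_dominated:
  assumes L: "slowly_varying L" and \<alpha>: "\<alpha> > 0" and c: "c > 0"
  obtains C t0 where "C > 0" "t0 \<ge> 1"
    "\<And>t x. t \<ge> t0 \<Longrightarrow> x \<ge> c * t \<Longrightarrow> x powr (-\<alpha>) * L x \<le> C * (t powr (-\<alpha>) * L t)"
proof -
  \<comment> \<open>With a Potter loss below \<open>\<alpha>\<close> the power decay wins for all
    \<open>x \<ge> t\<close>; for \<open>c * t \<le> x < t\<close> the logarithm of
    \<open>t / x\<close> is at most \<open>\<bar>ln c\<bar>\<close>, which gives the constant
    \<open>C\<close>.\<close>
  define \<delta> where "\<delta> = \<alpha> / 2"
  have \<delta>: "\<delta> > 0" using \<alpha> by (simp add: \<delta>_def)
  obtain x0 where x0: "x0 \<ge> 1" "\<And>x. x \<ge> x0 \<Longrightarrow> L x > 0"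
    and pot: "\<And>x y. x0 \<le> x \<Longrightarrow> x \<le> y \<Longrightarrow> \<bar>ln (L y) - ln (L x)\<bar> \<le> \<delta> * (ln (y / x) + 1)"
    using slowly_varying_potter[OF L \<delta>] by metis
  define C where "C = exp (\<delta> + (\<alpha> + \<delta>) * \<bar>ln c\<bar>)"
  define t0 where "t0 = max x0 (x0 / c)"
  show ?thesis
  proof (rule that[of C t0])
    show "C > 0" "t0 \<ge> 1" using x0 by (auto simp: C_def t0_def)
    fix t x assume t: "t \<ge> t0" and x: "x \<ge> c * t"
    have t1: "t \<ge> x0" "x0 \<le> c * t" using t c by (auto simp: t0_def field_simps)
    then have x1: "x \<ge> x0" using x by linarith
    have pos: "t > 0" "x > 0" "L t > 0" "L x > 0" using t1 x1 x0 by force+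
    have "ln (x powr (-\<alpha>) * L x) - ln (t powr (-\<alpha>) * L t) = \<alpha> * (ln t - ln x) + (ln (L x) - ln (L t))"
      using pos by (simp add: ln_mult ln_powr algebra_simps)
    also have "\<dots> \<le> \<delta> + (\<alpha> + \<delta>) * \<bar>ln c\<bar>"
    proof (cases "x \<ge> t")
      case True
      have "ln (L x) - ln (L t) \<le> \<delta> * (ln (x / t) + 1)" using pot[OF t1(1) True] by linarith
      also have "\<dots> = \<delta> * (ln x - ln t) + \<delta>" using pos by (simp add: ln_div algebra_simps)
      finally have "\<alpha> * (ln t - ln x) + (ln (L x) - ln (L t)) \<le> (\<alpha> - \<delta>) * (ln t - ln x) + \<delta>"
        by (simp add: algebra_simps)
      also have "(\<alpha> - \<delta>) * (ln t - ln x) \<le> 0"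
        using True pos \<alpha> by (intro mult_nonneg_nonpos) (auto simp: \<delta>_def)
      also have "0 \<le> (\<alpha> + \<delta>) * \<bar>ln c\<bar>" using \<alpha> \<delta> by simp
      finally show ?thesis by simp
    next
      case False
      then have "x \<le> t" by simp
      have "ln (L x) - ln (L t) \<le> \<delta> * (ln (t / x) + 1)" using pot[OF x1 \<open>x \<le> t\<close>] by linarith
      also have "\<dots> = \<delta> * (ln t - ln x) + \<delta>" using pos by (simp add: ln_div algebra_simps)
      finally have "\<alpha> * (ln t - ln x) + (ln (L x) - ln (L t)) \<le> (\<alpha> + \<delta>) * (ln t - ln x) + \<delta>"
        by (simp add: algebra_simps)
      moreover have "ln t - ln x \<le> \<bar>ln c\<bar>"
      proof -
        have "ln (c * t) \<le> ln x" using x c pos by (subst ln_le_cancel_iff) auto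
        then show ?thesis using c pos by (simp add: ln_mult)
      qed
      then have "(\<alpha> + \<delta>) * (ln t - ln x) \<le> (\<alpha> + \<delta>) * \<bar>ln c\<bar>"
        using \<alpha> \<delta> by (intro mult_left_mono) auto
      ultimately show ?thesis by linarith
    qed
    finally have le: "ln (x powr (-\<alpha>) * L x) \<le> ln C + ln (t powr (-\<alpha>) * L t)"
      by (simp add: C_def)
    have pos': "t powr (-\<alpha>) * L t > 0" "x powr (-\<alpha>) * L x > 0" "C > 0"
      using pos by (auto simp: C_def)
    then show "x powr (-\<alpha>) * L x \<le> C * (t powr (-\<alpha>) * L t)"
      using le by (subst ln_le_cancel_iff[symmetric]) (auto simp: ln_mult)
  qed
qed

text \<open>A fixed shift changes the argument by a factor tending to 1, in particular below
  \<open>exp 1\<close> in either direction, so the unchained Potter estimate applies with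
  arbitrarily small \<open>\<delta>\<close>.\<close>

lemma regularly_varying_shift:
  assumes L: "slowly_varying L"
  shows "((\<lambda>x. ((x + j) powr (-\<alpha>) * L (x + j)) / (x powr (-\<alpha>) * L x)) \<longlongrightarrow> 1) at_top"
proof -
  have shift: "((\<lambda>x. ln (L (x + j)) - ln (L x)) \<longlongrightarrow> 0) at_top"
  proof (rule tendstoI)
    fix e :: real assume "e > 0"
    then have "e / 2 > 0" by simp
    then obtain x0 where x0: "x0 \<ge> 1"
      "\<And>x y. x0 \<le> x \<Longrightarrow> x \<le> y \<Longrightarrow> y \<le> exp 1 * x \<Longrightarrow> \<bar>ln (L y) - ln (L x)\<bar> \<le> e / 2"
      using slowly_varying_potter[OF L] by metis
    have e2: "y \<le> exp 1 * x" if "y \<le> 2 * x" "0 \<le> x" for x y :: real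
      using mult_right_mono[of 2 "exp 1" x] exp_ge_add_one_self[of 1] that by linarith
    have "eventually (\<lambda>x. x \<ge> x0 + 2 * \<bar>j\<bar>) at_top" by (rule eventually_ge_at_top)
    then show "eventually (\<lambda>x. dist (ln (L (x + j)) - ln (L x)) 0 < e) at_top"
    proof eventually_elim
      case (elim x)
      have "\<bar>ln (L (x + j)) - ln (L x)\<bar> \<le> e / 2"
      proof (cases "j \<ge> 0")
        case True
        then show ?thesis using elim x0(1) by (intro x0(2) e2) auto
      next
        case False
        then have "\<bar>ln (L x) - ln (L (x + j))\<bar> \<le> e / 2" using elim x0(1) by (intro x0(2) e2) auto
        then show ?thesis by (simp add: abs_minus_commute)
      qed
      then show ?case using \<open>e > 0\<close> by (simp add: dist_norm)
    qed
  qed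
  obtain x0 where x0: "x0 \<ge> 1" "\<And>x. x \<ge> x0 \<Longrightarrow> L x > 0"
    using slowly_varying_potter[OF L zero_less_one] by metis
  have "((\<lambda>x. ((x + j) / x) powr (-\<alpha>) * exp (ln (L (x + j)) - ln (L x))) \<longlongrightarrow> 1 powr (-\<alpha>) * exp 0) at_top"
    by (intro tendsto_intros shift) (real_asymp, simp)
  then have "((\<lambda>x. ((x + j) / x) powr (-\<alpha>) * exp (ln (L (x + j)) - ln (L x))) \<longlongrightarrow> 1) at_top"
    by simp
  moreover have "eventually (\<lambda>x. ((x + j) / x) powr (-\<alpha>) * exp (ln (L (x + j)) - ln (L x))
     = ((x + j) powr (-\<alpha>) * L (x + j)) / (x powr (-\<alpha>) * L x)) at_top"
  proof -
    have "eventually (\<lambda>x. x \<ge> max x0 (x0 - j)) at_top" by (rule eventually_ge_at_top)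
    then show ?thesis
    proof eventually_elim
      case (elim x)
      then have "L x > 0" "L (x + j) > 0" "x > 0" "x + j > 0" using x0 by force+
      then show ?case by (simp add: powr_divide exp_diff)
    qed
  qed
  ultimately show ?thesis by (rule Lim_transform_eventually)
qed

lemma regularly_varying_bounds:
  assumes L: "slowly_varying L" and \<delta>: "\<delta> > 0"
  shows "eventually (\<lambda>x. x powr (-\<alpha> - \<delta>) \<le> x powr (-\<alpha>) * L x \<and> x powr (-\<alpha>) * L x \<le> x powr (-\<alpha> + \<delta>)) at_top"
proof -
  have "\<delta> / 2 > 0" using \<delta> by simp
  then obtain x0 where x0: "x0 \<ge> 1" "\<And>x. x \<ge> x0 \<Longrightarrow> L x > 0"
    and pot: "\<And>x y. x0 \<le> x \<Longrightarrow> x \<le> y \<Longrightarrow> \<bar>ln (L y) - ln (L x)\<bar> \<le> \<delta> / 2 * (ln (y / x) + 1)"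
    using slowly_varying_potter[OF L] by metis
  \<comment> \<open>Half of \<open>\<delta>\<close> is spent on the Potter bound from the fixed base
    point \<open>x0\<close>; the other half absorbs the constants.\<close>
  have ev: "eventually (\<lambda>x. \<bar>ln (L x0)\<bar> + \<delta> / 2 * (ln x - ln x0 + 1) \<le> \<delta> * ln x) at_top"
    using \<delta> by real_asymp
  have "eventually (\<lambda>x. x \<ge> x0) at_top" by (rule eventually_ge_at_top)
  then show ?thesis using ev
  proof eventually_elim
    case (elim x)
    have pos: "x > 0" "L x > 0" "x0 > 0" using elim x0 by force+
    have "\<bar>ln (L x) - ln (L x0)\<bar> \<le> \<delta> / 2 * (ln x - ln x0 + 1)"
      using pot[of x0 x] elim pos by (simp add: ln_div)
    then have "\<bar>ln (L x)\<bar> \<le> \<delta> * ln x" using elim by linarith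
    then have "- (\<delta> * ln x) \<le> ln (L x)" "ln (L x) \<le> \<delta> * ln x" by linarith+
    then have "exp (- (\<delta> * ln x)) \<le> exp (ln (L x))" "exp (ln (L x)) \<le> exp (\<delta> * ln x)" by simp_all
    then have "x powr (-\<delta>) \<le> L x" "L x \<le> x powr \<delta>"
      using pos by (simp_all add: powr_def)
    then have "x powr (-\<alpha>) * x powr (-\<delta>) \<le> x powr (-\<alpha>) * L x" "x powr (-\<alpha>) * L x \<le> x powr (-\<alpha>) * x powr \<delta>"
      by (auto intro!: mult_left_mono)
    then show ?case by (simp add: powr_add[symmetric])
  qed
qed

section \<open>Convolution operators\<close>

lemma integrable_pmf_bounded:
  fixes f :: "'b \<Rightarrow> real"
  assumes "\<And>z. \<bar>f z\<bar> \<le> A"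
  shows "integrable (measure_pmf P) f"
  by (rule measure_pmf.integrable_const_bound[where B = A]) (use assms in auto)

text \<open>An operator on functions rather than a convolution of laws: the same iterates then serve
  point masses, distribution functions and Green functions, and a restriction of the steps to
  \<open>B\<close> simply makes the kernel sub-Markovian.\<close>

definition conv_op :: "int pmf \<Rightarrow> int set \<Rightarrow> (int \<Rightarrow> real) \<Rightarrow> int \<Rightarrow> real" where
  "conv_op P B f x = (\<integral>z. indicator B z * f (x - z) \<partial>P)"

abbreviation walk_op :: "int pmf \<Rightarrow> (int \<Rightarrow> real) \<Rightarrow> int \<Rightarrow> real" where
  "walk_op P \<equiv> conv_op P UNIV"

text \<open>For the random walk $S_n$ with step law $P$, the functions \<open>walk_prob P n\<close> and
  \<open>trunc_walk P B n\<close> are $P(S_n = x)$ and the part of it carried by paths with all steps in $B$.\<close>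

definition walk_prob :: "int pmf \<Rightarrow> nat \<Rightarrow> int \<Rightarrow> real" where
  "walk_prob P n = (walk_op P ^^ n) (indicator {0})"

definition trunc_walk :: "int pmf \<Rightarrow> int set \<Rightarrow> nat \<Rightarrow> int \<Rightarrow> real" where
  "trunc_walk P B n = (conv_op P B ^^ n) (indicator {0})"

lemma walk_op_eq: "walk_op P f x = (\<integral>z. f (x - z) \<partial>P)"
  by (simp add: conv_op_def)

lemma integrable_conv:
  fixes f :: "int \<Rightarrow> real"
  assumes "\<And>x. \<bar>f x\<bar> \<le> A"
  shows "integrable (measure_pmf P) (\<lambda>z. indicator B z * f (x - z))"
proof (rule integrable_pmf_bounded)
  fix z
  have "0 \<le> A" using assms[of 0] by linarith
  then show "\<bar>indicator B z * f (x - z)\<bar> \<le> A"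
    using assms[of "x - z"] by (simp add: indicator_def)
qed

lemma conv_op_mono:
  assumes "\<And>x. \<bar>f x\<bar> \<le> A" "\<And>x. \<bar>g x\<bar> \<le> A'" "\<And>x. f x \<le> g x"
  shows "conv_op P B f x \<le> conv_op P B g x"
  unfolding conv_op_def
  by (intro integral_mono integrable_conv[OF assms(1)] integrable_conv[OF assms(2)] mult_left_mono assms(3)) auto

lemma conv_op_nonneg: "(\<And>x. 0 \<le> f x) \<Longrightarrow> 0 \<le> conv_op P B f x"
  unfolding conv_op_def by (intro integral_nonneg_AE AE_I2) auto

lemma conv_op_le:
  assumes "\<And>x. \<bar>f x\<bar> \<le> A'" "\<And>x. f x \<le> A"
  shows "conv_op P B f x \<le> A * measure P B"
proof -
  have "conv_op P B f x \<le> (\<integral>z. indicator B z * A \<partial>P)"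
    unfolding conv_op_def
    by (intro integral_mono integrable_conv[OF assms(1)] mult_left_mono assms(2)
        integrable_pmf_bounded[where A = "\<bar>A\<bar>"]) (auto simp: indicator_def)
  then show ?thesis by (simp add: mult.commute)
qed

lemma conv_op_abs_le:
  assumes "\<And>x. \<bar>f x\<bar> \<le> A"
  shows "\<bar>conv_op P B f x\<bar> \<le> A"
proof -
  have "\<bar>conv_op P B f x\<bar> \<le> (\<integral>z. \<bar>indicator B z * f (x - z)\<bar> \<partial>P)"
    unfolding conv_op_def by (rule integral_abs_bound)
  also have "\<dots> \<le> (\<integral>z. A \<partial>P)"
  proof (intro integral_mono integrable_abs integrable_conv[OF assms])
    fix z have "0 \<le> A" using assms[of 0] by linarith
    then show "\<bar>indicator B z * f (x - z)\<bar> \<le> A"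
      using assms[of "x - z"] by (simp add: indicator_def)
  qed auto
  finally show ?thesis by simp
qed

lemma conv_op_add:
  assumes "\<And>x. \<bar>f x\<bar> \<le> A" "\<And>x. \<bar>g x\<bar> \<le> A'"
  shows "conv_op P B (\<lambda>x. f x + g x) x = conv_op P B f x + conv_op P B g x"
  unfolding conv_op_def
  by (subst Bochner_Integration.integral_add[OF integrable_conv[OF assms(1)] integrable_conv[OF assms(2)], symmetric])
     (simp add: distrib_left)

lemma conv_op_split:
  assumes "\<And>x. \<bar>f x\<bar> \<le> A"
  shows "walk_op P f x = conv_op P B f x + conv_op P (- B) f x"
  unfolding conv_op_def
  by (subst Bochner_Integration.integral_add[OF integrable_conv[OF assms] integrable_conv[OF assms], symmetric])
     (auto simp: indicator_def intro!: Bochner_Integration.integral_cong)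

lemma conv_op_sum:
  assumes "\<And>i x. i \<in> I \<Longrightarrow> \<bar>f i x\<bar> \<le> A i"
  shows "conv_op P B (\<lambda>x. \<Sum>i\<in>I. f i x) x = (\<Sum>i\<in>I. conv_op P B (f i) x)"
  unfolding conv_op_def
  by (subst Bochner_Integration.integral_sum[symmetric]) (auto intro: integrable_conv assms simp: sum_distrib_left)

section \<open>Point probabilities of the free and the truncated walk\<close>

lemma walk_prob_0: "walk_prob P 0 = indicator {0}"
  by (simp add: walk_prob_def)

lemma walk_prob_Suc: "walk_prob P (Suc n) = walk_op P (walk_prob P n)"
  by (simp add: walk_prob_def)

lemma trunc_walk_0: "trunc_walk P B 0 = indicator {0}"
  by (simp add: trunc_walk_def)

lemma trunc_walk_Suc: "trunc_walk P B (Suc n) = conv_op P B (trunc_walk P B n)"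
  by (simp add: trunc_walk_def)

lemma trunc_walk_nonneg: "0 \<le> trunc_walk P B n x"
  by (induction n arbitrary: x) (simp_all add: trunc_walk_0 trunc_walk_Suc conv_op_nonneg)

lemma trunc_walk_abs_le_1: "\<bar>trunc_walk P B n x\<bar> \<le> 1"
  by (induction n arbitrary: x) (simp_all add: trunc_walk_0 trunc_walk_Suc conv_op_abs_le indicator_def)

lemma walk_prob_eq_trunc: "walk_prob P n = trunc_walk P UNIV n"
  by (simp add: walk_prob_def trunc_walk_def)

lemma walk_prob_nonneg: "0 \<le> walk_prob P n x"
  by (simp add: walk_prob_eq_trunc trunc_walk_nonneg)

lemma walk_prob_abs_le_1: "\<bar>walk_prob P n x\<bar> \<le> 1"
  by (simp add: walk_prob_eq_trunc trunc_walk_abs_le_1)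

lemma walk_prob_le_1: "walk_prob P n x \<le> 1"
  using walk_prob_abs_le_1[of P n x] by linarith

lemma trunc_walk_le_walk_prob: "trunc_walk P B n x \<le> walk_prob P n x"
proof (induction n arbitrary: x)
  case (Suc n)
  have "trunc_walk P B (Suc n) x \<le> conv_op P B (walk_prob P n) x"
    unfolding trunc_walk_Suc by (intro conv_op_mono[where A = 1 and A' = 1] Suc trunc_walk_abs_le_1 walk_prob_abs_le_1)
  also have "\<dots> \<le> walk_prob P (Suc n) x"
    unfolding walk_prob_Suc
    by (subst conv_op_split[of _ 1 P _ B]) (auto simp: walk_prob_abs_le_1 intro: conv_op_nonneg walk_prob_nonneg)
  finally show ?case .
qed (simp add: trunc_walk_0 walk_prob_0)

text \<open>Decomposition at the first step outside \<open>B\<close>: it has \<open>n\<close>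
  possible positions, and the steps before it act as a contraction, so each position costs at most
  \<open>c\<close>.\<close>

lemma walk_prob_le_trunc:
  assumes "\<And>m x. conv_op P (- B) (walk_prob P m) x \<le> c"
  shows "walk_prob P n x \<le> trunc_walk P B n x + real n * c"
proof (induction n arbitrary: x)
  case (Suc n)
  have c: "0 \<le> c"
    by (rule order_trans[OF conv_op_nonneg assms]) (rule walk_prob_nonneg)
  have bd: "\<bar>trunc_walk P B n x + real n * c\<bar> \<le> 1 + real n * c" for x
    using trunc_walk_abs_le_1[of P B n x] mult_nonneg_nonneg[of "real n" c] c by linarith
  have "conv_op P B (walk_prob P n) x \<le> conv_op P B (\<lambda>x. trunc_walk P B n x + real n * c) x"
    by (rule conv_op_mono[OF walk_prob_abs_le_1 bd Suc])
  also have "\<dots> = trunc_walk P B (Suc n) x + conv_op P B (\<lambda>x. real n * c) x"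
    unfolding trunc_walk_Suc by (rule conv_op_add[OF trunc_walk_abs_le_1 order_refl])
  also have "conv_op P B (\<lambda>x. real n * c) x \<le> real n * c"
    using conv_op_abs_le[of "\<lambda>_. real n * c" "real n * c" P B x] c by simp
  finally have "conv_op P B (walk_prob P n) x \<le> trunc_walk P B (Suc n) x + real n * c" by simp
  then show ?case
    unfolding walk_prob_Suc conv_op_split[of _ 1 P _ B, OF walk_prob_abs_le_1]
    using assms[of n x] by (simp add: algebra_simps)
qed (simp add: trunc_walk_0 walk_prob_0)

lemma sum_walk_prob_abs_le: "\<bar>\<Sum>n<M. walk_prob P n x\<bar> \<le> real M"
  using sum_bounded_above[of "{..<M}" "\<lambda>n. walk_prob P n x" 1]
  by (simp add: walk_prob_le_1 abs_of_nonneg sum_nonneg walk_prob_nonneg)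

lemma sum_walk_prob_Suc:
  "(\<Sum>n<Suc M. walk_prob P n x) = indicator {0} x + walk_op P (\<lambda>x. \<Sum>n<M. walk_prob P n x) x"
  by (subst sum.lessThan_Suc_shift, subst conv_op_sum[where A = "\<lambda>_. 1"])
     (auto simp: walk_prob_abs_le_1 walk_prob_0 walk_prob_Suc)

text \<open>A maximum principle: away from 0 the Green function up to time \<open>M + 1\<close> is
  an average of the one up to time \<open>M\<close>. It makes the supremum over \<open>x\<close> a
  concrete finite number, which can later be bounded in terms of itself.\<close>

lemma sum_walk_prob_le_0: "(\<Sum>n<M. walk_prob P n x) \<le> (\<Sum>n<M. walk_prob P n 0)"
proof (induction M arbitrary: x)
  case (Suc M)
  show ?case
  proof (cases "x = 0")
    case False
    have "walk_op P (\<lambda>x. \<Sum>n<M. walk_prob P n x) x \<le> (\<Sum>n<M. walk_prob P n 0) * measure P UNIV"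
      by (rule conv_op_le[OF sum_walk_prob_abs_le Suc])
    also have "\<dots> \<le> (\<Sum>n<Suc M. walk_prob P n 0)" by (simp add: walk_prob_nonneg)
    finally show ?thesis using False by (subst sum_walk_prob_Suc) simp
  qed simp
qed simp

text \<open>Summed form of the decomposition at the first step outside \<open>B\<close>. Wherever
  that step lands, at most \<open>A\<close> visits are expected afterwards; so only the total mass
  \<open>b\<close> of such steps counts, once for each of the \<open>M\<close> possible
  times.\<close>

lemma sum_walk_prob_le_sum_trunc:
  assumes "\<And>M x. (\<Sum>n<M. walk_prob P n x) \<le> A" "measure P (- B) \<le> b"
  shows "(\<Sum>n<M. walk_prob P n x - trunc_walk P B n x) \<le> real M * (A * b)"
proof (induction M arbitrary: x)
  case (Suc M)
  define e where "e x = (\<Sum>n<M. walk_prob P n x - trunc_walk P B n x)" for x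
  have A: "0 \<le> A" using assms(1)[where M = 0] by simp
  have b: "0 \<le> b" using assms(2) measure_nonneg order_trans by blast
  have e0: "0 \<le> e x" for x unfolding e_def by (intro sum_nonneg) (simp add: trunc_walk_le_walk_prob)
  have eb: "\<bar>e x\<bar> \<le> real M * (A * b)" for x using Suc[of x] e0[of x] by (simp add: e_def)
  have bd: "\<bar>walk_prob P n x - trunc_walk P B n x\<bar> \<le> 2" for n x
    using walk_prob_abs_le_1[of P n x] trunc_walk_abs_le_1[of P B n x] by linarith
  have "walk_prob P (Suc n) x - trunc_walk P B (Suc n) x
     = conv_op P B (\<lambda>x. walk_prob P n x - trunc_walk P B n x) x + conv_op P (- B) (walk_prob P n) x" for n
    using conv_op_add[where f = "\<lambda>x. walk_prob P n x - trunc_walk P B n x" and g = "trunc_walk P B n"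
        and A = 2 and A' = 1 and P = P and B = B and x = x, OF bd trunc_walk_abs_le_1]
    unfolding walk_prob_Suc trunc_walk_Suc conv_op_split[of _ 1 P _ B, OF walk_prob_abs_le_1] by simp
  then have "(\<Sum>n<Suc M. walk_prob P n x - trunc_walk P B n x)
     = conv_op P B e x + (\<Sum>n<M. conv_op P (- B) (walk_prob P n) x)"
    unfolding e_def
    by (subst sum.lessThan_Suc_shift, subst conv_op_sum[where A = "\<lambda>_. 2"])
       (auto simp: bd sum.distrib walk_prob_0 trunc_walk_0)
  also have "(\<Sum>n<M. conv_op P (- B) (walk_prob P n) x) = conv_op P (- B) (\<lambda>x. \<Sum>n<M. walk_prob P n x) x"
    by (rule conv_op_sum[where A = "\<lambda>_. 1", symmetric]) (rule walk_prob_abs_le_1)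
  also have "\<dots> \<le> A * measure P (- B)"
    by (rule conv_op_le[OF sum_walk_prob_abs_le assms(1)])
  also have "\<dots> \<le> A * b" using assms(2) A by (rule mult_left_mono)
  also have "conv_op P B e x \<le> real M * (A * b)"
    using conv_op_abs_le[of e, OF eb, of P B x] by linarith
  finally show ?case by (simp add: algebra_simps)
qed simp

text \<open>Exponential Markov inequality at a single point. The bound \<open>r\<close> on
  \<open>h * z\<close> over \<open>B\<close> is what makes the exponential moment finite under heavy
  tails.\<close>

lemma trunc_walk_chernoff:
  fixes P :: "int pmf"
  assumes B: "\<And>z. z \<in> B \<Longrightarrow> h * real_of_int z \<le> r"
    and m: "(\<integral>z. indicator B z * exp (h * real_of_int z) \<partial>P) \<le> m"
  shows "trunc_walk P B n x \<le> exp (- h * real_of_int x) * m ^ n"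
proof -
  have int: "integrable P (\<lambda>z. indicator B z * exp (h * real_of_int z))"
    by (rule integrable_pmf_bounded[where A = "exp r"]) (auto simp: indicator_def B)
  have m0: "0 \<le> m" by (rule order_trans[OF _ m]) (auto intro!: integral_nonneg_AE AE_I2)
  show ?thesis
  proof (induction n arbitrary: x)
    case (Suc n)
    have "trunc_walk P B (Suc n) x \<le> (\<integral>z. exp (- h * real_of_int x) * m ^ n * (indicator B z * exp (h * real_of_int z)) \<partial>P)"
      unfolding trunc_walk_Suc conv_op_def
    proof (rule integral_mono)
      show "integrable P (\<lambda>z. indicator B z * trunc_walk P B n (x - z))"
        by (rule integrable_conv[OF trunc_walk_abs_le_1])
      show "integrable P (\<lambda>z. exp (- h * real_of_int x) * m ^ n * (indicator B z * exp (h * real_of_int z)))"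
        by (intro integrable_mult_right int)
      fix z
      have "indicator B z * trunc_walk P B n (x - z) \<le> indicator B z * (exp (- h * real_of_int (x - z)) * m ^ n)"
        using Suc[of "x - z"] by (intro mult_left_mono) auto
      also have "\<dots> = exp (- h * real_of_int x) * m ^ n * (indicator B z * exp (h * real_of_int z))"
        by (simp add: algebra_simps exp_add[symmetric])
      finally show "indicator B z * trunc_walk P B n (x - z) \<le> exp (- h * real_of_int x) * m ^ n * (indicator B z * exp (h * real_of_int z))" .
    qed
    also have "\<dots> = exp (- h * real_of_int x) * m ^ n * (\<integral>z. indicator B z * exp (h * real_of_int z) \<partial>P)"
      by simp
    also have "\<dots> \<le> exp (- h * real_of_int x) * m ^ n * m"
      using m m0 by (intro mult_left_mono) auto
    finally show ?case by (simp add: mult_ac)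
  qed (simp add: trunc_walk_0 indicator_def)
qed

text \<open>$P$ dominates $\eta$ times the counting measure on an interval of $m$ points, and on this part
  the increment telescopes: one application of the operator turns a bound $D$ on the increments into
  $2 \eta A + (1 - m \eta) D$, and iterating gives about $2 A / m$.\<close>

lemma walk_op_smoothing:
  assumes pos: "\<And>z. z \<ge> z0 \<Longrightarrow> pmf P z > 0" and "\<epsilon> > 0"
  obtains k where "\<And>f A x. (\<And>y. \<bar>f y\<bar> \<le> A) \<Longrightarrow> \<bar>(walk_op P ^^ k) f (x + 1) - (walk_op P ^^ k) f x\<bar> \<le> \<epsilon> * A"
proof -
  \<comment> \<open>Half of the allowed \<open>\<epsilon>\<close> goes to the limit value
    \<open>2 / m\<close> of the iteration, the other half to the geometric remainder
    \<open>2 * \<rho> ^ k\<close>.\<close>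
  obtain m :: nat where m: "m > 0" "2 / real m < \<epsilon> / 2"
  proof -
    obtain m :: nat where "real m > 4 / \<epsilon>" using reals_Archimedean2 by blast
    moreover have "4 / \<epsilon> > 0" using \<open>\<epsilon> > 0\<close> by simp
    ultimately have "real m > 0" "real m * \<epsilon> > 4" using \<open>\<epsilon> > 0\<close> by (linarith, simp add: field_simps)
    then show ?thesis by (intro that[of m]) (auto simp: field_simps)
  qed
  define I where "I = {z0..<z0 + int m}"
  define \<eta> where "\<eta> = Min (pmf P ` I)"
  have I: "finite I" "I \<noteq> {}" "card I = m" using m by (auto simp: I_def)
  have \<eta>: "\<eta> > 0" "\<And>z. z \<in> I \<Longrightarrow> \<eta> \<le> pmf P z"
    using I pos by (auto simp: \<eta>_def I_def)
  have sumI: "(\<Sum>z\<in>I. pmf P z) = measure P I"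
    using I by (simp add: measure_measure_pmf_finite)
  have "real m * \<eta> \<le> (\<Sum>z\<in>I. pmf P z)"
    using sum_bounded_below[of I \<eta> "pmf P"] \<eta>(2) I by simp
  also have "\<dots> \<le> 1" by (simp add: sumI)
  finally have \<eta>m: "real m * \<eta> \<le> 1" .
  define \<rho> where "\<rho> = 1 - real m * \<eta>"
  have \<rho>: "0 \<le> \<rho>" "\<rho> < 1" using \<eta>m \<eta>(1) m by (auto simp: \<rho>_def)
  have step: "\<bar>walk_op P g (x + 1) - walk_op P g x\<bar> \<le> 2 * \<eta> * A + \<rho> * D"
    if g: "\<And>y. \<bar>g y\<bar> \<le> A" and D: "\<And>y. \<bar>g (y + 1) - g y\<bar> \<le> D" for g A D x
  proof -
    define d where "d z = g (x + 1 - z) - g (x - z)" for z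
    have dD: "\<bar>d z\<bar> \<le> D" for z using D[of "x - z"] by (simp add: d_def algebra_simps)
    have int_d: "integrable P d" by (rule integrable_pmf_bounded[OF dD])
    have int_dI: "integrable P (\<lambda>z. indicator S z * d z)" for S
      by (rule integrable_pmf_bounded[where A = "\<bar>D\<bar>"]) (use order_trans[OF dD abs_ge_self] in \<open>auto simp: indicator_def\<close>)
    have "walk_op P g (x + 1) - walk_op P g x = (\<integral>z. d z \<partial>P)"
      unfolding walk_op_eq d_def
      by (subst Bochner_Integration.integral_diff) (auto intro!: integrable_pmf_bounded[where A = A] g simp: algebra_simps)
    also have "\<dots> = (\<integral>z. indicator I z * d z + indicator (- I) z * d z \<partial>P)"
      by (intro Bochner_Integration.integral_cong) (auto simp: indicator_def)
    also have "\<dots> = (\<integral>z. indicator I z * d z \<partial>P) + (\<integral>z. indicator (- I) z * d z \<partial>P)"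
      by (rule Bochner_Integration.integral_add[OF int_dI int_dI])
    also have "(\<integral>z. indicator I z * d z \<partial>P) = (\<Sum>z\<in>I. (indicator I z * d z) * pmf P z)"
      by (rule integral_measure_pmf_real) (use I in \<open>auto simp: indicator_def split: if_splits\<close>)
    also have "\<dots> = (\<Sum>z\<in>I. d z * (pmf P z - \<eta>)) + \<eta> * (\<Sum>z\<in>I. d z)"
      by (simp add: sum.distrib[symmetric] sum_distrib_left algebra_simps)
    finally have eq: "walk_op P g (x + 1) - walk_op P g x
       = (\<Sum>z\<in>I. d z * (pmf P z - \<eta>)) + \<eta> * (\<Sum>z\<in>I. d z) + (\<integral>z. indicator (- I) z * d z \<partial>P)" .
    have "\<bar>\<Sum>z\<in>I. d z * (pmf P z - \<eta>)\<bar> \<le> (\<Sum>z\<in>I. D * (pmf P z - \<eta>))"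
      using \<eta>(2) dD order_trans[OF abs_ge_zero dD]
      by (intro order_trans[OF sum_abs] sum_mono) (auto simp: abs_mult intro!: mult_mono)
    also have "\<dots> = D * (measure P I - real m * \<eta>)"
      by (simp add: sum_distrib_left[symmetric] sum_subtractf sumI I)
    finally have 1: "\<bar>\<Sum>z\<in>I. d z * (pmf P z - \<eta>)\<bar> \<le> D * (measure P I - real m * \<eta>)" .
    have "(\<Sum>z\<in>I. d z) = (\<Sum>i<m. d (z0 + int i))"
      by (rule sum.reindex_bij_witness[of _ "\<lambda>i. z0 + int i" "\<lambda>z. nat (z - z0)"]) (auto simp: I_def)
    also have "\<dots> = g (x + 1 - z0) - g (x + 1 - z0 - int m)"
      by (induction m) (auto simp: d_def algebra_simps)
    finally have "\<bar>\<Sum>z\<in>I. d z\<bar> \<le> 2 * A"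
      using g[of "x + 1 - z0"] g[of "x + 1 - z0 - int m"] by linarith
    then have "\<bar>\<eta> * (\<Sum>z\<in>I. d z)\<bar> \<le> \<eta> * (2 * A)"
      using \<eta>(1) by (simp add: abs_mult)
    note 2 = this
    have "\<bar>\<integral>z. indicator (- I) z * d z \<partial>P\<bar> \<le> (\<integral>z. \<bar>indicator (- I) z * d z\<bar> \<partial>P)"
      by (rule integral_abs_bound)
    also have "\<dots> \<le> (\<integral>z. D * indicator (- I) z \<partial>P)"
      by (intro integral_mono integrable_abs int_dI integrable_pmf_bounded[where A = "\<bar>D\<bar>"])
         (use dD in \<open>auto simp: indicator_def\<close>)
    also have "\<dots> = D * (1 - measure P I)"
      by (simp add: measure_pmf.prob_compl[of I, simplified] Compl_eq_Diff_UNIV)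
    finally have 3: "\<bar>\<integral>z. indicator (- I) z * d z \<partial>P\<bar> \<le> D * (1 - measure P I)" .
    show ?thesis unfolding eq using 1 2 3 by (simp add: \<rho>_def algebra_simps)
  qed
  have bnd: "\<bar>(walk_op P ^^ k) f x\<bar> \<le> A" if "\<And>y. \<bar>f y\<bar> \<le> A" for k f A x
    using that by (induction k arbitrary: x) (auto intro: conv_op_abs_le)
  have iter: "\<bar>(walk_op P ^^ k) f (x + 1) - (walk_op P ^^ k) f x\<bar> \<le> (2 / real m + \<rho> ^ k * 2) * A"
    if f: "\<And>y. \<bar>f y\<bar> \<le> A" for k f A x
  proof (induction k arbitrary: x)
    case 0
    have "0 \<le> A" using f[of 0] by linarith
    then have "0 \<le> 2 * A / real m" by simp
    moreover have "\<bar>f (x + 1) - f x\<bar> \<le> 2 * A" using f[of "x + 1"] f[of x] by linarith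
    ultimately have "\<bar>f (x + 1) - f x\<bar> \<le> 2 * A / real m + 2 * A" by linarith
    then show ?case by (simp add: distrib_right)
  next
    case (Suc k)
    have "\<bar>(walk_op P ^^ Suc k) f (x + 1) - (walk_op P ^^ Suc k) f x\<bar>
      \<le> 2 * \<eta> * A + \<rho> * ((2 / real m + \<rho> ^ k * 2) * A)"
      using step[where g = "(walk_op P ^^ k) f" and x = x, OF bnd Suc] f by simp
    \<comment> \<open>\<open>2 / m\<close> is the fixed point of
      \<open>D \<mapsto> 2 * \<eta> + \<rho> * D\<close>, because
      \<open>1 - \<rho> = m * \<eta>\<close>.\<close>
    also have "\<dots> = (2 / real m + \<rho> ^ Suc k * 2) * A"
      using m by (simp add: \<rho>_def field_simps)
    finally show ?case .
  qed
  have "(\<lambda>k. \<rho> ^ k * 2) \<longlonglongrightarrow> 0 * 2"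
    using \<rho> by (intro tendsto_intros LIMSEQ_realpow_zero) auto
  then have "eventually (\<lambda>k. \<rho> ^ k * 2 < \<epsilon> / 2) sequentially"
    by (rule order_tendstoD) (use \<open>\<epsilon> > 0\<close> in auto)
  then obtain k where k: "\<rho> ^ k * 2 < \<epsilon> / 2" by (auto dest: eventually_happens)
  show ?thesis
  proof (rule that[of k])
    fix f :: "int \<Rightarrow> real" and A x assume f: "\<And>y. \<bar>f y\<bar> \<le> A"
    have "0 \<le> A" using f[of 0] by linarith
    then have "(2 / real m + \<rho> ^ k * 2) * A \<le> \<epsilon> * A"
      using k m by (intro mult_right_mono) auto
    moreover have "\<bar>(walk_op P ^^ k) f (x + 1) - (walk_op P ^^ k) f x\<bar> \<le> (2 / real m + \<rho> ^ k * 2) * A"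
      by (rule iter) (rule f)
    ultimately show "\<bar>(walk_op P ^^ k) f (x + 1) - (walk_op P ^^ k) f x\<bar> \<le> \<epsilon> * A" by linarith
  qed
qed

section \<open>The renewal theorem\<close>

text \<open>Telescoping over \<open>\<bar>z\<bar>\<close> unit steps. It is used with
  \<open>a = 0\<close> to show that the Green function hardly moves near \<open>t\<close>, and with
  its value at \<open>t\<close> as \<open>a\<close> to linearize the summed distribution
  functions.\<close>

lemma increments_linear_approx:
  fixes V :: "int \<Rightarrow> real"
  assumes "\<And>x. \<bar>x - t\<bar> \<le> \<bar>z\<bar> \<Longrightarrow> \<bar>V x - V (x - 1) - a\<bar> \<le> b"
  shows "\<bar>V t - V (t - z) - real_of_int z * a\<bar> \<le> \<bar>real_of_int z\<bar> * b"
proof -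
  have pos: "\<bar>V t - V (t - int n) - real n * a\<bar> \<le> real n * b"
    if "\<And>x. \<bar>x - t\<bar> \<le> int n \<Longrightarrow> \<bar>V x - V (x - 1) - a\<bar> \<le> b" for n
    using that
  proof (induction n)
    case (Suc n)
    have "\<bar>V (t - int n) - V (t - int n - 1) - a\<bar> \<le> b" by (rule Suc.prems) simp
    moreover have "\<bar>V t - V (t - int n) - real n * a\<bar> \<le> real n * b"
      by (rule Suc.IH) (use Suc.prems in simp)
    moreover have "t - int (Suc n) = t - int n - 1" by simp
    ultimately show ?case by (simp only: of_nat_Suc distrib_right)
  qed simp
  have neg: "\<bar>V t - V (t + int n) + real n * a\<bar> \<le> real n * b"
    if "\<And>x. \<bar>x - t\<bar> \<le> int n \<Longrightarrow> \<bar>V x - V (x - 1) - a\<bar> \<le> b" for n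
    using that
  proof (induction n)
    case (Suc n)
    have "\<bar>V (t + int n + 1) - V (t + int n + 1 - 1) - a\<bar> \<le> b" by (rule Suc.prems) simp
    moreover have "\<bar>V t - V (t + int n) + real n * a\<bar> \<le> real n * b"
      by (rule Suc.IH) (use Suc.prems in simp)
    moreover have "t + int (Suc n) = t + int n + 1" "t + int n + 1 - 1 = t + int n" by simp_all
    ultimately show ?case by (simp only: of_nat_Suc distrib_right)
  qed simp
  show ?thesis
  proof (cases "z \<ge> 0")
    case True
    then show ?thesis using pos[of "nat z"] assms by simp
  next
    case False
    then show ?thesis using neg[of "nat (- z)"] assms by simp
  qed
qed

text \<open>This is the probability of \<open>S_n \<le> x\<close>, read as
  \<open>0 \<le> x - S_n\<close>.\<close>

definition walk_cdf :: "int pmf \<Rightarrow> nat \<Rightarrow> int \<Rightarrow> real" where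
  "walk_cdf P n = (walk_op P ^^ n) (indicator {0..})"

lemma walk_cdf_nonneg: "0 \<le> walk_cdf P n x"
  unfolding walk_cdf_def by (induction n arbitrary: x) (auto intro: conv_op_nonneg)

lemma walk_cdf_abs_le_1: "\<bar>walk_cdf P n x\<bar> \<le> 1"
  unfolding walk_cdf_def
  by (induction n arbitrary: x) (auto intro: conv_op_abs_le simp: indicator_def)

lemma walk_cdf_Suc: "walk_cdf P (Suc n) = walk_op P (walk_cdf P n)"
  by (simp add: walk_cdf_def)

lemma walk_cdf_diff: "walk_cdf P n x - walk_cdf P n (x - 1) = walk_prob P n x"
proof (induction n arbitrary: x)
  case (Suc n)
  have int: "integrable P (\<lambda>z. walk_cdf P n (y - z))" for y
    by (rule integrable_pmf_bounded[OF walk_cdf_abs_le_1])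
  have "walk_cdf P (Suc n) x - walk_cdf P (Suc n) (x - 1)
     = (\<integral>z. walk_cdf P n (x - z) - walk_cdf P n (x - 1 - z) \<partial>P)"
    unfolding walk_cdf_Suc walk_op_eq by (rule Bochner_Integration.integral_diff[symmetric, OF int int])
  also have "\<dots> = walk_prob P (Suc n) x"
    unfolding walk_prob_Suc walk_op_eq Suc[symmetric] by (simp add: algebra_simps)
  finally show ?case .
qed (auto simp: walk_cdf_def walk_prob_def indicator_def)

text \<open>Markov property at time \<open>k\<close>: all but the first \<open>k\<close> terms of
  the Green function lie in the range of the \<open>k\<close>-th power of the operator, where
  smoothing applies.\<close>

lemma sum_walk_prob_add:
  "(\<Sum>n<k + M. walk_prob P n x) = (\<Sum>n<k. walk_prob P n x) + (walk_op P ^^ k) (\<lambda>x. \<Sum>n<M. walk_prob P n x) x"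
proof -
  have "(walk_op P ^^ k) (\<lambda>x. \<Sum>n<M. walk_prob P n x) x = (\<Sum>n<M. walk_prob P (k + n) x)"
  proof (induction k arbitrary: x)
    case (Suc k)
    have "(walk_op P ^^ Suc k) (\<lambda>x. \<Sum>n<M. walk_prob P n x) x = walk_op P (\<lambda>x. \<Sum>n<M. walk_prob P (k + n) x) x"
      using Suc by (simp cong: if_cong) (metis ext)
    also have "\<dots> = (\<Sum>n<M. walk_op P (walk_prob P (k + n)) x)"
      by (rule conv_op_sum[where A = "\<lambda>_. 1"]) (rule walk_prob_abs_le_1)
    finally show ?case by (simp add: walk_prob_Suc)
  qed simp
  moreover have "(\<Sum>n<k + M. walk_prob P n x) = (\<Sum>n<k. walk_prob P n x) + (\<Sum>n<M. walk_prob P (k + n) x)"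
    by (induction M) (auto simp: add.assoc)
  ultimately show ?thesis by simp
qed

text \<open>The law of \<open>S_n\<close> as a genuine measure, for arguments that use total mass 1
  (decay of point masses at infinity) or integrate over the position of the walk.\<close>

fun walk_pmf :: "int pmf \<Rightarrow> nat \<Rightarrow> int pmf" where
  "walk_pmf P 0 = return_pmf 0"
| "walk_pmf P (Suc n) = bind_pmf P (\<lambda>z. map_pmf ((+) z) (walk_pmf P n))"

lemma pmf_walk_pmf: "pmf (walk_pmf P n) x = walk_prob P n x"
proof (induction n arbitrary: x)
  case (Suc n)
  have "pmf (map_pmf ((+) z) W) x = pmf W (x - z)" for z W
    using pmf_map_inj'[of "(+) z" W "x - z"] by simp
  then show ?case using Suc by (simp add: pmf_bind walk_prob_Suc walk_op_eq)
qed (simp add: walk_prob_0 indicator_def)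

lemma pmf_tendsto_0: "(pmf W \<longlongrightarrow> 0) cofinite"
proof (rule tendstoI)
  fix e :: real assume "e > 0"
  have "finite {x. pmf W x \<ge> e}"
  proof (rule ccontr)
    assume inf: "infinite {x. pmf W x \<ge> e}"
    obtain n where n: "1 / e < real n" using reals_Archimedean2 by blast
    obtain F where F: "finite F" "card F = n" "F \<subseteq> {x. pmf W x \<ge> e}"
      using infinite_arbitrarily_large[OF inf, of n] by blast
    have "real n * e \<le> sum (pmf W) F" using sum_bounded_below[of F e "pmf W"] F by auto
    also have "\<dots> \<le> 1" using F(1) by (simp add: measure_measure_pmf_finite[symmetric])
    finally show False using n \<open>e > 0\<close> by (simp add: field_simps)
  qed
  then show "eventually (\<lambda>x. dist (pmf W x) 0 < e) cofinite"
    unfolding eventually_cofinite by (rule rev_finite_subset) auto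
qed

lemma filterlim_cofinite_inj: "inj f \<Longrightarrow> filterlim f cofinite cofinite"
  unfolding filterlim_iff eventually_cofinite using finite_vimageI[of "{x. \<not> Q x}" f for Q] by (auto simp: vimage_def)

text \<open>Positivity of the mass on a half-line \<open>z \<ge> z0\<close> takes the place of
  aperiodicity; it also supplies the intervals on which the smoothing argument bounds
  \<open>P\<close> from below.\<close>

locale renewal_walk =
  fixes P :: "int pmf" and \<mu> :: real and z0 :: int
  assumes integrable_P: "integrable P real_of_int"
    and mean: "\<mu> = (\<integral>z. real_of_int z \<partial>P)" and mean_pos: "\<mu> > 0"
    and pmf_pos: "\<And>z. z \<ge> z0 \<Longrightarrow> pmf P z > 0"
begin

abbreviation w :: "nat \<Rightarrow> int \<Rightarrow> real" where "w \<equiv> walk_prob P"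

abbreviation green :: "nat \<Rightarrow> int \<Rightarrow> real" where "green M x \<equiv> (\<Sum>n<M. w n x)"

text \<open>Error in the renewal identity truncated at time \<open>M\<close>. For
  \<open>x \<ge> 0\<close> the bracket tends to 1 as \<open>M\<close> grows, since the walk drifts
  to the right, so a small defect says that the Green function is close to
  \<open>1 / \<mu>\<close>.\<close>

abbreviation defect :: "nat \<Rightarrow> int \<Rightarrow> real" where
  "defect M x \<equiv> \<mu> * green M x - (walk_cdf P 0 x - walk_cdf P M x)"

definition tail_mean :: "nat \<Rightarrow> real" where
  "tail_mean J = (\<integral>z. \<bar>real_of_int z\<bar> * indicator {z. \<bar>z\<bar> > int J} z \<partial>P)"

definition abs_mean :: real where "abs_mean = (\<integral>z. \<bar>real_of_int z\<bar> \<partial>P)"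

lemma abs_mean_nonneg: "abs_mean \<ge> 0"
  unfolding abs_mean_def by (intro integral_nonneg_AE) auto

lemma tail_mean_tendsto_0: "tail_mean \<longlonglongrightarrow> 0"
proof -
  have "(\<lambda>J. \<integral>z. \<bar>real_of_int z\<bar> * indicator {z. \<bar>z\<bar> > int J} z \<partial>P) \<longlonglongrightarrow> (\<integral>z. 0 \<partial>P)"
  proof (rule integral_dominated_convergence[where w = "\<lambda>z. \<bar>real_of_int z\<bar>"])
    show "AE z in P. (\<lambda>J. \<bar>real_of_int z\<bar> * indicator {z. \<bar>z\<bar> > int J} z) \<longlonglongrightarrow> 0"
    proof (rule AE_I2)
      fix z :: int
      have "eventually (\<lambda>J. J \<ge> nat \<bar>z\<bar>) sequentially" by (rule eventually_ge_at_top)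
      then have "eventually (\<lambda>J. \<bar>real_of_int z\<bar> * indicator {z. \<bar>z\<bar> > int J} z = 0) sequentially"
        by eventually_elim (auto simp: indicator_def)
      then show "(\<lambda>J. \<bar>real_of_int z\<bar> * indicator {z. \<bar>z\<bar> > int J} z) \<longlonglongrightarrow> 0"
        by (rule tendsto_eventually)
    qed
  qed (use integrable_P in \<open>auto simp: indicator_def\<close>)
  then show ?thesis by (simp add: tail_mean_def[abs_def])
qed

text \<open>$V = \sum_{n<M} P(S_n \le \cdot)$ satisfies $V(t) - E V(t - X) = P(S_0 \le t) - P(S_M \le t)$, while
  $V(t) - V(t - z)$ is close to $z u(t)$ wherever its increment $u$ is nearly constant around $t$.\<close>

lemma renewal_estimate:
  assumes A: "\<And>x. green M x \<le> A"
    and D: "\<And>x. \<bar>x - t\<bar> \<le> int J + 1 \<Longrightarrow> \<bar>green M (x + 1) - green M x\<bar> \<le> D"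
  shows "\<bar>defect M t\<bar>
     \<le> real J * D * abs_mean + 2 * A * tail_mean J"
proof -
  define u where "u x = green M x" for x
  define V where "V x = (\<Sum>n<M. walk_cdf P n x)" for x
  have u0: "0 \<le> u x" for x by (simp add: u_def sum_nonneg walk_prob_nonneg)
  have uA: "u x \<le> A" for x using A by (simp add: u_def)
  have A0: "0 \<le> A" using u0[of 0] uA[of 0] by linarith
  have Vu: "V x - V (x - 1) = u x" for x
    by (simp add: V_def u_def sum_subtractf[symmetric] walk_cdf_diff)
  have D': "\<bar>u (x + 1) - u x\<bar> \<le> D" if "\<bar>x - t\<bar> \<le> int J + 1" for x
    using D[OF that] by (simp add: u_def)
  have D0: "D \<ge> 0" using D'[of t] by linarith
  have u_near: "\<bar>u x - u t\<bar> \<le> real J * D" if "\<bar>x - t\<bar> \<le> int J" for x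
  proof -
    have "\<bar>u t - u (t - (t - x)) - real_of_int (t - x) * 0\<bar> \<le> \<bar>real_of_int (t - x)\<bar> * D"
    proof (rule increments_linear_approx)
      fix y assume "\<bar>y - t\<bar> \<le> \<bar>t - x\<bar>"
      then have y: "\<bar>y - t\<bar> \<le> int J" using that by linarith
      show "\<bar>u y - u (y - 1) - 0\<bar> \<le> D"
        using D'[of "y - 1"] y by simp
    qed
    also have "\<dots> \<le> real J * D" using that D0 by (intro mult_right_mono) linarith+
    finally show ?thesis by (simp add: abs_minus_commute)
  qed
  \<comment> \<open>Jumps up to \<open>J\<close> stay where the Green function is nearly constant;
    for longer jumps only \<open>0 \<le> u \<le> A\<close> is used, and integrability of the step
    makes their share \<open>tail_mean J\<close> small.\<close>
  have approx: "\<bar>V t - V (t - z) - real_of_int z * u t\<bar>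
     \<le> real J * D * \<bar>real_of_int z\<bar> + 2 * A * (\<bar>real_of_int z\<bar> * indicator {z. \<bar>z\<bar> > int J} z)" for z
  proof (cases "\<bar>z\<bar> \<le> int J")
    case True
    have "\<bar>V t - V (t - z) - real_of_int z * u t\<bar> \<le> \<bar>real_of_int z\<bar> * (real J * D)"
      by (rule increments_linear_approx) (use u_near True Vu in auto)
    then show ?thesis using True by (simp add: mult_ac)
  next
    case False
    have "\<bar>V t - V (t - z) - real_of_int z * u t\<bar> \<le> \<bar>real_of_int z\<bar> * (2 * A)"
    proof (rule increments_linear_approx)
      fix x
      show "\<bar>V x - V (x - 1) - u t\<bar> \<le> 2 * A"
        unfolding Vu using u0[of x] u0[of t] uA[of x] uA[of t] by linarith
    qed
    moreover have "0 \<le> real J * D * \<bar>real_of_int z\<bar>" using D0 by simp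
    ultimately show ?thesis using False by (simp add: mult_ac)
  qed
  have Vb: "\<bar>V x\<bar> \<le> real M" for x
    using sum_bounded_above[of "{..<M}" "\<lambda>n. walk_cdf P n x" 1] walk_cdf_abs_le_1[of P _ x]
    by (auto simp: V_def abs_of_nonneg sum_nonneg walk_cdf_nonneg abs_le_D1)
  have intV: "integrable P (\<lambda>z. V (t - z))"
    by (rule integrable_pmf_bounded[OF Vb])
  have "(\<integral>z. V t - V (t - z) \<partial>P) = V t - walk_op P V t"
    using intV by (simp add: walk_op_eq)
  also have "walk_op P V t = (\<Sum>n<M. walk_cdf P (Suc n) t)"
    unfolding V_def walk_cdf_Suc by (rule conv_op_sum[where A = "\<lambda>_. 1"]) (rule walk_cdf_abs_le_1)
  also have "V t - (\<Sum>n<M. walk_cdf P (Suc n) t) = walk_cdf P 0 t - walk_cdf P M t"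
    unfolding V_def by (induction M) auto
  finally have telescope: "(\<integral>z. V t - V (t - z) \<partial>P) = walk_cdf P 0 t - walk_cdf P M t" .
  have int_abs: "integrable P (\<lambda>z. \<bar>real_of_int z\<bar>)" using integrable_P by simp
  have int_tail: "integrable P (\<lambda>z. \<bar>real_of_int z\<bar> * indicator {z. \<bar>z\<bar> > int J} z)"
    by (rule Bochner_Integration.integrable_bound[OF int_abs]) (auto simp: indicator_def)
  have int_g: "integrable P (\<lambda>z. V t - V (t - z) - real_of_int z * u t)"
    using intV integrable_P by auto
  have "(\<integral>z. V t - V (t - z) - real_of_int z * u t \<partial>P) = (walk_cdf P 0 t - walk_cdf P M t) - \<mu> * u t"
    using intV integrable_P telescope by (simp add: mean)
  moreover have "\<bar>\<integral>z. V t - V (t - z) - real_of_int z * u t \<partial>P\<bar>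
    \<le> (\<integral>z. \<bar>V t - V (t - z) - real_of_int z * u t\<bar> \<partial>P)"
    by (rule integral_abs_bound)
  moreover have "\<dots> \<le> (\<integral>z. real J * D * \<bar>real_of_int z\<bar> + 2 * A * (\<bar>real_of_int z\<bar> * indicator {z. \<bar>z\<bar> > int J} z) \<partial>P)"
    by (intro integral_mono integrable_abs int_g Bochner_Integration.integrable_add integrable_mult_right int_abs int_tail approx)
  moreover have "\<dots> = real J * D * abs_mean + 2 * A * tail_mean J"
    using int_abs int_tail by (simp add: abs_mean_def tail_mean_def)
  ultimately show ?thesis unfolding u_def by linarith
qed

text \<open>Smoothing acts only after \<open>k\<close> steps, so the first \<open>k\<close> terms
  survive as an explicit error; it is at most \<open>2 * k\<close> everywhere and vanishes far from
  the origin.\<close>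

lemma sum_walk_prob_increment:
  assumes k: "\<And>f A x. (\<And>y. \<bar>f y\<bar> \<le> A) \<Longrightarrow> \<bar>(walk_op P ^^ k) f (x + 1) - (walk_op P ^^ k) f x\<bar> \<le> \<epsilon> * A"
    and A: "\<And>x. green M x \<le> A" and \<epsilon>: "\<epsilon> \<ge> 0"
  shows "\<bar>green M (x + 1) - green M x\<bar>
     \<le> (\<Sum>n<k. w n (x + 1) + w n x) + \<epsilon> * A"
proof (cases "k \<le> M")
  case True
  then obtain m where m: "M = k + m" by (auto simp: le_iff_add)
  define f where "f x = (\<Sum>n<m. w n x)" for x
  have "\<bar>f y\<bar> \<le> A" for y
  proof -
    have "f y \<le> green M y"
      unfolding f_def by (rule sum_mono2) (auto simp: m walk_prob_nonneg)
    then show ?thesis using A[of y] by (simp add: f_def sum_nonneg walk_prob_nonneg)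
  qed
  then have "\<bar>(walk_op P ^^ k) f (x + 1) - (walk_op P ^^ k) f x\<bar> \<le> \<epsilon> * A" by (rule k)
  moreover have "green M y = (\<Sum>n<k. w n y) + (walk_op P ^^ k) f y" for y
    unfolding m f_def[abs_def] by (rule sum_walk_prob_add)
  moreover have "0 \<le> (\<Sum>n<k. w n y)" for y by (simp add: sum_nonneg walk_prob_nonneg)
  from this[of x] this[of "x + 1"] have "\<bar>(\<Sum>n<k. w n (x + 1)) - (\<Sum>n<k. w n x)\<bar>
      \<le> (\<Sum>n<k. w n (x + 1)) + (\<Sum>n<k. w n x)" by linarith
  ultimately show ?thesis by (simp add: sum.distrib)
next
  case False
  have nn: "0 \<le> green M y" for y by (simp add: sum_nonneg walk_prob_nonneg)
  have "0 \<le> A" using nn[of x] A[of x] by linarith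
  then have "0 \<le> \<epsilon> * A" using \<epsilon> by simp
  moreover have "green M y \<le> (\<Sum>n<k. w n y)" for y
    using False by (intro sum_mono2) (auto simp: walk_prob_nonneg)
  from this[of x] this[of "x + 1"] nn[of x] nn[of "x + 1"]
  have "\<bar>green M (x + 1) - green M x\<bar>
     \<le> (\<Sum>n<k. w n (x + 1)) + (\<Sum>n<k. w n x)" by linarith
  ultimately show ?thesis by (simp add: sum.distrib)
qed

text \<open>The constants \<open>J\<close> and \<open>k\<close> depend on \<open>e\<close> alone,
  while \<open>M\<close> and the bound \<open>A\<close> are free: the estimate is first applied with
  the still uncontrolled \<open>A = green M 0\<close>, and again once a bound uniform in
  \<open>M\<close> is known.\<close>

definition renewal_bound :: "real \<Rightarrow> nat \<Rightarrow> nat \<Rightarrow> bool" where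
  "renewal_bound e J k \<longleftrightarrow> (\<forall>M A t b. (\<forall>x. green M x \<le> A) \<longrightarrow>
      (\<forall>x. \<bar>x - t\<bar> \<le> int J + 1 \<longrightarrow> (\<Sum>n<k. w n (x + 1) + w n x) \<le> b) \<longrightarrow>
      \<bar>defect M t\<bar> \<le> real J * b * abs_mean + e * A)"

lemma renewal_bound_exists:
  assumes "e > 0"
  shows "\<exists>J k. renewal_bound e J k"
proof -
  have "eventually (\<lambda>J. tail_mean J < e / 4) sequentially"
    by (rule order_tendstoD[OF tail_mean_tendsto_0]) (use assms in simp)
  then obtain J where J: "tail_mean J < e / 4" by (auto dest: eventually_happens)
  \<comment> \<open>The smoothing error enters multiplied by \<open>J * abs_mean\<close> and may use
    \<open>e / 2\<close>, the long jumps use the rest; the \<open>+ 1\<close> keeps the denominator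
    positive.\<close>
  define d where "d = e / (2 * (real J * abs_mean + 1))"
  have JE: "real J * abs_mean \<ge> 0" using abs_mean_nonneg by simp
  then have d: "d > 0" using assms by (simp add: d_def)
  have dJE: "real J * abs_mean * d \<le> e / 2"
  proof -
    have "real J * abs_mean * d \<le> (real J * abs_mean + 1) * d" using d by simp
    also have "\<dots> = e / 2" using JE by (simp add: d_def field_simps)
    finally show ?thesis .
  qed
  obtain k where k: "\<And>f A x. (\<And>y. \<bar>f y\<bar> \<le> A) \<Longrightarrow> \<bar>(walk_op P ^^ k) f (x + 1) - (walk_op P ^^ k) f x\<bar> \<le> d * A"
    using walk_op_smoothing[OF pmf_pos d] by metis
  show ?thesis
    unfolding renewal_bound_def
  proof (rule exI[of _ J], rule exI[of _ k], intro allI impI)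
    fix M A t b
    assume "\<forall>x. green M x \<le> A"
      and b: "\<forall>x. \<bar>x - t\<bar> \<le> int J + 1 \<longrightarrow> (\<Sum>n<k. w n (x + 1) + w n x) \<le> b"
    then have A: "\<And>x. green M x \<le> A" by blast
    have A0: "0 \<le> A" by (rule order_trans[OF _ A[of 0]]) (simp add: sum_nonneg walk_prob_nonneg)
    have "\<bar>defect M t\<bar>
      \<le> real J * (b + d * A) * abs_mean + 2 * A * tail_mean J"
    proof (rule renewal_estimate[OF A])
      fix x assume x: "\<bar>x - t\<bar> \<le> int J + 1"
      have "\<bar>green M (x + 1) - green M x\<bar>
          \<le> (\<Sum>n<k. w n (x + 1) + w n x) + d * A"
        by (rule sum_walk_prob_increment[OF _ A]) (use k d in auto)
      then show "\<bar>green M (x + 1) - green M x\<bar> \<le> b + d * A"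
        using b x by force
    qed
    moreover have "2 * A * tail_mean J \<le> 2 * A * (e / 4)" using J A0 by (intro mult_left_mono) auto
    moreover have "real J * abs_mean * d * A \<le> e / 2 * A" using dJE A0 by (rule mult_right_mono)
    ultimately show "\<bar>defect M t\<bar> \<le> real J * b * abs_mean + e * A"
      by (simp add: algebra_simps)
  qed
qed

text \<open>Self-improvement: with \<open>e = \<mu> / 2\<close> and \<open>A = green M 0\<close> the
  renewal estimate bounds \<open>\<mu> * green M 0\<close> by a constant plus half of itself,
  uniformly in \<open>M\<close>. This gives transience.\<close>

lemma green_bounded: obtains A where "A > 0" "\<And>M x. green M x \<le> A"
proof -
  have "\<mu> / 2 > 0" using mean_pos by simp
  then obtain J k where approx: "renewal_bound (\<mu> / 2) J k" using renewal_bound_exists by blast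
  define A where "A = 2 * (1 + real J * (2 * real k) * abs_mean) / \<mu>"
  have "green M x \<le> A" for M x
  proof -
    define a where "a = green M 0"
    have "\<bar>\<mu> * a - (walk_cdf P 0 0 - walk_cdf P M 0)\<bar> \<le> real J * (2 * real k) * abs_mean + \<mu> / 2 * a"
      unfolding a_def
    proof (rule approx[unfolded renewal_bound_def, rule_format])
      fix x
      show "green M x \<le> green M 0" by (rule sum_walk_prob_le_0)
      have "(\<Sum>n<k. w n (x + 1) + w n x) \<le> (\<Sum>n<k. 2)"
        by (intro sum_mono) (metis add_mono one_add_one walk_prob_le_1)
      then show "(\<Sum>n<k. w n (x + 1) + w n x) \<le> 2 * real k" by simp
    qed
    moreover have "walk_cdf P 0 0 - walk_cdf P M 0 \<le> 1"
      using walk_cdf_nonneg[of P M 0] walk_cdf_abs_le_1[of P 0 0] by linarith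
    ultimately have "\<mu> * a \<le> 1 + real J * (2 * real k) * abs_mean + \<mu> / 2 * a" by linarith
    then have "a \<le> A" using mean_pos by (simp add: A_def field_simps)
    then show ?thesis using sum_walk_prob_le_0[of P x M] by (simp add: a_def)
  qed
  then have "green M x \<le> max A 1" for M x
    by (simp add: max.coboundedI1)
  then show ?thesis by (intro that[of "max A 1"]) auto
qed

lemma walk_prob_summable: "summable (\<lambda>n. w n x)"
proof -
  obtain A where "\<And>M x. green M x \<le> A" using green_bounded by metis
  then show ?thesis by (intro summableI_nonneg_bounded[where x = A]) (auto simp: walk_prob_nonneg)
qed

text \<open>The error from the first \<open>k\<close> steps disappears as \<open>t\<close> goes to
  infinity in either direction. Uniformity in \<open>M\<close> allows \<open>M\<close> to tend to
  infinity at fixed \<open>t\<close>; the cofinite filter makes far negative points available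
  too.\<close>

lemma renewal_error:
  assumes "e > 0"
  shows "eventually (\<lambda>t. \<forall>M. \<bar>defect M t\<bar> \<le> e) cofinite"
proof -
  obtain A where A: "A > 0" "\<And>M x. green M x \<le> A" using green_bounded by metis
  have "e / (2 * A) > 0" using assms A by simp
  then obtain J k where approx: "renewal_bound (e / (2 * A)) J k" using renewal_bound_exists by blast
  define d where "d = e / (2 * (real J * abs_mean + 1))"
  have JE: "real J * abs_mean \<ge> 0" using abs_mean_nonneg by simp
  then have d: "d > 0" using assms by (simp add: d_def)
  have "real J * d * abs_mean \<le> (real J * abs_mean + 1) * d" using d by (simp add: algebra_simps)
  also have "\<dots> = e / 2" using JE by (simp add: d_def field_simps)
  finally have dJE: "real J * d * abs_mean \<le> e / 2" .
  have lim: "((\<lambda>t. \<Sum>n<k. w n (t + j + 1) + w n (t + j)) \<longlongrightarrow> (\<Sum>n<k. 0 + 0)) cofinite" for j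
  proof -
    have "((\<lambda>t. pmf (walk_pmf P n) (t + z)) \<longlongrightarrow> 0) cofinite" for n z
      by (rule filterlim_compose[OF pmf_tendsto_0 filterlim_cofinite_inj]) (simp add: inj_def)
    from this[of _ j] this[of _ "j + 1"] show ?thesis
      by (intro tendsto_sum tendsto_add) (simp_all add: pmf_walk_pmf add.assoc)
  qed
  have "eventually (\<lambda>t. \<forall>j\<in>{- int J - 1..int J + 1}. (\<Sum>n<k. w n (t + j + 1) + w n (t + j)) < d) cofinite"
    by (intro eventually_ball_finite ballI order_tendstoD(2)[OF lim]) (use d in auto)
  then show ?thesis
  proof (eventually_elim, intro allI)
    fix t M assume t: "\<forall>j\<in>{- int J - 1..int J + 1}. (\<Sum>n<k. w n (t + j + 1) + w n (t + j)) < d"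
    have "\<bar>defect M t\<bar> \<le> real J * d * abs_mean + e / (2 * A) * A"
    proof (rule approx[unfolded renewal_bound_def, rule_format, OF A(2)])
      fix x assume "\<bar>x - t\<bar> \<le> int J + 1"
      then show "(\<Sum>n<k. w n (x + 1) + w n x) \<le> d"
        using t[rule_format, of "x - t"] by (auto simp: abs_le_iff)
    qed
    then show "\<bar>defect M t\<bar> \<le> e"
      using dJE A(1) by simp
  qed
qed

lemma walk_cdf_diff_sum: "walk_cdf P M (s + int m) - walk_cdf P M s = (\<Sum>i<m. w M (s + int i + 1))"
proof (induction m)
  case (Suc m)
  have "walk_cdf P M (s + int m + 1) - walk_cdf P M (s + int m) = w M (s + int m + 1)"
    using walk_cdf_diff[of P M "s + int m + 1"] by simp
  then show ?case using Suc by (simp add: algebra_simps)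
qed simp

theorem renewal_theorem: "(\<lambda>t. \<Sum>n. w n (int t)) \<longlonglongrightarrow> 1 / \<mu>"
proof -
  have "(\<lambda>t. \<mu> * (\<Sum>n. w n (int t))) \<longlonglongrightarrow> 1"
  proof (rule tendstoI)
    fix e :: real assume "e > 0"
    then have e4: "e / 4 > 0" by simp
    have "filterlim int cofinite sequentially"
      unfolding cofinite_eq_sequentially[symmetric] by (rule filterlim_cofinite_inj) simp
    from eventually_compose_filterlim[OF renewal_error[OF e4] this]
    show "eventually (\<lambda>t. dist (\<mu> * (\<Sum>n. w n (int t))) 1 < e) sequentially"
    proof eventually_elim
      case (elim t)
      txt \<open>At a far negative point $s$ the estimate forces $P(S_M \le s)$ to be small for all $M$,
        and $P(s < S_M \le t)$ tends to 0 by transience.\<close>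
      have "infinite {..<0 :: int}" by (rule infinite_Iio)
      then obtain s where s: "s < 0" and err: "\<And>M. \<bar>defect M s\<bar> \<le> e / 4"
        using renewal_error[OF e4] unfolding eventually_cofinite
        by (metis (mono_tags, lifting) lessThan_iff mem_Collect_eq rev_finite_subset subsetI)
      \<comment> \<open>At \<open>s < 0\<close> the defect equals
        \<open>\<mu> * green M s + walk_cdf P M s\<close>, a sum of two nonnegative terms. This
        takes the place of a law of large numbers.\<close>
      have cs: "walk_cdf P M s \<le> e / 4" for M
      proof -
        have "walk_cdf P 0 s = 0" using s by (simp add: walk_cdf_def)
        moreover have "0 \<le> \<mu> * green M s"
          using mean_pos by (simp add: sum_nonneg walk_prob_nonneg)
        ultimately show ?thesis using err[of M] by linarith
      qed
      define m where "m = nat (int t - s)"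
      have m: "s + int m = int t" using s by (simp add: m_def)
      have "(\<lambda>M. \<Sum>i<m. w M (s + int i + 1)) \<longlonglongrightarrow> (\<Sum>i<m. 0)"
        by (intro tendsto_sum summable_LIMSEQ_zero walk_prob_summable)
      then have "eventually (\<lambda>M. (\<Sum>i<m. w M (s + int i + 1)) < e / 4) sequentially"
        by (rule order_tendstoD) (use e4 in simp)
      then have ev: "eventually (\<lambda>M. \<bar>\<mu> * green M (int t) - 1\<bar> \<le> 3 * (e / 4)) sequentially"
      proof eventually_elim
        case (elim M)
        have "walk_cdf P 0 (int t) = 1" by (simp add: walk_cdf_def)
        moreover have "walk_cdf P M (int t) < e / 2"
          using walk_cdf_diff_sum[of M s m] cs[of M] elim unfolding m by linarith
        ultimately show ?case
          using \<open>\<forall>M. \<bar>defect M (int t)\<bar> \<le> e / 4\<close>[rule_format, of M]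
            walk_cdf_nonneg[of P M "int t"] by linarith
      qed
      have "(\<lambda>M. \<bar>\<mu> * green M (int t) - 1\<bar>) \<longlonglongrightarrow> \<bar>\<mu> * (\<Sum>n. w n (int t)) - 1\<bar>"
        by (intro tendsto_intros summable_LIMSEQ walk_prob_summable)
      from tendsto_upperbound[OF this ev] have "\<bar>\<mu> * (\<Sum>n. w n (int t)) - 1\<bar> \<le> 3 * (e / 4)" by simp
      then show ?case using \<open>e > 0\<close> by (simp add: dist_norm)
    qed
  qed
  then have "(\<lambda>t. inverse \<mu> * (\<mu> * (\<Sum>n. w n (int t)))) \<longlonglongrightarrow> inverse \<mu> * 1"
    by (intro tendsto_intros)
  moreover have "inverse \<mu> * (\<mu> * y) = y" for y using mean_pos by simp
  ultimately show ?thesis by (simp add: inverse_eq_divide)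
qed

end

section \<open>Visits far from the mean\<close>

lemma exp_le_quadratic_neg:
  assumes "0 \<le> (x::real)"
  shows "exp (- x) \<le> 1 - x + x\<^sup>2"
proof -
  have pos: "1 + x + x\<^sup>2 / 2 > 0" using assms by (intro add_pos_nonneg) auto
  have "exp (- x) \<le> 1 / (1 + x + x\<^sup>2 / 2)"
    unfolding exp_minus inverse_eq_divide
    by (rule divide_left_mono[OF exp_lower_Taylor_quadratic[OF assms]]) (use pos in auto)
  also have "\<dots> \<le> 1 - x + x\<^sup>2"
  proof -
    have "(1 - x + x\<^sup>2) * (1 + x + x\<^sup>2 / 2) = 1 + (x^2 + x^3 + x^4) / 2"
      by (simp add: field_simps power2_eq_square power3_eq_cube power4_eq_xxxx)
    then have "1 \<le> (1 - x + x\<^sup>2) * (1 + x + x\<^sup>2 / 2)" using assms by simp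
    then show ?thesis using pos by (simp add: divide_le_eq)
  qed
  finally show ?thesis .
qed

text \<open>First-order Taylor bound whose remainder needs only a moment of order
  \<open>q \<le> 2\<close>. For \<open>\<bar>y\<bar> \<le> 1\<close> the quadratic remainder is
  below \<open>\<bar>y\<bar> powr q\<close>; for \<open>y > 1\<close> the factor
  \<open>exp r\<close> alone suffices; for \<open>y < - 1\<close> the term
  \<open>\<bar>y\<bar> powr q\<close> outweighs the negative \<open>y\<close>.\<close>

lemma exp_le_powr_bound:
  fixes y r q :: real
  assumes "y \<le> r" "0 \<le> r" "1 \<le> q" "q \<le> 2"
  shows "exp y \<le> 1 + y + \<bar>y\<bar> powr q * exp r"
proof -
  have er: "1 \<le> exp r" using assms by simp
  have le: "\<bar>y\<bar> powr q \<le> \<bar>y\<bar> powr q * exp r"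
    using mult_left_mono[OF er, of "\<bar>y\<bar> powr q"] by simp
  consider "\<bar>y\<bar> \<le> 1" | "y > 1" | "y < -1" by linarith
  then show ?thesis
  proof cases
    case 1
    have "exp y \<le> 1 + y + y\<^sup>2"
    proof (cases "y \<ge> 0")
      case True then show ?thesis using exp_bound[of y] 1 by linarith
    next
      case False then show ?thesis using exp_le_quadratic_neg[of "- y"] by simp
    qed
    also have "y\<^sup>2 \<le> \<bar>y\<bar> powr q"
    proof (cases "y = 0")
      case False
      then have "y\<^sup>2 = \<bar>y\<bar> powr 2" by (simp add: powr_numeral)
      also have "\<dots> \<le> \<bar>y\<bar> powr q" using 1 assms False by (intro powr_mono') auto
      finally show ?thesis .
    qed simp
    finally show ?thesis using le by linarith
  next
    case 2
    then have "exp y \<le> 1 * exp r" using assms by simp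
    also have "\<dots> \<le> \<bar>y\<bar> powr q * exp r"
      using 2 assms ge_one_powr_ge_zero[of y q] by (intro mult_right_mono) auto
    finally show ?thesis using 2 by linarith
  next
    case 3
    then have "\<bar>y\<bar> powr 1 \<le> \<bar>y\<bar> powr q" using assms by (intro powr_mono) auto
    then have "- y \<le> \<bar>y\<bar> powr q" using 3 by simp
    moreover have "exp y \<le> 1" using 3 by simp
    ultimately show ?thesis using le by linarith
  qed
qed

text \<open>Commutativity of convolution. Integrating over the rest of the walk instead of the
  distinguished step exposes \<open>pmf P (t - y)\<close>, to which regular variation
  applies.\<close>

lemma conv_op_swap:
  "conv_op P B (pmf W) t = (\<integral>y. indicator B (t - y) * pmf P (t - y) \<partial>measure_pmf W)"
proof -
  have "conv_op P B (pmf W) t = enn2real (\<integral>\<^sup>+z. ennreal (indicator B z * pmf W (t - z)) \<partial>P)"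
    unfolding conv_op_def by (rule integral_eq_nn_integral) auto
  also have "(\<integral>\<^sup>+z. ennreal (indicator B z * pmf W (t - z)) \<partial>P)
     = (\<integral>\<^sup>+z. ennreal (pmf P z) * ennreal (indicator B z * pmf W (t - z)) \<partial>count_space UNIV)"
    by (rule nn_integral_measure_pmf)
  also have "\<dots> = (\<integral>\<^sup>+y. ennreal (pmf P (t - y)) * ennreal (indicator B (t - y) * pmf W (t - (t - y))) \<partial>count_space UNIV)"
    by (rule nn_integral_bij_count_space[symmetric])
       (auto simp: bij_def inj_def surj_def intro!: exI[of _ "t - _"])
  also have "\<dots> = (\<integral>\<^sup>+y. ennreal (pmf W y) * ennreal (indicator B (t - y) * pmf P (t - y)) \<partial>count_space UNIV)"
    by (intro nn_integral_cong) (simp add: ennreal_mult'[symmetric] mult_ac)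
  also have "\<dots> = (\<integral>\<^sup>+y. ennreal (indicator B (t - y) * pmf P (t - y)) \<partial>measure_pmf W)"
    by (rule nn_integral_measure_pmf[symmetric])
  also have "enn2real \<dots> = (\<integral>y. indicator B (t - y) * pmf P (t - y) \<partial>measure_pmf W)"
    by (rule integral_eq_nn_integral[symmetric]) auto
  finally show ?thesis .
qed

lemma conv_op_walk_swap:
  "conv_op P B (walk_prob P n) t = (\<integral>y. indicator B (t - y) * pmf P (t - y) \<partial>walk_pmf P n)"
  using conv_op_swap[of P B "walk_pmf P n" t] by (simp add: pmf_walk_pmf[abs_def])

locale moment_walk = renewal_walk +
  fixes q :: real
  assumes q: "1 < q" "q < 2"
    and moment: "integrable P (\<lambda>z. \<bar>real_of_int z\<bar> powr q)"
begin

definition K :: real where "K = (\<integral>z. \<bar>real_of_int z\<bar> powr q \<partial>P)"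

lemma K_nonneg: "K \<ge> 0"
  unfolding K_def by (intro integral_nonneg_AE) auto

text \<open>The truncation is one-sided, in the direction of $h$: on the removed part the bound
  $1 + h z + |h z|^q e^r$ is still positive, so the mean needs no correction.\<close>

lemma truncated_mgf_le:
  assumes "r \<ge> 0"
  shows "(\<integral>z. indicator {z. h * real_of_int z \<le> r} z * exp (h * real_of_int z) \<partial>P)
    \<le> exp (h * \<mu> + K * \<bar>h\<bar> powr q * exp r)"
proof -
  have "(\<integral>z. indicator {z. h * real_of_int z \<le> r} z * exp (h * real_of_int z) \<partial>P)
     \<le> (\<integral>z. 1 + h * real_of_int z + \<bar>h\<bar> powr q * exp r * \<bar>real_of_int z\<bar> powr q \<partial>P)"
  proof (rule integral_mono)
    show "integrable P (\<lambda>z. indicator {z. h * real_of_int z \<le> r} z * exp (h * real_of_int z))"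
      by (rule integrable_pmf_bounded[where A = "exp r"]) (auto simp: indicator_def)
    show "integrable P (\<lambda>z. 1 + h * real_of_int z + \<bar>h\<bar> powr q * exp r * \<bar>real_of_int z\<bar> powr q)"
      using integrable_P moment by auto
    fix z :: int
    have eq: "\<bar>h\<bar> powr q * exp r * \<bar>real_of_int z\<bar> powr q = \<bar>h * real_of_int z\<bar> powr q * exp r"
      by (simp add: abs_mult powr_mult mult_ac)
    show "indicator {z. h * real_of_int z \<le> r} z * exp (h * real_of_int z)
        \<le> 1 + h * real_of_int z + \<bar>h\<bar> powr q * exp r * \<bar>real_of_int z\<bar> powr q"
    proof (cases "h * real_of_int z \<le> r")
      case True
      then show ?thesis using exp_le_powr_bound[of "h * real_of_int z" r q] q assms by (simp add: eq)
    next
      case False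
      then have "0 \<le> h * real_of_int z" using assms by linarith
      then show ?thesis using False by (simp add: eq)
    qed
  qed
  also have "\<dots> = 1 + (h * \<mu> + K * \<bar>h\<bar> powr q * exp r)"
    using integrable_P moment by (simp add: mean K_def)
  also have "\<dots> \<le> exp (h * \<mu> + K * \<bar>h\<bar> powr q * exp r)" by (rule exp_ge_add_one_self)
  finally show ?thesis .
qed

lemma trunc_walk_le:
  assumes "r \<ge> 0"
  shows "trunc_walk P {z. h * real_of_int z \<le> r} n t
    \<le> exp (- h * (real_of_int t - real n * \<mu>) + real n * (K * \<bar>h\<bar> powr q * exp r))"
proof -
  have "trunc_walk P {z. h * real_of_int z \<le> r} n t
     \<le> exp (- h * real_of_int t) * exp (h * \<mu> + K * \<bar>h\<bar> powr q * exp r) ^ n"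
    by (rule trunc_walk_chernoff[where r = r]) (auto intro: truncated_mgf_le[OF assms])
  also have "\<dots> = exp (- h * (real_of_int t - real n * \<mu>) + real n * (K * \<bar>h\<bar> powr q * exp r))"
    by (simp add: exp_of_nat_mult[symmetric] exp_add[symmetric] algebra_simps)
  finally show ?thesis .
qed

lemma tail_markov:
  assumes "r > 0"
  shows "measure P (- {z. h * real_of_int z \<le> r}) \<le> K * (\<bar>h\<bar> / r) powr q"
proof (cases "h = 0")
  case False
  have "- {z. h * real_of_int z \<le> r} \<subseteq> {z. \<bar>real_of_int z\<bar> powr q \<ge> (r / \<bar>h\<bar>) powr q}"
  proof
    fix z assume "z \<in> - {z. h * real_of_int z \<le> r}"
    then have "r \<le> \<bar>h\<bar> * \<bar>real_of_int z\<bar>" by (simp add: abs_mult[symmetric])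
    then have "r / \<bar>h\<bar> \<le> \<bar>real_of_int z\<bar>" using False by (simp add: field_simps)
    then show "z \<in> {z. \<bar>real_of_int z\<bar> powr q \<ge> (r / \<bar>h\<bar>) powr q}"
      using q assms by (auto intro!: powr_mono2)
  qed
  then have "measure P (- {z. h * real_of_int z \<le> r}) \<le> measure P {z. \<bar>real_of_int z\<bar> powr q \<ge> (r / \<bar>h\<bar>) powr q}"
    by (intro measure_pmf.finite_measure_mono) auto
  also have "\<dots> \<le> K / (r / \<bar>h\<bar>) powr q"
    using integral_Markov_inequality_measure[OF moment, of UNIV "(r / \<bar>h\<bar>) powr q"] assms False by (simp add: K_def)
  also have "\<dots> = K * (\<bar>h\<bar> / r) powr q"
    using assms False by (simp add: powr_divide)
  finally show ?thesis .
qed (use assms q in auto)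

text \<open>The cap on \<open>M\<close> keeps the number of steps within reach of a Chernoff bound
  at distance \<open>Y\<close>. It is used with \<open>\<theta> = 1\<close> for dyadic blocks, where
  \<open>Y\<close> is of order \<open>M\<close>, and with \<open>\<theta> = 1 / \<kappa>\<close>
  around the window, where \<open>Y = t powr \<kappa>\<close>.\<close>

definition visit_bound :: "real \<Rightarrow> real \<Rightarrow> real \<Rightarrow> real \<Rightarrow> bool" where
  "visit_bound D \<theta> C Y0 \<longleftrightarrow> (\<forall>Y\<ge>Y0. \<forall>M t S. real M \<le> D * Y powr \<theta> \<longrightarrow> S \<subseteq> {..<M} \<longrightarrow>
     (\<forall>n\<in>S. \<bar>real_of_int t - real n * \<mu>\<bar> \<ge> Y) \<longrightarrow> (\<Sum>n\<in>S. w n t) \<le> C * real M * Y powr (- q))"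

text \<open>Only the tail of the law is used, not its local behaviour: jumps beyond the truncation level have
  total mass $O(Y^{-q})$, and summing over $n$ bounds their contribution by the Green function.\<close>

lemma visits:
  assumes \<theta>: "\<theta> < q" and D: "D > 0"
  obtains C Y0 where "C > 0" "visit_bound D \<theta> C Y0"
proof -
  obtain A where A: "A > 0" "\<And>M x. green M x \<le> A" using green_bounded by metis
  \<comment> \<open>Jumps will be truncated at \<open>Y / k\<close>. Then
    \<open>exp r = Y powr (q / k)\<close> uses half of the margin \<open>q - \<theta>\<close>, and
    the other half, \<open>Y powr (- e)\<close>, beats the logarithms.\<close>
  define k where "k = 2 * q / (q - \<theta>)"
  have k: "k > 0" "q / k = (q - \<theta>) / 2" using q \<theta> by (auto simp: k_def)
  define e where "e = (q - \<theta>) / 2"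
  have e: "e > 0" using \<theta> by (simp add: e_def)
  define C where "C = exp 1 + 2 * (A * (K * k powr q))"
  have "((\<lambda>Y. D * K * (Y powr (- e) * (q * ln Y) powr q)) \<longlongrightarrow> 0) at_top"
    using e q by real_asymp
  then have "eventually (\<lambda>Y. D * K * (Y powr (- e) * (q * ln Y) powr q) < 1) at_top"
    by (rule order_tendstoD) simp
  then obtain Y1 where Y1: "\<And>Y. Y \<ge> Y1 \<Longrightarrow> D * K * (Y powr (- e) * (q * ln Y) powr q) < 1"
    by (auto simp: eventually_at_top_linorder)
  show ?thesis
  proof (rule that[of C "max Y1 2"])
    show "C > 0" using A K_nonneg by (auto simp: C_def intro!: add_pos_nonneg)
    show "visit_bound D \<theta> C (max Y1 2)"
      unfolding visit_bound_def
    proof (intro allI impI)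
      fix Y :: real and M :: nat and t :: int and S
      assume Y: "max Y1 2 \<le> Y" and M: "real M \<le> D * Y powr \<theta>" and S: "S \<subseteq> {..<M}"
        and far: "\<forall>n\<in>S. \<bar>real_of_int t - real n * \<mu>\<bar> \<ge> Y"
      have Ypos: "Y > 0" "Y > 1" using Y by auto
      then have lnY: "ln Y > 0" by simp
      \<comment> \<open>Tuned so that a deviation \<open>Y\<close> in the direction
        \<open>\<sigma>\<close> costs \<open>exp (- q * ln Y) = Y powr (- q)\<close>.\<close>
      define h where "h \<sigma> = \<sigma> * (q * ln Y / Y)" for \<sigma> :: real
      define r where "r = q / k * ln Y"
      have r: "r > 0" using q k lnY by (simp add: r_def)
      have habs: "\<bar>h \<sigma>\<bar> = q * ln Y / Y" if "\<sigma> \<in> {- 1, 1}" for \<sigma>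
        using that q lnY Ypos by (auto simp: h_def)
      define B where "B \<sigma> = {z. h \<sigma> * real_of_int z \<le> r}" for \<sigma>
      have er: "exp r = Y powr ((q - \<theta>) / 2)" using Ypos by (simp add: r_def k powr_def)
      have v: "trunc_walk P (B \<sigma>) n t \<le> exp 1 * Y powr (- q)"
        if \<sigma>: "\<sigma> \<in> {- 1, 1}" and "n \<in> S" and side: "Y \<le> \<sigma> * (real_of_int t - real n * \<mu>)" for \<sigma> n
      proof -
        have n: "real n \<le> D * Y powr \<theta>" using \<open>n \<in> S\<close> S M by (auto simp: subset_iff)
        have "h \<sigma> * (real_of_int t - real n * \<mu>) = q * ln Y / Y * (\<sigma> * (real_of_int t - real n * \<mu>))"
          by (simp add: h_def)
        also have "\<dots> \<ge> q * ln Y / Y * Y"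
          using side q lnY Ypos by (intro mult_left_mono) auto
        finally have 1: "- h \<sigma> * (real_of_int t - real n * \<mu>) \<le> - q * ln Y" using Ypos by simp
        have "real n * (K * \<bar>h \<sigma>\<bar> powr q * exp r) \<le> D * Y powr \<theta> * (K * \<bar>h \<sigma>\<bar> powr q * exp r)"
          using n K_nonneg by (intro mult_right_mono) auto
        also have "\<dots> = D * K * (Y powr (- e) * (q * ln Y) powr q)"
        proof -
          have "Y powr (- e) = Y powr \<theta> * (Y powr (- q) * Y powr ((q - \<theta>) / 2))"
            unfolding powr_add[symmetric] by (rule arg_cong2[where f = "(powr)"]) (simp_all add: e_def field_simps)
          moreover have "\<bar>h \<sigma>\<bar> powr q = (q * ln Y) powr q * Y powr (- q)"
            unfolding habs[OF \<sigma>] using Ypos lnY q by (subst powr_divide) (auto simp: powr_minus_divide)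
          ultimately show ?thesis by (simp add: er mult_ac)
        qed
        also have "\<dots> < 1" using Y by (intro Y1) simp
        finally have 2: "real n * (K * \<bar>h \<sigma>\<bar> powr q * exp r) < 1" .
        have "trunc_walk P (B \<sigma>) n t
           \<le> exp (- h \<sigma> * (real_of_int t - real n * \<mu>) + real n * (K * \<bar>h \<sigma>\<bar> powr q * exp r))"
          unfolding B_def by (rule trunc_walk_le) (use r in simp)
        also have "\<dots> \<le> exp (- q * ln Y + 1)" using 1 2 by simp
        also have "\<dots> = exp 1 * Y powr (- q)" using Ypos by (simp add: exp_diff exp_minus powr_def divide_inverse)
        finally show ?thesis .
      qed
      have tail: "measure P (- B \<sigma>) \<le> K * k powr q * Y powr (- q)" if "\<sigma> \<in> {- 1, 1}" for \<sigma>
      proof -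
        have "\<bar>h \<sigma>\<bar> / r = k / Y" using q k lnY Ypos by (simp add: habs[OF that] r_def)
        moreover have "(k / Y) powr q = k powr q * Y powr (- q)"
          using Ypos k by (subst powr_divide) (auto simp: powr_minus_divide)
        ultimately show ?thesis using tail_markov[OF r, of "h \<sigma>"] unfolding B_def by simp
      qed
      \<comment> \<open>A time is estimated with the truncation on its own side of the mean. Adding
        both nonnegative corrections for every \<open>n\<close> avoids splitting \<open>S\<close>
        and allows summation over all \<open>n < M\<close>.\<close>
      define d where "d \<sigma> n = w n t - trunc_walk P (B \<sigma>) n t" for \<sigma> n
      have d0: "d \<sigma> n \<ge> 0" for \<sigma> n by (simp add: d_def trunc_walk_le_walk_prob)
      have "w n t \<le> exp 1 * Y powr (- q) + (d (- 1) n + d 1 n)" if "n \<in> S" for n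
      proof -
        have "Y \<le> 1 * (real_of_int t - real n * \<mu>) \<or> Y \<le> - 1 * (real_of_int t - real n * \<mu>)"
          using far[rule_format, OF that] by (simp add: abs_if split: if_splits)
        then show ?thesis
          using v[of 1 n] v[of "- 1" n] that d0[of 1 n] d0[of "- 1" n] by (auto simp: d_def)
      qed
      then have "(\<Sum>n\<in>S. w n t) \<le> (\<Sum>n\<in>S. exp 1 * Y powr (- q) + (d (- 1) n + d 1 n))"
        by (rule sum_mono)
      also have "\<dots> \<le> (\<Sum>n<M. exp 1 * Y powr (- q) + (d (- 1) n + d 1 n))"
        using S d0 by (intro sum_mono2) auto
      also have "\<dots> = real M * (exp 1 * Y powr (- q)) + ((\<Sum>n<M. d (- 1) n) + (\<Sum>n<M. d 1 n))"
        by (simp add: sum.distrib)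
      also have "(\<Sum>n<M. d (- 1) n) \<le> real M * (A * (K * k powr q * Y powr (- q)))"
        unfolding d_def by (rule sum_walk_prob_le_sum_trunc[OF A(2) tail]) simp
      also have "(\<Sum>n<M. d 1 n) \<le> real M * (A * (K * k powr q * Y powr (- q)))"
        unfolding d_def by (rule sum_walk_prob_le_sum_trunc[OF A(2) tail]) simp
      finally show "(\<Sum>n\<in>S. w n t) \<le> C * real M * Y powr (- q)"
        by (simp add: C_def algebra_simps)
    qed
  qed
qed

end

section \<open>Local asymptotics for few summands\<close>

lemma bounded_convergence_pmf:
  fixes f :: "nat \<Rightarrow> 'b \<Rightarrow> real"
  assumes lim: "\<And>x. (\<lambda>i. f i x) \<longlonglongrightarrow> g x"
    and bound: "eventually (\<lambda>i. \<forall>x. \<bar>f i x\<bar> \<le> c) sequentially"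
  shows "(\<lambda>i. \<integral>x. f i x \<partial>measure_pmf W) \<longlonglongrightarrow> (\<integral>x. g x \<partial>measure_pmf W)"
proof -
  obtain N where N: "\<And>i x. i \<ge> N \<Longrightarrow> \<bar>f i x\<bar> \<le> c" using bound by (auto simp: eventually_sequentially)
  have "(\<lambda>i. \<integral>x. f (i + N) x \<partial>measure_pmf W) \<longlonglongrightarrow> (\<integral>x. g x \<partial>measure_pmf W)"
    by (rule integral_dominated_convergence[where w = "\<lambda>_. c"])
       (auto intro!: LIMSEQ_ignore_initial_segment[OF lim] N)
  then show ?thesis by (rule LIMSEQ_offset)
qed

locale heavy_walk = renewal_walk +
  fixes \<alpha> :: real and L :: "real \<Rightarrow> real"
  assumes alpha: "2 < \<alpha>" "\<alpha> < 3" and slowly_varying_L: "slowly_varying L"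
    and pmf_eq: "\<And>t::nat. t \<ge> 1 \<Longrightarrow> pmf P (int t) = real t powr (- \<alpha>) * L (real t)"
    and moments: "\<And>q. 1 < q \<Longrightarrow> q < \<alpha> - 1 \<Longrightarrow> integrable P (\<lambda>z. \<bar>real_of_int z\<bar> powr q)"
begin

lemma moment_walk: "1 < q \<Longrightarrow> q < \<alpha> - 1 \<Longrightarrow> moment_walk P \<mu> z0 q"
  by unfold_locales (use alpha moments in auto)

lemma pmf_int_eq: "z \<ge> 1 \<Longrightarrow> pmf P z = real_of_int z powr (- \<alpha>) * L (real_of_int z)"
  using pmf_eq[of "nat z"] by simp

lemma pmf_dominated:
  assumes "c > 0"
  obtains C T where "C > 0" "T \<ge> 1" "\<And>t x. t \<ge> T \<Longrightarrow> real_of_int x \<ge> c * real_of_int t \<Longrightarrow> pmf P x \<le> C * pmf P t"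
proof -
  have "\<alpha> > 0" using alpha by simp
  then obtain C t0 where C: "C > 0" "t0 \<ge> 1"
    "\<And>t x. t \<ge> t0 \<Longrightarrow> x \<ge> c * t \<Longrightarrow> x powr (-\<alpha>) * L x \<le> C * (t powr (-\<alpha>) * L t)"
    using regularly_varying_dominated[OF slowly_varying_L _ assms] by metis
  define T where "T = \<lceil>t0\<rceil>"
  show ?thesis
  proof (rule that[of C T])
    show "T \<ge> 1" using C(2) by (simp add: T_def)
    fix t x assume t: "T \<le> t" and x: "c * real_of_int t \<le> real_of_int x"
    have t0: "real_of_int t \<ge> t0" "t \<ge> 1" using t C(2) by (auto simp: T_def ceiling_le_iff)
    then have "0 < c * real_of_int t" using assms by simp
    then have "x \<ge> 1" using x by linarith
    then show "pmf P x \<le> C * pmf P t"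
      using C(3)[OF t0(1) x] t0(2) by (simp add: pmf_int_eq)
  qed (use C in auto)
qed

lemma pmf_shift: "(\<lambda>t. pmf P (int t - z) / pmf P (int t)) \<longlonglongrightarrow> 1"
proof -
  have "(\<lambda>t. ((real t + - real_of_int z) powr (-\<alpha>) * L (real t + - real_of_int z)) / (real t powr (-\<alpha>) * L (real t))) \<longlonglongrightarrow> 1"
    by (rule filterlim_compose[OF regularly_varying_shift[OF slowly_varying_L] filterlim_real_sequentially])
  moreover have "eventually (\<lambda>t. ((real t + - real_of_int z) powr (-\<alpha>) * L (real t + - real_of_int z)) / (real t powr (-\<alpha>) * L (real t))
      = pmf P (int t - z) / pmf P (int t)) sequentially"
  proof -
    have "eventually (\<lambda>t. t \<ge> nat \<bar>z\<bar> + 1) sequentially" by (rule eventually_ge_at_top)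
    then show ?thesis by eventually_elim (simp add: pmf_int_eq)
  qed
  ultimately show ?thesis by (rule Lim_transform_eventually)
qed

lemma pmf_bounds:
  assumes "\<delta> > 0"
  shows "eventually (\<lambda>t::nat. real t powr (- \<alpha> - \<delta>) \<le> pmf P (int t) \<and> pmf P (int t) \<le> real t powr (- \<alpha> + \<delta>)) sequentially"
proof -
  have "eventually (\<lambda>t. real t powr (- \<alpha> - \<delta>) \<le> real t powr (- \<alpha>) * L (real t) \<and>
      real t powr (- \<alpha>) * L (real t) \<le> real t powr (- \<alpha> + \<delta>)) sequentially"
    using filterlim_real_sequentially regularly_varying_bounds[OF slowly_varying_L assms] eventually_compose_filterlim by blast
  then show ?thesis using eventually_ge_at_top[of 1]
    by eventually_elim (simp add: pmf_eq)
qed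

text \<open>Here \<open>S_n\<close> exceeds its mean by at least \<open>t / 2\<close>. With all
  steps at most \<open>t / k\<close> a Chernoff bound gives
  \<open>O(t powr (- \<alpha> - 1))\<close>, which is below \<open>pmf P t\<close>; a longer step
  can occur at \<open>n\<close> places, and at each of them its point mass is at most
  \<open>C * pmf P t\<close>.\<close>

lemma local_one_big_jump:
  obtains C where "C > 0"
    "eventually (\<lambda>t. \<forall>n. 2 * \<mu> * real n \<le> real t \<longrightarrow> w n (int t) \<le> C * real n * pmf P (int t)) sequentially"
proof -
  define q where "q = \<alpha> / 2"
  have q: "1 < q" "q < \<alpha> - 1" using alpha by (auto simp: q_def)
  interpret moment_walk P \<mu> z0 q using q by (rule moment_walk)
  \<comment> \<open>This makes \<open>\<beta> / k = (q - 1) / 2\<close>, so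
    \<open>exp r = t powr e\<close> and the correction \<open>n * K * h powr q * exp r\<close> is
    \<open>t powr (- e)\<close> up to logarithms.\<close>
  define k where "k = 4 * (\<alpha> + 1) / (q - 1)"
  have k: "k > 0" using q alpha by (simp add: k_def)
  obtain C T where C: "C > 0" "T \<ge> 1" and dom: "\<And>t x. t \<ge> T \<Longrightarrow> real_of_int x \<ge> (1 / k) * real_of_int t \<Longrightarrow> pmf P x \<le> C * pmf P t"
    using pmf_dominated[of "1 / k"] k by (metis zero_less_divide_1_iff)
  define e where "e = (q - 1) / 2"
  have e: "e > 0" using q by (simp add: e_def)
  \<comment> \<open>With \<open>h = \<beta> * ln t / t\<close> a deviation of \<open>t / 2\<close>
    costs exactly \<open>t powr (- \<alpha> - 1)\<close>.\<close>
  define \<beta> where "\<beta> = 2 * (\<alpha> + 1)"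
  have \<beta>: "\<beta> > 0" using alpha by (simp add: \<beta>_def)
  have "(\<lambda>t::nat. 1 / (2 * \<mu>) * (K * (real t powr (- e) * (\<beta> * ln (real t)) powr q))) \<longlonglongrightarrow> 0"
    using e q \<beta> by real_asymp
  then have ev1: "eventually (\<lambda>t::nat. 1 / (2 * \<mu>) * (K * (real t powr (- e) * (\<beta> * ln (real t)) powr q)) < 1) sequentially"
    by (rule order_tendstoD) simp
  have ev2: "eventually (\<lambda>t::nat. real t powr (- \<alpha> - 1) \<le> pmf P (int t)) sequentially"
    using pmf_bounds[of 1] by (auto elim: eventually_mono)
  have "eventually (\<lambda>t. \<forall>n. 2 * \<mu> * real n \<le> real t \<longrightarrow> w n (int t) \<le> (exp 1 + C) * real n * pmf P (int t)) sequentially"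
    using ev1 ev2 eventually_ge_at_top[of "max 2 (nat T)"]
  proof eventually_elim
    case (elim t)
    then have t: "real t > 1" "int t \<ge> T" by auto
    then have lnt: "ln (real t) > 0" by simp
    define h where "h = \<beta> * ln (real t) / real t"
    have h: "h > 0" using \<beta> lnt t by (simp add: h_def)
    define r where "r = h * (real t / k)"
    have r: "r \<ge> 0" using h t k by (simp add: r_def)
    define B where "B = {z. h * real_of_int z \<le> r}"
    have er: "exp r = real t powr e"
    proof -
      have "r = \<beta> / k * ln (real t)" using t by (simp add: r_def h_def)
      also have "\<beta> / k = e" using q alpha by (simp add: k_def e_def \<beta>_def divide_simps)
      finally have "r = e * ln (real t)" .
      then show ?thesis using t by (simp add: powr_def)
    qed
    show ?case
    proof (intro allI impI)
      fix n :: nat assume n2: "2 * \<mu> * real n \<le> real t"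
      show "w n (int t) \<le> (exp 1 + C) * real n * pmf P (int t)"
      proof (cases "n = 0")
        case True
        then show ?thesis using t by (simp add: walk_prob_0)
      next
        case False
        then have n: "1 \<le> n" "2 * \<mu> * real n \<le> real t" using n2 by auto
        have jump: "conv_op P (- B) (w m) x \<le> C * pmf P (int t)" for m x
        proof -
          have "conv_op P (- B) (w m) x \<le> (\<integral>y. C * pmf P (int t) \<partial>walk_pmf P m)"
            unfolding conv_op_walk_swap
          proof (intro integral_mono)
            show "integrable (walk_pmf P m) (\<lambda>y. indicator (- B) (x - y) * pmf P (x - y))"
              by (rule integrable_pmf_bounded[where A = 1]) (auto simp: indicator_def pmf_le_1)
          next
            fix y :: int
            have "pmf P (x - y) \<le> C * pmf P (int t)" if "x - y \<notin> B"
            proof (rule dom)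
              show "(1 / k) * real_of_int (int t) \<le> real_of_int (x - y)"
              proof -
                have "h * (real t / k) < h * real_of_int (x - y)"
                  using that unfolding B_def r_def by (simp only: mem_Collect_eq not_le)
                then show ?thesis using h by (simp only: mult_less_cancel_left_pos) simp
              qed
            qed (use t in simp)
            then show "indicator (- B) (x - y) * pmf P (x - y) \<le> C * pmf P (int t)"
              using C by (auto simp: indicator_def)
          qed auto
          then show ?thesis by simp
        qed
        have 1: "- h * (real_of_int (int t) - real n * \<mu>) \<le> - (\<alpha> + 1) * ln (real t)"
        proof -
          have "(\<alpha> + 1) * ln (real t) = h * (real t / 2)" using t by (simp add: h_def \<beta>_def field_simps)
          also have "\<dots> \<le> h * (real t - real n * \<mu>)" using n h by (intro mult_left_mono) (auto simp: field_simps)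
          finally show ?thesis by (simp only: mult_minus_left neg_le_iff_le of_int_of_nat_eq)
        qed
        have 2: "real n * (K * \<bar>h\<bar> powr q * exp r) < 1"
        proof -
          have "real n \<le> real t / (2 * \<mu>)" using n mean_pos by (simp add: field_simps)
          then have "real n * (K * \<bar>h\<bar> powr q * exp r) \<le> real t / (2 * \<mu>) * (K * \<bar>h\<bar> powr q * exp r)"
            using K_nonneg by (intro mult_right_mono) auto
          also have "\<dots> = 1 / (2 * \<mu>) * (K * (real t powr (- e) * (\<beta> * ln (real t)) powr q))"
          proof -
            have "\<bar>h\<bar> powr q = (\<beta> * ln (real t)) powr q * real t powr (- q)"
              unfolding h_def using t lnt \<beta> by (simp add: abs_mult) (simp add: powr_divide powr_minus_divide)
            moreover have "real t powr (- e) = real t powr 1 * (real t powr (- q) * real t powr e)"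
              unfolding powr_add[symmetric] by (rule arg_cong2[where f = "(powr)"]) (simp_all add: e_def field_simps)
            ultimately show ?thesis using t by (simp add: er)
          qed
          finally show ?thesis using elim by linarith
        qed
        have "trunc_walk P B n (int t) \<le> exp (- h * (real_of_int (int t) - real n * \<mu>) + real n * (K * \<bar>h\<bar> powr q * exp r))"
          unfolding B_def by (rule trunc_walk_le[OF r])
        also have "\<dots> \<le> exp (- (\<alpha> + 1) * ln (real t) + 1)" using 1 2 by simp
        also have "\<dots> = exp 1 * real t powr (- \<alpha> - 1)" using t
          by (simp add: powr_def exp_add[symmetric] algebra_simps)
        also have "\<dots> \<le> exp 1 * (real n * pmf P (int t))"
        proof -
          have "1 * pmf P (int t) \<le> real n * pmf P (int t)" using n by (intro mult_right_mono) auto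
          then show ?thesis using elim by (intro mult_left_mono) auto
        qed
        finally have "trunc_walk P B n (int t) \<le> exp 1 * (real n * pmf P (int t))" .
        then show ?thesis
          using walk_prob_le_trunc[OF jump, of n "int t"] by (simp add: algebra_simps)
      qed
    qed
  qed
  moreover have "exp 1 + C > 0" using C by (simp add: add_pos_pos)
  ultimately show ?thesis using that by blast
qed

lemma pmf_int_pos_eventually: "eventually (\<lambda>t::nat. pmf P (int t) > 0) sequentially"
  using eventually_ge_at_top[of "nat z0"] by eventually_elim (auto intro: pmf_pos)

lemma local_fixed_number: "(\<lambda>t. w n (int t) / pmf P (int t)) \<longlonglongrightarrow> real n"
proof (induction n)
  case 0
  have "eventually (\<lambda>t. w 0 (int t) / pmf P (int t) = 0) sequentially"
    using eventually_ge_at_top[of 1] by eventually_elim (simp add: walk_prob_0)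
  then show ?case by (simp add: tendsto_eventually)
next
  case (Suc n)
  have half: "1 / 2 > (0::real)" by simp
  obtain C T where C: "C > 0" "T \<ge> 1" and dom: "\<And>t x. t \<ge> T \<Longrightarrow> real_of_int x \<ge> 1 / 2 * real_of_int t \<Longrightarrow> pmf P x \<le> C * pmf P t"
    using pmf_dominated[OF half] by metis
  have "eventually (\<lambda>t. w n (int t) / pmf P (int t) < real n + 1) sequentially"
    by (rule order_tendstoD[OF Suc]) simp
  then obtain T1 where T1: "\<And>t. t \<ge> T1 \<Longrightarrow> w n (int t) / pmf P (int t) < real n + 1"
    by (auto simp: eventually_sequentially)
  txt \<open>If the first step is at most $t/2$, the other $n$ steps reach $t$ by one big jump; otherwise
    it is the big jump itself.\<close>
  define B where "B t = {z. 2 * z \<le> int t}" for t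
  have dom_half: "pmf P x \<le> C * pmf P (int t)" if "int t \<ge> T" "2 * x \<ge> int t" for t x
  proof (rule dom[OF that(1)])
    have "real_of_int (2 * x) \<ge> real_of_int (int t)" using that(2) by (simp only: of_int_le_iff)
    then show "1 / 2 * real_of_int (int t) \<le> real_of_int x" by simp
  qed
  have large: "eventually (\<lambda>t. 2 * int T1 \<le> int t \<and> T \<le> int t \<and> 2 * \<bar>z0\<bar> \<le> int t) sequentially"
    using eventually_ge_at_top[of "nat (max (2 * int T1) (max T (2 * \<bar>z0\<bar>)))"] by eventually_elim auto
  have "(\<lambda>t. \<integral>z. indicator (B t) z * w n (int t - z) / pmf P (int t) \<partial>P) \<longlonglongrightarrow> (\<integral>z. real n \<partial>P)"
  proof (rule bounded_convergence_pmf)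
    fix z
    have "filterlim (\<lambda>t. nat (int t - z)) sequentially sequentially"
      unfolding filterlim_at_top
    proof (intro allI)
      fix Z
      show "eventually (\<lambda>t. Z \<le> nat (int t - z)) sequentially"
        using eventually_ge_at_top[of "nat (int Z + z)"] by eventually_elim auto
    qed
    \<comment> \<open>The quotient is factored through \<open>pmf P (t - z)\<close>: the induction
      hypothesis at the shifted point, times the insensitivity of \<open>pmf P\<close> to a fixed
      shift.\<close>
    then have "(\<lambda>t. w n (int (nat (int t - z))) / pmf P (int (nat (int t - z))) * (pmf P (int t - z) / pmf P (int t))) \<longlonglongrightarrow> real n * 1"
      by (intro tendsto_mult pmf_shift filterlim_compose[OF Suc])
    moreover have "eventually (\<lambda>t. w n (int (nat (int t - z))) / pmf P (int (nat (int t - z))) * (pmf P (int t - z) / pmf P (int t))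
      = indicator (B t) z * w n (int t - z) / pmf P (int t)) sequentially"
      using eventually_ge_at_top[of "nat (2 * \<bar>z\<bar> + \<bar>z0\<bar>)"]
    proof eventually_elim
      case (elim t)
      then have "pmf P (int t - z) > 0" "z \<in> B t" "int (nat (int t - z)) = int t - z"
        by (auto simp: B_def intro!: pmf_pos)
      then show ?case by simp
    qed
    ultimately show "(\<lambda>t. indicator (B t) z * w n (int t - z) / pmf P (int t)) \<longlonglongrightarrow> real n"
      by (auto intro: Lim_transform_eventually)
  next
    show "eventually (\<lambda>t. \<forall>z. \<bar>indicator (B t) z * w n (int t - z) / pmf P (int t)\<bar> \<le> (real n + 1) * C) sequentially"
      using large
    proof (eventually_elim, intro allI)
      fix t z assume t: "2 * int T1 \<le> int t \<and> T \<le> int t \<and> 2 * \<bar>z0\<bar> \<le> int t"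
      have pt: "pmf P (int t) > 0" using t by (intro pmf_pos) auto
      show "\<bar>indicator (B t) z * w n (int t - z) / pmf P (int t)\<bar> \<le> (real n + 1) * C"
      proof (cases "z \<in> B t")
        case True
        define s where "s = nat (int t - z)"
        have z: "2 * (int t - z) \<ge> int t" using True by (simp add: B_def)
        have s: "int s = int t - z" "int s \<ge> z0" "s \<ge> T1" using z t by (auto simp: s_def)
        then have "w n (int s) / pmf P (int s) < real n + 1" "pmf P (int s) > 0"
          using T1[of s] pmf_pos[of "int s"] by blast+
        then have "w n (int s) \<le> (real n + 1) * pmf P (int s)" by (simp add: field_simps)
        also have "\<dots> \<le> (real n + 1) * (C * pmf P (int t))"
          using t z s by (intro mult_left_mono dom_half) auto
        finally have "w n (int s) / pmf P (int t) \<le> (real n + 1) * C"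
          using pt by (simp add: field_simps)
        then show ?thesis using True walk_prob_nonneg[of P n "int s"] by (simp add: s)
      qed (use C in simp)
    qed
  qed
  then have lim1: "(\<lambda>t. conv_op P (B t) (w n) (int t) / pmf P (int t)) \<longlonglongrightarrow> real n"
    unfolding conv_op_def by simp
  have "(\<lambda>t. \<integral>y. indicator (- B t) (int t - y) * pmf P (int t - y) / pmf P (int t) \<partial>walk_pmf P n) \<longlonglongrightarrow> (\<integral>y. 1 \<partial>walk_pmf P n)"
  proof (rule bounded_convergence_pmf)
    fix y
    have "eventually (\<lambda>t. pmf P (int t - y) / pmf P (int t) = indicator (- B t) (int t - y) * pmf P (int t - y) / pmf P (int t)) sequentially"
      using eventually_ge_at_top[of "nat (2 * \<bar>y\<bar> + 1)"] by eventually_elim (auto simp: B_def indicator_def)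
    then show "(\<lambda>t. indicator (- B t) (int t - y) * pmf P (int t - y) / pmf P (int t)) \<longlonglongrightarrow> 1"
      by (rule Lim_transform_eventually[OF pmf_shift])
  next
    show "eventually (\<lambda>t. \<forall>y. \<bar>indicator (- B t) (int t - y) * pmf P (int t - y) / pmf P (int t)\<bar> \<le> C) sequentially"
      using large
    proof (eventually_elim, intro allI)
      fix t y assume t: "2 * int T1 \<le> int t \<and> T \<le> int t \<and> 2 * \<bar>z0\<bar> \<le> int t"
      have "pmf P (int t) > 0" using t by (intro pmf_pos) auto
      then show "\<bar>indicator (- B t) (int t - y) * pmf P (int t - y) / pmf P (int t)\<bar> \<le> C"
        using dom_half[of t "int t - y"] t C by (auto simp: B_def indicator_def field_simps)
    qed
  qed
  then have lim2: "(\<lambda>t. conv_op P (- B t) (w n) (int t) / pmf P (int t)) \<longlonglongrightarrow> 1"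
    unfolding conv_op_walk_swap by simp
  have "w (Suc n) (int t) / pmf P (int t)
     = conv_op P (B t) (w n) (int t) / pmf P (int t) + conv_op P (- B t) (w n) (int t) / pmf P (int t)" for t
    unfolding walk_prob_Suc by (subst conv_op_split[of _ 1 P _ "B t"]) (auto simp: walk_prob_abs_le_1 add_divide_distrib)
  then show ?case using tendsto_add[OF lim1 lim2] by (simp add: add.commute)
qed

end

section \<open>The renewal sum over a window\<close>

context heavy_walk
begin

text \<open>On a block \<open>[m, 2 m)\<close> the weights are comparable to \<open>p m\<close> and
  the expected number of visits is \<open>O(m * m powr (- q))\<close>, which is again comparable to
  the sum of \<open>n powr (- q)\<close> over the block. The weights are left general:
  \<open>p = 1\<close> serves the renewal sum, the law of \<open>N\<close> serves the stopped
  walk.\<close>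

lemma far_sum:
  fixes p :: "nat \<Rightarrow> real"
  assumes q: "1 < q" "q < \<alpha> - 1" and p0: "\<And>n. p n \<ge> 0"
    and p: "\<And>m n. m \<ge> S \<Longrightarrow> m \<le> n \<Longrightarrow> n \<le> 2 * m \<Longrightarrow> p n \<le> c * p m \<and> p m \<le> c * p n"
  obtains C T where "C > 0" "T \<ge> 1"
    "\<And>(m::nat) (t::nat) J. m \<ge> T \<Longrightarrow> 2 * real t \<le> \<mu> * real m \<Longrightarrow>
      (\<Sum>n\<in>{m..<2 ^ J * m}. p n * w n (int t)) \<le> C * (\<Sum>n\<in>{m..<2 ^ J * m}. real n powr (- q) * p n)"
proof -
  interpret moment_walk P \<mu> z0 q using q by (rule moment_walk)
  have D: "4 / \<mu> > 0" using mean_pos by simp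
  obtain C0 Y0 where C0: "C0 > 0" and vis: "visit_bound (4 / \<mu>) 1 C0 Y0"
    using visits[OF q(1) D] by metis
  define C where "C = C0 * (2 * (\<mu> / 2) powr (- q))"
  define T where "T = max 1 (nat \<lceil>2 * Y0 / \<mu>\<rceil>)"
  have C: "C > 0" "T \<ge> 1" using C0 mean_pos by (simp_all add: C_def T_def)
  have block: "(\<Sum>n\<in>{m..<2 * m}. w n (int t)) \<le> C * (real m * real m powr (- q))"
    if m: "m \<ge> T" and t: "2 * real t \<le> \<mu> * real m" for m t :: nat
  proof -
    have m1: "m \<ge> 1" using m by (simp add: T_def)
    \<comment> \<open>For \<open>n \<ge> m\<close> and \<open>2 * t \<le> \<mu> * m\<close> the mean
      \<open>n * \<mu>\<close> exceeds \<open>t\<close> by at least this amount.\<close>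
    define Y where "Y = \<mu> / 2 * real m"
    have Y: "Y > 0" using mean_pos m1 by (simp add: Y_def)
    have "2 * Y0 / \<mu> \<le> real m" using m by (simp add: T_def)
    then have YY0: "Y \<ge> Y0" using mean_pos by (simp add: Y_def field_simps)
    have "(\<Sum>n\<in>{m..<2 * m}. w n (int t)) \<le> C0 * real (2 * m) * Y powr (- q)"
    proof (rule vis[unfolded visit_bound_def, rule_format, OF YY0])
      show "real (2 * m) \<le> 4 / \<mu> * Y powr 1" using Y mean_pos by (simp add: Y_def)
      fix n assume "n \<in> {m..<2 * m}"
      then have "\<mu> * real m \<le> \<mu> * real n" using mean_pos by simp
      then show "Y \<le> \<bar>real_of_int (int t) - real n * \<mu>\<bar>"
        using t by (simp add: Y_def algebra_simps)
    qed auto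
    also have "Y powr (- q) = (\<mu> / 2) powr (- q) * real m powr (- q)"
      using mean_pos unfolding Y_def by (intro powr_mult)
    finally show ?thesis by (simp add: C_def mult_ac)
  qed
  define c' where "c' = max c 1"
  define C' where "C' = c' * c' * C * 2 powr q"
  have c': "c' \<ge> 1" "c' > 0" by (auto simp: c'_def)
  have p': "p n \<le> c' * p m \<and> p m \<le> c' * p n" if "m \<ge> S" "m \<le> n" "n \<le> 2 * m" for m n
    using p[OF that] mult_right_mono[of c c' "p m"] mult_right_mono[of c c' "p n"] p0[of m] p0[of n]
    by (auto simp: c'_def)
  have C': "C' > 0" using C c' by (simp add: C'_def)
  have pblock: "(\<Sum>n\<in>{m..<2 * m}. p n * w n (int t)) \<le> C' * (\<Sum>n\<in>{m..<2 * m}. real n powr (- q) * p n)"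
    if m: "m \<ge> max S T" and t: "2 * real t \<le> \<mu> * real m" for m t :: nat
  proof -
    have m1: "m \<ge> 1" using m C by simp
    have "(\<Sum>n\<in>{m..<2 * m}. p n * w n (int t)) \<le> (\<Sum>n\<in>{m..<2 * m}. c' * p m * w n (int t))"
      using p' m by (intro sum_mono mult_right_mono walk_prob_nonneg) auto
    also have "\<dots> = c' * p m * (\<Sum>n\<in>{m..<2 * m}. w n (int t))"
      by (simp add: sum_distrib_left)
    also have "\<dots> \<le> c' * p m * (C * (real m * real m powr (- q)))"
      using c' p0 m t by (intro mult_left_mono block) auto
    also have "\<dots> = c' * C * (\<Sum>n\<in>{m..<2 * m}. real m powr (- q) * p m)" by simp
    also have "\<dots> \<le> c' * C * (\<Sum>n\<in>{m..<2 * m}. (2 powr q * real n powr (- q)) * (c' * p n))"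
    proof (intro mult_left_mono sum_mono mult_mono)
      fix n assume n: "n \<in> {m..<2 * m}"
      have "real n powr q \<le> (2 * real m) powr q" using n q by (intro powr_mono2) auto
      then have "real n powr q \<le> 2 powr q * real m powr q" by (simp add: powr_mult)
      then show "real m powr (- q) \<le> 2 powr q * real n powr (- q)"
        using n m1 by (simp add: powr_minus field_simps)
      show "p m \<le> c' * p n" using p' m n by auto
    qed (use c' C p0 in auto)
    also have "\<dots> = C' * (\<Sum>n\<in>{m..<2 * m}. real n powr (- q) * p n)"
      by (simp add: C'_def sum_distrib_left mult_ac)
    finally show ?thesis .
  qed
  show ?thesis
  proof (rule that[of C' "max S T"])
    show "max S T \<ge> 1" using C by simp
    fix m t :: nat and J assume m: "m \<ge> max S T" and t: "2 * real t \<le> \<mu> * real m"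
    show "(\<Sum>n\<in>{m..<2 ^ J * m}. p n * w n (int t)) \<le> C' * (\<Sum>n\<in>{m..<2 ^ J * m}. real n powr (- q) * p n)"
    proof (induction J)
      case (Suc J)
      have le: "m \<le> 2 ^ J * m" "2 ^ J * m \<le> 2 ^ Suc J * m" by auto
      have split: "(\<Sum>n\<in>{m..<2 ^ Suc J * m}. g n) = (\<Sum>n\<in>{m..<2 ^ J * m}. g n) + (\<Sum>n\<in>{2 ^ J * m..<2 * (2 ^ J * m)}. g n)"
        for g :: "nat \<Rightarrow> real"
        using sum.atLeastLessThan_concat[OF le, of g] by (simp add: mult.assoc)
      have "\<mu> * real m \<le> \<mu> * real (2 ^ J * m)"
        using mean_pos le(1) by (intro mult_left_mono) (simp_all only: of_nat_le_iff)
      then have "2 * real t \<le> \<mu> * real (2 ^ J * m)" using t by linarith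
      then have "(\<Sum>n\<in>{2 ^ J * m..<2 * (2 ^ J * m)}. p n * w n (int t))
         \<le> C' * (\<Sum>n\<in>{2 ^ J * m..<2 * (2 ^ J * m)}. real n powr (- q) * p n)"
        using order_trans[OF m le(1)] by (intro pblock) auto
      then show ?case unfolding split using Suc by (simp add: distrib_left)
    qed simp
  qed (fact C')
qed

text \<open>From this index on the mean position is beyond \<open>2 * t\<close>, so the dyadic
  estimate applies; the \<open>+ 1\<close> makes the first block nonempty even for
  \<open>t = 0\<close>.\<close>

definition cutoff :: "nat \<Rightarrow> nat" where "cutoff t = nat \<lceil>2 * real t / \<mu>\<rceil> + 1"

lemma cutoff_bounds: "2 * real t < \<mu> * real (cutoff t)" "real (cutoff t) \<le> 2 * real t / \<mu> + 2" "cutoff t \<ge> 1"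
proof -
  have "2 * real t / \<mu> \<ge> 0" using mean_pos by simp
  then have "2 * real t / \<mu> < real (cutoff t)" "real (cutoff t) \<le> 2 * real t / \<mu> + 2"
    unfolding cutoff_def by linarith+
  then show "2 * real t < \<mu> * real (cutoff t)" "real (cutoff t) \<le> 2 * real t / \<mu> + 2"
    using mean_pos by (auto simp: field_simps)
qed (simp add: cutoff_def)

definition window :: "real \<Rightarrow> nat \<Rightarrow> nat set" where
  "window \<kappa> t = {n. n < cutoff t \<and> \<bar>real t - real n * \<mu>\<bar> < real t powr \<kappa>}"

definition outside :: "real \<Rightarrow> nat \<Rightarrow> nat set" where
  "outside \<kappa> t = {n. n < cutoff t \<and> \<bar>real t - real n * \<mu>\<bar> \<ge> real t powr \<kappa>}"

text \<open>The dyadic ranges exhaust all indices because \<open>N + m \<le> 2 ^ N * m\<close>;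
  terms are nonnegative, so a bound uniform in \<open>J\<close> passes to the series.\<close>

lemma suminf_cutoff_le:
  fixes p :: "nat \<Rightarrow> real"
  assumes p0: "\<And>n. p n \<ge> 0" and "m \<ge> 1"
    and le: "\<And>J. (\<Sum>n\<in>{m..<2 ^ J * m}. p n * w n (int t)) \<le> b"
  shows "summable (\<lambda>n. p (n + m) * w (n + m) (int t)) \<and> (\<Sum>n. p (n + m) * w (n + m) (int t)) \<le> b"
proof -
  have part: "(\<Sum>n<N. p (n + m) * w (n + m) (int t)) \<le> b" for N
  proof -
    have "N + m \<le> 2 ^ N * m"
    proof -
      have "N + 1 \<le> 2 ^ N" by (simp add: Suc_le_eq)
      then have "(N + 1) * m \<le> 2 ^ N * m" by (rule mult_le_mono1)
      moreover have "N + m \<le> (N + 1) * m" using \<open>m \<ge> 1\<close> by simp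
      ultimately show ?thesis by linarith
    qed
    have "(\<Sum>n<N. p (n + m) * w (n + m) (int t)) = (\<Sum>n\<in>{m..<N + m}. p n * w n (int t))"
      using sum.shift_bounds_nat_ivl[of "\<lambda>n. p n * w n (int t)" 0 m N] by (simp add: lessThan_atLeast0)
    also have "\<dots> \<le> (\<Sum>n\<in>{m..<2 ^ N * m}. p n * w n (int t))"
      using \<open>N + m \<le> 2 ^ N * m\<close> by (intro sum_mono2) (auto simp: p0 walk_prob_nonneg)
    also have "\<dots> \<le> b" by (rule le)
    finally show ?thesis .
  qed
  have "summable (\<lambda>n. p (n + m) * w (n + m) (int t))"
    by (rule summableI_nonneg_bounded[where x = b]) (auto simp: p0 walk_prob_nonneg part)
  then show ?thesis using suminf_le_const[OF _ part] by auto
qed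

text \<open>The condition on \<open>\<kappa>\<close> leaves room for a moment order \<open>q\<close>
  between \<open>1 / \<kappa>\<close> and \<open>\<alpha> - 1\<close>. Visits at distance
  \<open>t powr \<kappa>\<close> during \<open>O(t)\<close> steps are then
  \<open>O(t powr (1 - \<kappa> * q))\<close>, a negative power.\<close>

lemma outside_window_tendsto_0:
  assumes \<kappa>: "1 / (\<alpha> - 1) < \<kappa>" "\<kappa> < 1"
  shows "(\<lambda>t. \<Sum>n\<in>outside \<kappa> t. w n (int t)) \<longlonglongrightarrow> 0"
proof -
  have \<kappa>0: "\<kappa> > 0" using \<kappa> alpha by (smt (verit) zero_less_divide_1_iff)
  have "1 / \<kappa> < \<alpha> - 1" using \<kappa> \<kappa>0 alpha by (simp add: field_simps)
  moreover have "1 / \<kappa> > 1" using \<kappa> \<kappa>0 by simp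
  ultimately obtain q where q0: "1 / \<kappa> < q" "q < \<alpha> - 1" "1 < q" using dense by force
  then have qq: "1 < q" "q < \<alpha> - 1" "1 / \<kappa> < q" "1 - \<kappa> * q < 0"
    using \<kappa>0 by (auto simp: field_simps)
  interpret moment_walk P \<mu> z0 q using qq(1,2) by (rule moment_walk)
  have D: "4 / \<mu> > 0" using mean_pos by simp
  obtain C Y0 where C: "C > 0" and vis: "visit_bound (4 / \<mu>) (1 / \<kappa>) C Y0"
    using visits[OF qq(3) D] by metis
  have "filterlim (\<lambda>t::nat. real t powr \<kappa>) at_top sequentially" using \<kappa>0 by real_asymp
  then have ev1: "eventually (\<lambda>t::nat. real t powr \<kappa> \<ge> Y0) sequentially"
    by (simp add: filterlim_at_top)
  have ev2: "eventually (\<lambda>t::nat. real t \<ge> max 1 \<mu>) sequentially"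
    by (rule eventually_compose_filterlim[OF eventually_ge_at_top filterlim_real_sequentially])
  have up: "eventually (\<lambda>t::nat. (\<Sum>n\<in>outside \<kappa> t. w n (int t))
     \<le> C * (4 / \<mu>) * real t powr (1 - \<kappa> * q)) sequentially"
    using ev1 ev2
  proof eventually_elim
    case (elim t)
    have c: "real (cutoff t) \<le> 4 / \<mu> * real t"
      using cutoff_bounds(2)[of t] elim mean_pos by (simp add: field_simps)
    have t: "(real t powr \<kappa>) powr (1 / \<kappa>) = real t" using elim \<kappa>0 by (simp add: powr_powr)
    have "(\<Sum>n\<in>outside \<kappa> t. w n (int t))
      \<le> C * real (cutoff t) * (real t powr \<kappa>) powr (- q)"
      by (rule vis[unfolded visit_bound_def, rule_format, OF elim(1)]) (use c t in \<open>auto simp: outside_def\<close>)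
    also have "\<dots> \<le> C * (4 / \<mu> * real t) * (real t powr \<kappa>) powr (- q)"
      using c C by (intro mult_right_mono mult_left_mono) auto
    also have "(real t powr \<kappa>) powr (- q) = real t powr (- (\<kappa> * q))" by (simp add: powr_powr)
    also have "C * (4 / \<mu> * real t) * real t powr (- (\<kappa> * q)) = C * (4 / \<mu>) * (real t powr 1 * real t powr (- (\<kappa> * q)))"
      using elim by simp
    also have "real t powr 1 * real t powr (- (\<kappa> * q)) = real t powr (1 - \<kappa> * q)"
      by (simp only: powr_add[symmetric] add_uminus_conv_diff)
    finally show ?case .
  qed
  have lim: "(\<lambda>t::nat. C * (4 / \<mu>) * real t powr (1 - \<kappa> * q)) \<longlonglongrightarrow> 0" using qq(4) by real_asymp
  show ?thesis
    by (rule tendsto_sandwich[OF _ up tendsto_const lim]) (auto intro!: always_eventually sum_nonneg walk_prob_nonneg)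
qed

text \<open>The full renewal sum minus two vanishing pieces: times beyond the cutoff, bounded by a
  tail of the convergent series of \<open>n powr (- q)\<close>, and earlier times off the
  window.\<close>

lemma window_tendsto:
  assumes \<kappa>: "1 / (\<alpha> - 1) < \<kappa>" "\<kappa> < 1"
  shows "(\<lambda>t. \<Sum>n\<in>window \<kappa> t. w n (int t)) \<longlonglongrightarrow> 1 / \<mu>"
proof -
  define q where "q = \<alpha> / 2"
  have q: "1 < q" "q < \<alpha> - 1" using alpha by (auto simp: q_def)
  obtain C T where C: "C > 0" "T \<ge> 1" and far: "\<And>(m::nat) (t::nat) J. m \<ge> T \<Longrightarrow> 2 * real t \<le> \<mu> * real m \<Longrightarrow>
      (\<Sum>n\<in>{m..<2 ^ J * m}. 1 * w n (int t)) \<le> C * (\<Sum>n\<in>{m..<2 ^ J * m}. real n powr (- q) * 1)"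
    using far_sum[OF q, of "\<lambda>_. 1" 0 1] by auto
  have sq: "summable (\<lambda>n. real n powr (- q))" using q by (simp add: summable_real_powr_iff)
  have cut: "filterlim cutoff sequentially sequentially"
  proof (rule filterlim_at_top_mono[where f = "\<lambda>t::nat. nat \<lfloor>2 * real t / \<mu>\<rfloor>"])
    show "filterlim (\<lambda>t::nat. nat \<lfloor>2 * real t / \<mu>\<rfloor>) sequentially sequentially"
      using mean_pos by (intro filterlim_compose[OF filterlim_nat_sequentially] filterlim_compose[OF filterlim_floor_sequentially]) real_asymp
    show "eventually (\<lambda>t. nat \<lfloor>2 * real t / \<mu>\<rfloor> \<le> cutoff t) sequentially"
      by (intro always_eventually allI) (simp add: cutoff_def, linarith)
  qed
  have "(\<lambda>k. \<Sum>n. real (n + k) powr (- q)) \<longlonglongrightarrow> 0" by (rule suminf_exist_split2[OF sq])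
  from filterlim_compose[OF this cut] have tail0: "(\<lambda>t. C * (\<Sum>n. real (n + cutoff t) powr (- q))) \<longlonglongrightarrow> 0"
    by (rule tendsto_mult_right_zero)
  have "eventually (\<lambda>t. cutoff t \<ge> T) sequentially" using cut by (simp add: filterlim_at_top)
  then have up: "eventually (\<lambda>t. (\<Sum>n. w (n + cutoff t) (int t)) \<le> C * (\<Sum>n. real (n + cutoff t) powr (- q))) sequentially"
  proof eventually_elim
    case (elim t)
    have "(\<Sum>n. 1 * w (n + cutoff t) (int t)) \<le> C * (\<Sum>n. real (n + cutoff t) powr (- q))"
    proof (rule suminf_cutoff_le[THEN conjunct2])
      fix J
      have "(\<Sum>n\<in>{cutoff t..<2 ^ J * cutoff t}. 1 * w n (int t)) \<le> C * (\<Sum>n\<in>{cutoff t..<2 ^ J * cutoff t}. real n powr (- q) * 1)"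
        using elim cutoff_bounds(1)[of t] by (intro far) auto
      also have "(\<Sum>n\<in>{cutoff t..<2 ^ J * cutoff t}. real n powr (- q) * 1) = (\<Sum>n<2 ^ J * cutoff t - cutoff t. real (n + cutoff t) powr (- q))"
        using sum.shift_bounds_nat_ivl[of "\<lambda>n. real n powr (- q)" 0 "cutoff t" "2 ^ J * cutoff t - cutoff t"] by (simp add: lessThan_atLeast0)
      also have "\<dots> \<le> (\<Sum>n. real (n + cutoff t) powr (- q))"
        by (intro sum_le_suminf summable_ignore_initial_segment sq) auto
      finally show "(\<Sum>n\<in>{cutoff t..<2 ^ J * cutoff t}. 1 * w n (int t)) \<le> C * (\<Sum>n. real (n + cutoff t) powr (- q))"
        using C by simp
    qed (use cutoff_bounds(3) in auto)
    then show ?case by simp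
  qed
  have far0: "(\<lambda>t. \<Sum>n. w (n + cutoff t) (int t)) \<longlonglongrightarrow> 0"
    by (rule tendsto_sandwich[OF _ up tendsto_const tail0])
       (auto intro!: always_eventually suminf_nonneg summable_ignore_initial_segment walk_prob_summable walk_prob_nonneg)
  have "(\<Sum>n\<in>window \<kappa> t. w n (int t))
     = (\<Sum>n. w n (int t)) - (\<Sum>n. w (n + cutoff t) (int t))
       - (\<Sum>n\<in>outside \<kappa> t. w n (int t))" for t
  proof -
    have "(\<Sum>n<cutoff t. w n (int t)) = (\<Sum>n\<in>window \<kappa> t. w n (int t))
       + (\<Sum>n\<in>outside \<kappa> t. w n (int t))"
      by (subst sum.union_disjoint[symmetric]) (auto simp: window_def outside_def intro!: sum.cong)
    then show ?thesis using suminf_split_initial_segment[OF walk_prob_summable, of "int t" "cutoff t"] by simp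
  qed
  moreover have "(\<lambda>t. (\<Sum>n. w n (int t)) - (\<Sum>n. w (n + cutoff t) (int t))
       - (\<Sum>n\<in>outside \<kappa> t. w n (int t))) \<longlonglongrightarrow> 1 / \<mu> - 0 - 0"
    by (intro tendsto_diff renewal_theorem far0 outside_window_tendsto_0[OF \<kappa>])
  ultimately show ?thesis by simp
qed

end

section \<open>The randomly stopped walk\<close>

lemma cond_R1_pos:
  assumes "cond_R1 p" "t \<ge> 1" "p t \<ge> 0"
  shows "p t > 0"
proof -
  obtain c1 c2 c3 where c: "c1 > 1" "c2 > 0" and H: "\<forall>t1 t2. t1 \<ge> 1 \<and> t2 \<ge> 1 \<and> 1 \<le> real t2 / real t1 \<and> real t2 / real t1 \<le> c1 \<longrightarrow>
           c2 \<le> p t2 / p t1 \<and> p t2 / p t1 \<le> c3"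
    using assms(1) unfolding cond_R1_def by blast
  have "c2 \<le> p t / p t" using H[rule_format, of t t] assms(2) c by simp
  then have "p t \<noteq> 0" using c by auto
  then show ?thesis using assms(3) by simp
qed

text \<open>(R1) compares indices up to the ratio \<open>c1\<close> only; an arbitrary ratio
  \<open>r\<close> is reached by finitely many intermediate indices, each losing a factor
  \<open>d\<close>.\<close>

lemma cond_R1_comparable:
  assumes R1: "cond_R1 p" and p0: "\<And>n. p n \<ge> 0" and "r > 0"
  obtains c S where "c > 0" "S \<ge> 1" "\<And>m n. m \<ge> S \<Longrightarrow> m \<le> n \<Longrightarrow> real n \<le> r * real m \<Longrightarrow> p n \<le> c * p m \<and> p m \<le> c * p n"
proof -
  obtain c1 c2 c3 where c: "c1 > 1" "c2 > 0" "c3 > 0" and H: "\<And>t1 t2. t1 \<ge> 1 \<Longrightarrow> t2 \<ge> 1 \<Longrightarrow> 1 \<le> real t2 / real t1 \<Longrightarrow> real t2 / real t1 \<le> c1 \<Longrightarrow>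
           c2 \<le> p t2 / p t1 \<and> p t2 / p t1 \<le> c3"
    using R1 unfolding cond_R1_def by blast
  have pos: "p n > 0" if "n \<ge> 1" for n using cond_R1_pos[OF R1 that] p0 by auto
  define d where "d = max 1 (max c3 (1 / c2))"
  have d: "d \<ge> 1" by (simp add: d_def)
  have base: "p n \<le> d * p m \<and> p m \<le> d * p n" if "m \<ge> 1" "m \<le> n" "real n \<le> c1 * real m" for m n
  proof -
    have "c2 \<le> p n / p m \<and> p n / p m \<le> c3" using that by (intro H) (auto simp: field_simps)
    moreover have pp: "p m > 0" "p n > 0" using pos that by auto
    ultimately have "p n \<le> c3 * p m" "p m \<le> 1 / c2 * p n" using c by (auto simp: field_simps)
    moreover have "c3 * p m \<le> d * p m" "1 / c2 * p n \<le> d * p n"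
      by (rule mult_right_mono; use pp in \<open>simp add: d_def\<close>)+
    ultimately show ?thesis by linarith
  qed
  \<comment> \<open>Intermediate indices must be integers. A growth factor strictly between 1 and
    \<open>c1\<close> is guaranteed after rounding \<open>c1 * m\<close> down, once
    \<open>m \<ge> 2 / (c1 - 1)\<close>.\<close>
  define \<rho> where "\<rho> = (1 + c1) / 2"
  have \<rho>: "\<rho> > 1" using c by (simp add: \<rho>_def)
  define S where "S = max 1 (nat \<lceil>2 / (c1 - 1)\<rceil>)"
  have iter: "p n \<le> d ^ k * p m \<and> p m \<le> d ^ k * p n"
    if "m \<ge> S" "m \<le> n" "real n \<le> \<rho> ^ k * real m" for k m n
    using that
  proof (induction k arbitrary: m)
    case (Suc k)
    have m1: "m \<ge> 1" using Suc.prems(1) by (simp add: S_def)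
    show ?case
    proof (cases "real n \<le> c1 * real m")
      case True
      have "d * x \<le> d ^ Suc k * x" if "x \<ge> 0" for x
        using d that one_le_power[of d k] by (intro mult_right_mono) auto
      from this[of "p m"] this[of "p n"] show ?thesis using base[OF m1 Suc.prems(2) True] p0 by force
    next
      case False
      define s where "s = nat \<lfloor>c1 * real m\<rfloor>"
      have nn: "c1 * real m \<ge> 0" using c by simp
      have s: "real s \<le> c1 * real m" "real s \<ge> c1 * real m - 1"
        using nn unfolding s_def by linarith+
      have "2 / (c1 - 1) \<le> real m" using Suc.prems(1) unfolding S_def by linarith
      then have "1 \<le> (c1 - 1) / 2 * real m" using c by (simp add: field_simps)
      then have s\<rho>: "real s \<ge> \<rho> * real m" using s(2) by (simp add: \<rho>_def field_simps)
      have "real m \<le> \<rho> * real m" using \<rho> mult_right_mono[of 1 \<rho> "real m"] by simp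
      then have ms: "m \<le> s" using s\<rho> by linarith
      have sn: "s \<le> n" using False s(1) by linarith
      have "real n \<le> \<rho> ^ k * (\<rho> * real m)" using Suc.prems(3) by (simp add: mult_ac)
      also have "\<dots> \<le> \<rho> ^ k * real s" using s\<rho> \<rho> by (intro mult_left_mono) auto
      finally have 1: "p n \<le> d ^ k * p s \<and> p s \<le> d ^ k * p n"
        using ms sn Suc.prems(1) by (intro Suc.IH) auto
      have 2: "p s \<le> d * p m \<and> p m \<le> d * p s" by (rule base[OF m1 ms s(1)])
      have "p n \<le> d ^ k * (d * p m)" using 1 2 d by (meson mult_left_mono order_trans zero_le_power zero_le_one)
      moreover have "p m \<le> d * (d ^ k * p n)" using 1 2 d by (meson mult_left_mono order_trans zero_le_one)
      ultimately show ?thesis by (simp add: mult_ac)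
    qed
  qed simp
  obtain k where k: "r < \<rho> ^ k" using real_arch_pow[OF \<rho>] by blast
  show ?thesis
  proof (rule that[of "d ^ k" S])
    fix m n assume "m \<ge> S" "m \<le> n" "real n \<le> r * real m"
    moreover have "r * real m \<le> \<rho> ^ k * real m" using k by (intro mult_right_mono) auto
    ultimately show "p n \<le> d ^ k * p m \<and> p m \<le> d ^ k * p n" by (intro iter) auto
  qed (use d in \<open>auto simp: S_def\<close>)
qed

text \<open>The supremum controls \<open>p t / p s\<close> from above only. The reverse comparison
  will come from exchanging the roles of \<open>t\<close> and \<open>s\<close>, so the one-sided
  form is all that is extracted.\<close>

lemma cond_R2_close:
  assumes R2: "cond_R2 \<alpha> p" and pos: "\<And>n. n \<ge> 1 \<Longrightarrow> p n > 0"
  obtains \<kappa> where "\<kappa> > 1 / (\<alpha> - 1)"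
    "\<And>\<epsilon>. \<epsilon> > 0 \<Longrightarrow> \<exists>T. \<forall>t\<ge>T. \<forall>s\<ge>1. \<bar>real t - real s\<bar> \<le> real t powr \<kappa> \<longrightarrow> p t \<le> (1 + \<epsilon>) * p s"
proof -
  obtain \<kappa> where \<kappa>: "\<kappa> > max (1 / (\<alpha> - 1)) (1 / 2)"
    and lim: "(\<lambda>t. SUP s\<in>{s. s \<ge> 1 \<and> \<bar>real t - real s\<bar> \<le> real t powr \<kappa>}. p t / p s) \<longlonglongrightarrow> 1"
    using R2 unfolding cond_R2_def by blast
  show ?thesis
  proof (rule that[of \<kappa>])
    show "\<kappa> > 1 / (\<alpha> - 1)" using \<kappa> by simp
    fix \<epsilon> :: real assume "\<epsilon> > 0"
    then have "eventually (\<lambda>t. (SUP s\<in>{s. s \<ge> 1 \<and> \<bar>real t - real s\<bar> \<le> real t powr \<kappa>}. p t / p s) < 1 + \<epsilon>) sequentially"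
      by (intro order_tendstoD(2)[OF lim]) simp
    then obtain T where T: "\<And>t. t \<ge> T \<Longrightarrow> (SUP s\<in>{s. s \<ge> 1 \<and> \<bar>real t - real s\<bar> \<le> real t powr \<kappa>}. p t / p s) < 1 + \<epsilon>"
      by (auto simp: eventually_sequentially)
    show "\<exists>T. \<forall>t\<ge>T. \<forall>s\<ge>1. \<bar>real t - real s\<bar> \<le> real t powr \<kappa> \<longrightarrow> p t \<le> (1 + \<epsilon>) * p s"
    proof (intro exI[of _ T] allI impI)
      fix t s assume t: "t \<ge> T" and s: "1 \<le> s" "\<bar>real t - real s\<bar> \<le> real t powr \<kappa>"
      \<comment> \<open>Finiteness makes the set of ratios bounded, without which the real supremum
        need not dominate its members.\<close>
      have "{s. s \<ge> 1 \<and> \<bar>real t - real s\<bar> \<le> real t powr \<kappa>} \<subseteq> {..nat \<lceil>real t + real t powr \<kappa>\<rceil>}"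
        by (auto simp: abs_le_iff) linarith
      then have "finite {s. s \<ge> 1 \<and> \<bar>real t - real s\<bar> \<le> real t powr \<kappa>}" by (rule finite_subset) simp
      then have "p t / p s \<le> (SUP s\<in>{s. s \<ge> 1 \<and> \<bar>real t - real s\<bar> \<le> real t powr \<kappa>}. p t / p s)"
        using s by (intro cSUP_upper) auto
      also have "\<dots> < 1 + \<epsilon>" by (rule T[OF t])
      finally show "p t \<le> (1 + \<epsilon>) * p s" using pos[OF s(1)] by (simp add: field_simps)
    qed
  qed
qed

locale stopped_heavy_walk = heavy_walk +
  fixes p :: "nat \<Rightarrow> real" and \<beta> :: real
  assumes p_nonneg: "\<And>n. p n \<ge> 0" and p_summable: "summable p"
    and R1: "cond_R1 p" and R2: "cond_R2 \<alpha> p"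
    and beta: "0 < \<beta>" "\<beta> < \<alpha> - 2"
    and tail_small: "(\<lambda>t. \<Sum>\<^sub>\<infinity>n\<in>{t..}. real n powr (- 1 - \<beta>) * p n) \<in> o(p)"
begin

lemma p_pos: "n \<ge> 1 \<Longrightarrow> p n > 0"
  using cond_R1_pos[OF R1] p_nonneg by blast

definition stopped_prob :: "nat \<Rightarrow> real" where
  "stopped_prob t = (\<Sum>n. p n * w n (int t))"

definition small_part :: "nat \<Rightarrow> real" where
  "small_part t = (\<Sum>n | 2 * \<mu> * real n \<le> real t. p n * w n (int t))"

definition center :: "nat \<Rightarrow> nat" where "center t = nat \<lfloor>real t / \<mu>\<rfloor>"

lemma center_bounds: "real (center t) \<le> real t / \<mu>" "real (center t) > real t / \<mu> - 1"
proof -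
  have "real t / \<mu> \<ge> 0" using mean_pos by simp
  then show "real (center t) \<le> real t / \<mu>" "real (center t) > real t / \<mu> - 1"
    unfolding center_def by linarith+
qed

lemma center_at_top: "filterlim center sequentially sequentially"
  unfolding center_def using mean_pos
  by (intro filterlim_compose[OF filterlim_nat_sequentially] filterlim_compose[OF filterlim_floor_sequentially]) real_asymp

lemma eventually_real_ge: "eventually (\<lambda>t::nat. real t \<ge> c) sequentially"
  by (rule eventually_compose_filterlim[OF eventually_ge_at_top filterlim_real_sequentially])

lemma summable_stopped: "summable (\<lambda>n. p n * w n x)"
  by (rule summable_comparison_test[OF _ p_summable])
     (auto simp: p_nonneg walk_prob_nonneg mult_left_le walk_prob_le_1)

lemma p_comparable_center:
  assumes "r > 0"
  obtains c where "c > 0"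
    "eventually (\<lambda>t. \<forall>n. real t \<le> r * real n \<longrightarrow> real n \<le> r * real t \<longrightarrow> p n \<le> c * p (center t)) sequentially"
proof -
  \<comment> \<open>\<open>2 * \<mu> * r\<close> serves the case \<open>center t \<le> n\<close>,
    where \<open>t \<le> 2 * \<mu> * center t\<close>; \<open>r / \<mu>\<close> serves
    \<open>n < center t\<close>, where \<open>center t \<le> t / \<mu>\<close>.\<close>
  define r' where "r' = max (2 * \<mu> * r) (r / \<mu>)"
  have r': "r' > 0" using mean_pos assms by (simp add: r'_def less_max_iff_disj)
  obtain c S where c: "c > 0" "S \<ge> 1" and cmp: "\<And>m n. m \<ge> S \<Longrightarrow> m \<le> n \<Longrightarrow> real n \<le> r' * real m \<Longrightarrow> p n \<le> c * p m \<and> p m \<le> c * p n"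
    using cond_R1_comparable[OF R1 p_nonneg r'] by metis
  have ev: "eventually (\<lambda>t. center t \<ge> S) sequentially" using center_at_top by (simp add: filterlim_at_top)
  have "eventually (\<lambda>t. \<forall>n. real t \<le> r * real n \<longrightarrow> real n \<le> r * real t \<longrightarrow> p n \<le> c * p (center t)) sequentially"
    using ev eventually_real_ge[of "r * real S"] eventually_real_ge[of "2 * \<mu>"]
  proof eventually_elim
    case (elim t)
    have t2: "real t / \<mu> \<ge> 2" using elim mean_pos by (simp add: field_simps)
    show ?case
    proof (intro allI impI)
      fix n assume n: "real t \<le> r * real n" "real n \<le> r * real t"
      show "p n \<le> c * p (center t)"
      proof (cases "center t \<le> n")
        case True
        have "real t / \<mu> \<le> 2 * real (center t)" using center_bounds[of t] t2 by linarith
        then have "real t \<le> 2 * \<mu> * real (center t)" using mean_pos by (simp add: field_simps)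
        then have "r * real t \<le> r * (2 * \<mu> * real (center t))" using assms by (intro mult_left_mono) auto
        also have "\<dots> = 2 * \<mu> * r * real (center t)" by simp
        also have "\<dots> \<le> r' * real (center t)" by (intro mult_right_mono) (auto simp: r'_def)
        finally show ?thesis using cmp[OF elim(1) True] n(2) by simp
      next
        case False
        have "r * real S \<le> r * real n" using elim(2) n(1) by linarith
        then have "n \<ge> S" using assms by simp
        moreover have "real (center t) \<le> r / \<mu> * real n"
          using center_bounds(1)[of t] n(1) mean_pos by (simp add: field_simps)
        moreover have "r / \<mu> * real n \<le> r' * real n" by (intro mult_right_mono) (auto simp: r'_def)
        ultimately show ?thesis using cmp[of n "center t"] False by simp
      qed
    qed
  qed
  then show ?thesis using that c by blast
qed

lemma p_le_center:
  obtains c where "c > 0" "eventually (\<lambda>t. p t \<le> c * p (center t)) sequentially"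
proof -
  obtain c where "c > 0"
    "eventually (\<lambda>t. \<forall>n. real t \<le> 1 * real n \<longrightarrow> real n \<le> 1 * real t \<longrightarrow> p n \<le> c * p (center t)) sequentially"
    using p_comparable_center[OF zero_less_one] by blast
  then show ?thesis using that by (auto elim: eventually_mono)
qed

lemma p_near_center:
  obtains c where "c > 0" "eventually (\<lambda>t. \<forall>n. real t < 2 * \<mu> * real n \<longrightarrow> n \<le> cutoff t \<longrightarrow> p n \<le> c * p (center t)) sequentially"
proof -
  define r where "r = max (2 * \<mu>) (4 / \<mu>)"
  have "r > 0" using mean_pos by (simp add: r_def less_max_iff_disj)
  then obtain c where c: "c > 0" and ev:
    "eventually (\<lambda>t. \<forall>n. real t \<le> r * real n \<longrightarrow> real n \<le> r * real t \<longrightarrow> p n \<le> c * p (center t)) sequentially"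
    by (rule p_comparable_center)
  have "eventually (\<lambda>t. \<forall>n. real t < 2 * \<mu> * real n \<longrightarrow> n \<le> cutoff t \<longrightarrow> p n \<le> c * p (center t)) sequentially"
    using ev eventually_real_ge[of \<mu>]
  proof eventually_elim
    case (elim t)
    have "2 * \<mu> * real n \<le> r * real n" "4 / \<mu> * real t \<le> r * real t" for n
      by (rule mult_right_mono; simp add: r_def)+
    moreover have "real (cutoff t) \<le> 4 / \<mu> * real t"
      using cutoff_bounds(2)[of t] elim(2) mean_pos by (simp add: field_simps)
    ultimately show ?case using elim(1) by (smt (verit) of_nat_le_iff)
  qed
  then show ?thesis using that c by blast
qed

text \<open>By (R2) the weights on the window agree with \<open>p (center t)\<close> up to a factor
  tending to 1, uniformly, so they can be pulled out of the renewal sum.\<close>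

lemma window_weighted:
  obtains \<kappa> where "1 / (\<alpha> - 1) < \<kappa>" "\<kappa> < 1"
    "(\<lambda>t. (\<Sum>n\<in>window \<kappa> t. p n * w n (int t)) / p (center t)) \<longlonglongrightarrow> 1 / \<mu>"
proof -
  obtain \<kappa>' where \<kappa>': "\<kappa>' > 1 / (\<alpha> - 1)"
    and close: "\<And>\<epsilon>. \<epsilon> > 0 \<Longrightarrow> \<exists>T. \<forall>t\<ge>T. \<forall>s\<ge>1. \<bar>real t - real s\<bar> \<le> real t powr \<kappa>' \<longrightarrow> p t \<le> (1 + \<epsilon>) * p s"
    using cond_R2_close[OF R2 p_pos] by metis
  \<comment> \<open>\<open>\<kappa> < 1\<close> is needed for the window sum. The gap to
    \<open>\<kappa>'\<close> absorbs the factor \<open>1 / \<mu>\<close>, the rounding in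
    \<open>center t\<close> and the passage from \<open>t\<close> to
    \<open>t / (2 * \<mu>)\<close>.\<close>
  have "1 / (\<alpha> - 1) < min 1 \<kappa>'" using \<kappa>' alpha by simp
  then obtain \<kappa> where \<kappa>: "1 / (\<alpha> - 1) < \<kappa>" "\<kappa> < 1" "\<kappa> < \<kappa>'" using dense by (metis min_less_iff_conj)
  have \<kappa>0: "\<kappa> > 0" using \<kappa>(1) alpha by (smt (verit) zero_less_divide_1_iff)
  define W where "W = window \<kappa>"
  define s where "s t = (\<Sum>n\<in>W t. w n (int t))" for t
  define r where "r t = (\<Sum>n\<in>W t. p n * w n (int t)) / p (center t)" for t
  have slim: "s \<longlonglongrightarrow> 1 / \<mu>" unfolding s_def W_def by (rule window_tendsto[OF \<kappa>(1,2)])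
  have ev1: "eventually (\<lambda>t::nat. real t powr \<kappa> / \<mu> + 1 \<le> (real t / (2 * \<mu>)) powr \<kappa>') sequentially"
    using mean_pos \<kappa> \<kappa>0 by real_asymp
  have ev2: "eventually (\<lambda>t::nat. real t powr \<kappa> \<le> real t / 2) sequentially"
    using \<kappa> by real_asymp
  have comp: "eventually (\<lambda>t. center t \<ge> 1 \<and> (\<forall>n\<in>W t. p n \<le> (1 + \<epsilon>) * p (center t) \<and> p (center t) \<le> (1 + \<epsilon>) * p n)) sequentially"
    if "\<epsilon> > 0" for \<epsilon>
  proof -
    obtain T where T: "\<And>t s. t \<ge> T \<Longrightarrow> s \<ge> 1 \<Longrightarrow> \<bar>real t - real s\<bar> \<le> real t powr \<kappa>' \<Longrightarrow> p t \<le> (1 + \<epsilon>) * p s"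
      using close[OF \<open>\<epsilon> > 0\<close>] by blast
    show ?thesis
      using ev1 ev2 eventually_real_ge[of "2 * \<mu> * (real T + 1)"]
    proof eventually_elim
      case (elim t)
      \<comment> \<open>A common lower bound for \<open>center t\<close> and all \<open>n\<close> in
        the window, so that (R2) can be applied from either side with radius at least
        \<open>x powr \<kappa>'\<close>.\<close>
      define x where "x = real t / (2 * \<mu>)"
      have x: "real t / \<mu> = 2 * x" by (simp add: x_def)
      have xT: "x \<ge> real T + 1" using elim(3) mean_pos by (simp add: x_def field_simps)
      have c: "real (center t) \<ge> x" "real (center t) \<le> 2 * x" "real (center t) > 2 * x - 1"
        using center_bounds[of t] xT unfolding x by linarith+
      have "p n \<le> (1 + \<epsilon>) * p (center t) \<and> p (center t) \<le> (1 + \<epsilon>) * p n" if "n \<in> W t" for n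
      proof -
        have n: "\<bar>real t - real n * \<mu>\<bar> < real t powr \<kappa>" using that by (simp add: W_def window_def)
        have "\<bar>2 * x - real n\<bar> = \<bar>real t - real n * \<mu>\<bar> / \<mu>"
          using mean_pos by (simp add: x_def abs_if field_simps)
        also have "\<dots> < real t powr \<kappa> / \<mu>" using n mean_pos by (intro divide_strict_right_mono)
        finally have n1: "\<bar>2 * x - real n\<bar> < real t powr \<kappa> / \<mu>" .
        have "real t powr \<kappa> / \<mu> \<le> x" using elim(2) mean_pos by (simp add: x_def field_simps)
        then have nx: "real n \<ge> x" using n1 by linarith
        have d: "\<bar>real n - real (center t)\<bar> \<le> x powr \<kappa>'"
          using n1 c elim(1) unfolding x_def[symmetric] by linarith
        have x0: "x \<ge> 0" using xT by linarith
        have \<kappa>'0: "\<kappa>' \<ge> 0" using \<kappa> \<kappa>0 by linarith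
        have 1: "\<bar>real n - real (center t)\<bar> \<le> real n powr \<kappa>'"
          using d powr_mono2[OF \<kappa>'0 x0 nx] by linarith
        have 2: "\<bar>real (center t) - real n\<bar> \<le> real (center t) powr \<kappa>'"
          using d powr_mono2[OF \<kappa>'0 x0 c(1)] by linarith
        have "n \<ge> T" "n \<ge> 1" "center t \<ge> T" "center t \<ge> 1" using nx c(1) xT by linarith+
        then show ?thesis using T[OF _ _ 1] T[OF _ _ 2] by blast
      qed
      moreover have "center t \<ge> 1" using c(1) xT by linarith
      ultimately show ?case by blast
    qed
  qed
  have s0: "s t \<ge> 0" for t by (simp add: s_def sum_nonneg walk_prob_nonneg)
  have "(\<lambda>t. r t - s t) \<longlonglongrightarrow> 0"
  proof (rule tendstoI)
    fix e :: real assume "e > 0"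
    define B where "B = 1 / \<mu> + 1"
    have B: "B > 0" using mean_pos by (simp add: B_def add_pos_pos)
    define \<epsilon> where "\<epsilon> = e / (2 * B)"
    have \<epsilon>: "\<epsilon> > 0" using \<open>e > 0\<close> B by (simp add: \<epsilon>_def)
    have evB: "eventually (\<lambda>t. s t < B) sequentially"
      by (rule order_tendstoD[OF slim]) (simp add: B_def)
    show "eventually (\<lambda>t. dist (r t - s t) 0 < e) sequentially"
      using comp[OF \<epsilon>] evB
    proof eventually_elim
      case (elim t)
      have pc: "p (center t) > 0" using elim(1) by (intro p_pos) auto
      have "r t = (\<Sum>n\<in>W t. p n / p (center t) * w n (int t))"
        by (simp add: r_def sum_divide_distrib)
      then have "r t - s t = (\<Sum>n\<in>W t. (p n / p (center t) - 1) * w n (int t))"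
        by (simp add: s_def sum_subtractf[symmetric] algebra_simps)
      also have "\<bar>\<dots>\<bar> \<le> (\<Sum>n\<in>W t. \<epsilon> * w n (int t))"
      proof (intro order_trans[OF sum_abs] sum_mono)
        fix n assume n: "n \<in> W t"
        have le: "p n \<le> (1 + \<epsilon>) * p (center t)" "p (center t) \<le> (1 + \<epsilon>) * p n" using elim(1) n by auto
        define y where "y = p n / p (center t)"
        have y: "y \<le> 1 + \<epsilon>" "1 \<le> (1 + \<epsilon>) * y" using le pc by (auto simp: y_def field_simps)
        have "1 - \<epsilon> \<le> y"
        proof (rule ccontr)
          assume "\<not> 1 - \<epsilon> \<le> y"
          then have "(1 + \<epsilon>) * y < (1 + \<epsilon>) * (1 - \<epsilon>)" using \<epsilon> by (intro mult_strict_left_mono) auto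
          also have "\<dots> \<le> 1" by (simp add: algebra_simps)
          finally show False using y by linarith
        qed
        then have "\<bar>y - 1\<bar> \<le> \<epsilon>" using y by linarith
        then show "\<bar>(p n / p (center t) - 1) * w n (int t)\<bar> \<le> \<epsilon> * w n (int t)"
          unfolding y_def[symmetric] abs_mult using walk_prob_nonneg[of P n "int t"]
          by (simp add: mult_right_mono)
      qed
      also have "\<dots> = \<epsilon> * s t" by (simp add: s_def sum_distrib_left)
      also have "\<dots> \<le> \<epsilon> * B" using elim(2) \<epsilon> by simp
      also have "\<dots> < e" using \<open>e > 0\<close> B by (simp add: \<epsilon>_def)
      finally show ?case by (simp add: dist_norm)
    qed
  qed
  from tendsto_add[OF this slim] have "r \<longlonglongrightarrow> 1 / \<mu>" by simp
  then show ?thesis using that \<kappa> unfolding r_def[abs_def] W_def by blast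
qed

abbreviation far_part :: "nat \<Rightarrow> real" where
  "far_part t \<equiv> (\<Sum>n. p (n + cutoff t) * w (n + cutoff t) (int t))"

text \<open>For \<open>q\<close> between \<open>1 + \<beta>\<close> and \<open>\<alpha> - 1\<close>
  the dyadic estimate is dominated by the tail sum of the hypothesis at \<open>cutoff t\<close>,
  hence is \<open>o(p (cutoff t))\<close>; (R1) carries this over to
  \<open>center t\<close>.\<close>

lemma far_weighted: "(\<lambda>t. far_part t / p (center t)) \<longlonglongrightarrow> 0"
proof -
  have "max 1 (1 + \<beta>) < \<alpha> - 1" using beta alpha by simp
  then obtain q where q: "1 < q" "q < \<alpha> - 1" "1 + \<beta> < q" using dense by (metis max_less_iff_conj)
  have two: "(2::real) > 0" by simp
  obtain c S where c: "c > 0" "S \<ge> 1" and cmp: "\<And>m n. m \<ge> S \<Longrightarrow> m \<le> n \<Longrightarrow> real n \<le> 2 * real m \<Longrightarrow> p n \<le> c * p m \<and> p m \<le> c * p n"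
    using cond_R1_comparable[OF R1 p_nonneg two] by metis
  have cmp': "p n \<le> c * p m \<and> p m \<le> c * p n" if "m \<ge> S" "m \<le> n" "n \<le> 2 * m" for m n
    using that by (intro cmp) auto
  obtain C T where C: "C > 0" "T \<ge> 1" and far: "\<And>(m::nat) (t::nat) J. m \<ge> T \<Longrightarrow> 2 * real t \<le> \<mu> * real m \<Longrightarrow>
      (\<Sum>n\<in>{m..<2 ^ J * m}. p n * w n (int t)) \<le> C * (\<Sum>n\<in>{m..<2 ^ J * m}. real n powr (- q) * p n)"
    by (rule far_sum[where q = q and p = p and S = S and c = c, OF q(1) q(2) p_nonneg], rule cmp', assumption+, rule that)
  obtain c' where c': "c' > 0" and near: "eventually (\<lambda>t. \<forall>n. real t < 2 * \<mu> * real n \<longrightarrow> n \<le> cutoff t \<longrightarrow> p n \<le> c' * p (center t)) sequentially"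
    by (rule p_near_center) (rule that)
  define tl where "tl t = (\<Sum>\<^sub>\<infinity>n\<in>{t..}. real n powr (- 1 - \<beta>) * p n)" for t
  have "summable (\<lambda>n. real n powr (- 1 - \<beta>) * p n)"
  proof (rule summable_comparison_test'[OF p_summable, of 1])
    fix n :: nat assume "n \<ge> 1"
    then have "real n powr (- 1 - \<beta>) \<le> 1" using powr_mono[of "- 1 - \<beta>" 0 "real n"] beta by simp
    then show "norm (real n powr (- 1 - \<beta>) * p n) \<le> p n" using p_nonneg[of n] by (simp add: mult_left_le_one_le)
  qed
  then have "(\<lambda>n. real n powr (- 1 - \<beta>) * p n) summable_on UNIV"
    by (intro norm_summable_imp_summable_on) (simp add: p_nonneg)
  then have tl_sum: "(\<lambda>n. real n powr (- 1 - \<beta>) * p n) summable_on {t..}" for t :: nat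
    by (rule summable_on_subset_banach) simp
  have tl0: "tl t \<ge> 0" for t unfolding tl_def by (intro infsum_nonneg) (simp add: p_nonneg)
  have cut: "filterlim cutoff sequentially sequentially"
  proof (rule filterlim_at_top_mono[OF center_at_top])
    have "center t \<le> cutoff t" for t
    proof -
      have "real (center t) \<le> 2 * real t / \<mu>"
        using center_bounds(1)[of t] mean_pos by (simp add: field_simps)
      also have "\<dots> < real (cutoff t)" using cutoff_bounds(1)[of t] mean_pos by (simp add: field_simps)
      finally show ?thesis by simp
    qed
    then show "eventually (\<lambda>t. center t \<le> cutoff t) sequentially" by simp
  qed
  have evc: "eventually (\<lambda>t. center t \<ge> 1) sequentially" using center_at_top by (simp add: filterlim_at_top)
  have evT: "eventually (\<lambda>t. cutoff t \<ge> T) sequentially" using cut by (simp add: filterlim_at_top)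
  have tlp: "(\<lambda>t. tl t / p t) \<longlonglongrightarrow> 0"
    using tail_small unfolding tl_def[abs_def] by (rule smalloD_tendsto)
  from tendsto_mult_right_zero[OF filterlim_compose[OF this cut]]
  have lim: "(\<lambda>t. (C * c') * (tl (cutoff t) / p (cutoff t))) \<longlonglongrightarrow> 0" .
  have up: "eventually (\<lambda>t. far_part t / p (center t) \<le> (C * c') * (tl (cutoff t) / p (cutoff t))) sequentially"
    using evc evT near
  proof eventually_elim
    case (elim t)
    have "far_part t \<le> C * tl (cutoff t)"
    proof (rule suminf_cutoff_le[THEN conjunct2, OF p_nonneg])
      fix J
      have "(\<Sum>n\<in>{cutoff t..<2 ^ J * cutoff t}. p n * w n (int t)) \<le> C * (\<Sum>n\<in>{cutoff t..<2 ^ J * cutoff t}. real n powr (- q) * p n)"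
        using elim cutoff_bounds(1)[of t] by (intro far) auto
      also have "(\<Sum>n\<in>{cutoff t..<2 ^ J * cutoff t}. real n powr (- q) * p n) \<le> (\<Sum>n\<in>{cutoff t..<2 ^ J * cutoff t}. real n powr (- 1 - \<beta>) * p n)"
        using cutoff_bounds(3)[of t] q by (intro sum_mono mult_right_mono p_nonneg powr_mono) auto
      also have "\<dots> \<le> tl (cutoff t)"
        unfolding tl_def by (rule finite_sum_le_infsum[OF tl_sum]) (auto simp: p_nonneg)
      finally show "(\<Sum>n\<in>{cutoff t..<2 ^ J * cutoff t}. p n * w n (int t)) \<le> C * tl (cutoff t)"
        using C by simp
    qed (use cutoff_bounds(3) in auto)
    then have "far_part t / p (center t) \<le> C * tl (cutoff t) / p (center t)"
      using p_nonneg by (intro divide_right_mono) auto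
    also have "\<dots> \<le> C * tl (cutoff t) * (c' / p (cutoff t))"
    proof -
      have pos: "p (center t) > 0" "p (cutoff t) > 0" using elim cutoff_bounds(3)[of t] by (auto intro: p_pos)
      have "0 \<le> \<mu> * real (cutoff t)" using mean_pos by simp
      then have "real t < 2 * \<mu> * real (cutoff t)" using cutoff_bounds(1)[of t] by linarith
      then have "p (cutoff t) \<le> c' * p (center t)" using elim by blast
      then have "1 / p (center t) \<le> c' / p (cutoff t)" using pos by (simp add: field_simps)
      then have "C * tl (cutoff t) * (1 / p (center t)) \<le> C * tl (cutoff t) * (c' / p (cutoff t))"
        using C tl0 by (intro mult_left_mono) auto
      then show ?thesis by simp
    qed
    finally show ?case by (simp add: mult_ac)
  qed
  show ?thesis
    by (rule tendsto_sandwich[OF _ up tendsto_const lim])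
       (auto intro!: always_eventually divide_nonneg_nonneg suminf_nonneg summable_ignore_initial_segment[OF summable_stopped] mult_nonneg_nonneg p_nonneg walk_prob_nonneg)
qed

text \<open>Indices are split into few summands, window, remaining indices below the cutoff, and far
  indices. Of the last three only the window survives after division by
  \<open>p (center t)\<close>.\<close>

lemma main_part: "(\<lambda>t. (stopped_prob t - small_part t) / p (center t)) \<longlonglongrightarrow> 1 / \<mu>"
proof -
  obtain \<kappa> where \<kappa>: "1 / (\<alpha> - 1) < \<kappa>" "\<kappa> < 1" and win:
    "(\<lambda>t. (\<Sum>n\<in>window \<kappa> t. p n * w n (int t)) / p (center t)) \<longlonglongrightarrow> 1 / \<mu>"
    by (rule window_weighted) (rule that)
  define W where "W = window \<kappa>"
  \<comment> \<open>Indices below \<open>t / (2 * \<mu>)\<close> are excluded here, since (R1)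
    compares \<open>p n\<close> with \<open>p (center t)\<close> only at bounded ratios; they form
    \<open>small_part\<close>.\<close>
  define Out where "Out t = {n. n < cutoff t \<and> \<bar>real t - real n * \<mu>\<bar> \<ge> real t powr \<kappa> \<and> real t < 2 * \<mu> * real n}" for t
  define Out' where "Out' = outside \<kappa>"
  define Sm where "Sm t = {n. 2 * \<mu> * real n \<le> real t}" for t
  obtain c where c: "c > 0" and near: "eventually (\<lambda>t. \<forall>n. real t < 2 * \<mu> * real n \<longrightarrow> n \<le> cutoff t \<longrightarrow> p n \<le> c * p (center t)) sequentially"
    by (rule p_near_center) (rule that)
  have evc: "eventually (\<lambda>t. center t \<ge> 1) sequentially" using center_at_top by (simp add: filterlim_at_top)
  have lim: "(\<lambda>t. c * (\<Sum>n\<in>Out' t. w n (int t))) \<longlonglongrightarrow> 0"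
    unfolding Out'_def by (rule tendsto_mult_right_zero[OF outside_window_tendsto_0[OF \<kappa>]])
  have up: "eventually (\<lambda>t. (\<Sum>n\<in>Out t. p n * w n (int t)) / p (center t) \<le> c * (\<Sum>n\<in>Out' t. w n (int t))) sequentially"
    using evc near
  proof eventually_elim
    case (elim t)
    have pc: "p (center t) > 0" using elim by (intro p_pos) auto
    have "(\<Sum>n\<in>Out t. p n * w n (int t)) \<le> (\<Sum>n\<in>Out t. c * p (center t) * w n (int t))"
      using elim(2) by (intro sum_mono mult_right_mono walk_prob_nonneg) (auto simp: Out_def)
    also have "\<dots> \<le> (\<Sum>n\<in>Out' t. c * p (center t) * w n (int t))"
      using c p_nonneg by (intro sum_mono2) (auto simp: Out_def Out'_def outside_def walk_prob_nonneg)
    also have "\<dots> = c * (\<Sum>n\<in>Out' t. w n (int t)) * p (center t)"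
      by (simp add: sum_distrib_left mult_ac)
    finally show ?case using pc by (simp add: pos_divide_le_eq)
  qed
  have out: "(\<lambda>t. (\<Sum>n\<in>Out t. p n * w n (int t)) / p (center t)) \<longlonglongrightarrow> 0"
    by (rule tendsto_sandwich[OF _ up tendsto_const lim])
       (auto intro!: always_eventually divide_nonneg_nonneg sum_nonneg mult_nonneg_nonneg p_nonneg walk_prob_nonneg)
  \<comment> \<open>Few summands have mean at most \<open>t / 2\<close>, so from here on they cannot
    meet the window.\<close>
  have ev2: "eventually (\<lambda>t::nat. real t powr \<kappa> < real t / 2) sequentially"
    using \<kappa> by real_asymp
  have "eventually (\<lambda>t. (\<Sum>n\<in>W t. p n * w n (int t)) / p (center t) + (\<Sum>n\<in>Out t. p n * w n (int t)) / p (center t)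
       + far_part t / p (center t)
      = (stopped_prob t - small_part t) / p (center t)) sequentially"
    using ev2
  proof eventually_elim
    case (elim t)
    have less: "n < cutoff t" if "n \<in> Sm t" for n
    proof -
      have "\<mu> * real n < \<mu> * real (cutoff t)"
        using that cutoff_bounds(1)[of t] unfolding Sm_def by (simp add: mult.assoc)
      then show ?thesis using mean_pos by simp
    qed
    have disj: "Sm t \<inter> W t = {}" "(Sm t \<union> W t) \<inter> Out t = {}"
    proof -
      have "\<bar>real t - real n * \<mu>\<bar> \<ge> real t / 2" if "n \<in> Sm t" for n
        using that unfolding Sm_def by (simp add: mult_ac)
      then show "Sm t \<inter> W t = {}" using elim by (force simp: W_def window_def)
      then show "(Sm t \<union> W t) \<inter> Out t = {}" by (auto simp: Sm_def W_def window_def Out_def)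
    qed
    have un: "{..<cutoff t} = (Sm t \<union> W t) \<union> Out t"
      using less by (auto simp: Sm_def W_def window_def Out_def not_le not_less)
    have fin: "finite (Sm t)" "finite (W t)" "finite (Out t)"
      using un finite_lessThan[of "cutoff t"] by (metis finite_Un)+
    have "(\<Sum>n<cutoff t. p n * w n (int t)) = (\<Sum>n\<in>Sm t. p n * w n (int t)) + (\<Sum>n\<in>W t. p n * w n (int t)) + (\<Sum>n\<in>Out t. p n * w n (int t))"
      unfolding un using disj fin by (simp add: sum.union_disjoint)
    moreover have "(\<Sum>n\<in>Sm t. p n * w n (int t)) = small_part t" by (simp add: small_part_def Sm_def)
    moreover have "stopped_prob t = far_part t + (\<Sum>n<cutoff t. p n * w n (int t))"
      unfolding stopped_prob_def by (rule suminf_split_initial_segment[OF summable_stopped])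
    ultimately show ?case by (simp add: add_divide_distrib[symmetric])
  qed
  moreover have "(\<lambda>t. (\<Sum>n\<in>W t. p n * w n (int t)) / p (center t) + (\<Sum>n\<in>Out t. p n * w n (int t)) / p (center t)
       + far_part t / p (center t)) \<longlonglongrightarrow> 1 / \<mu> + 0 + 0"
    by (intro tendsto_add win[folded W_def] out far_weighted)
  ultimately show ?thesis using Lim_transform_eventually by force
qed

end

context stopped_heavy_walk
begin

section \<open>The contribution of few summands and the two asymptotic statements\<close>

lemma small_part_nonneg: "0 \<le> small_part t"
  unfolding small_part_def by (auto intro!: sum_nonneg mult_nonneg_nonneg p_nonneg walk_prob_nonneg)

lemma finite_small: "finite {n. 2 * \<mu> * real n \<le> real t}"
proof (rule finite_subset)
  have "n < cutoff t" if "2 * \<mu> * real n \<le> real t" for n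
  proof -
    have "\<mu> * real n < \<mu> * real (cutoff t)"
      using that cutoff_bounds(1)[of t] by (simp add: mult.assoc)
    then show ?thesis using mean_pos by simp
  qed
  then show "{n. 2 * \<mu> * real n \<le> real t} \<subseteq> {..<cutoff t}" by auto
qed simp

lemma small_part_tendsto:
  assumes EN: "summable (\<lambda>n. real n * p n)"
  shows "(\<lambda>t. small_part t / pmf P (int t)) \<longlonglongrightarrow> (\<Sum>n. real n * p n)"
proof -
  obtain C where C: "C > 0" and jump:
    "eventually (\<lambda>t. \<forall>n. 2 * \<mu> * real n \<le> real t \<longrightarrow> w n (int t) \<le> C * real n * pmf P (int t)) sequentially"
    by (rule local_one_big_jump) (rule that)
  \<comment> \<open>Extension by 0 turns a sum over a range depending on \<open>t\<close> into a
    series over a fixed index set with majorant \<open>C * k * p k\<close>, as Tannery's theorem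
    requires.\<close>
  define a where "a k t = (if 2 * \<mu> * real k \<le> real t then p k * w k (int t) / pmf P (int t) else 0)" for k t
  have lim: "(\<lambda>t. a k t) \<longlonglongrightarrow> real k * p k" for k
  proof -
    have "(\<lambda>t. p k * (w k (int t) / pmf P (int t))) \<longlonglongrightarrow> p k * real k"
      by (intro tendsto_mult_left local_fixed_number)
    moreover have "eventually (\<lambda>t. p k * (w k (int t) / pmf P (int t)) = a k t) sequentially"
      using eventually_real_ge[of "2 * \<mu> * real k"] by eventually_elim (simp add: a_def)
    ultimately show ?thesis by (simp add: Lim_transform_eventually mult.commute)
  qed
  have "eventually (\<lambda>t. \<forall>k. norm (a k t) \<le> C * (real k * p k)) sequentially"
    using pmf_int_pos_eventually jump
  proof eventually_elim
    case (elim t)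
    show ?case
    proof
      fix k
      show "norm (a k t) \<le> C * (real k * p k)"
      proof (cases "2 * \<mu> * real k \<le> real t")
        case True
        then have "p k * w k (int t) \<le> p k * (C * real k * pmf P (int t))"
          using elim by (intro mult_left_mono p_nonneg) auto
        then have "p k * w k (int t) / pmf P (int t) \<le> C * (real k * p k)"
          using elim(1) by (simp add: pos_divide_le_eq mult_ac)
        then show ?thesis using True p_nonneg[of k] walk_prob_nonneg[of P k "int t"] elim(1) by (simp add: a_def)
      next
        case False
        then show ?thesis using C p_nonneg[of k] by (simp add: a_def)
      qed
    qed
  qed
  from eventually_compose_filterlim[OF this filterlim_snd]
  have bnd: "eventually (\<lambda>(k, t). norm (a k t) \<le> C * (real k * p k)) (at_top \<times>\<^sub>F sequentially)"
    by (rule eventually_mono) auto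
  have "(\<lambda>t. suminf (\<lambda>k. a k t)) \<longlonglongrightarrow> (\<Sum>k. real k * p k)"
    using tannerys_theorem[OF lim bnd] EN by (simp add: summable_mult)
  moreover have "suminf (\<lambda>k. a k t) = small_part t / pmf P (int t)" for t
    using suminf_finite[OF finite_small, of t "\<lambda>k. a k t"]
    by (auto simp: a_def small_part_def sum_divide_distrib intro!: sum.cong)
  ultimately show ?thesis by simp
qed

lemma expectation_pos: "summable (\<lambda>n. real n * p n) \<Longrightarrow> (\<Sum>n. real n * p n) > 0"
  using p_pos[of 1] p_nonneg by (intro suminf_pos2[where i = 1]) auto

theorem finite_mean_asymptotics:
  assumes EN: "summable (\<lambda>n. real n * p n)"
  shows "\<exists>e1 e2 :: nat \<Rightarrow> real. e1 \<in> o(\<lambda>_. 1) \<and> e2 \<in> o(\<lambda>_. 1) \<and>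
    (\<forall>\<^sub>F t in sequentially. stopped_prob t =
       (\<Sum>n. real n * p n) * pmf P (int t) * (1 + e1 t) + inverse \<mu> * p (center t) * (1 + e2 t))"
proof -
  define E where "E = (\<Sum>n. real n * p n)"
  have E: "E > 0" unfolding E_def by (rule expectation_pos[OF EN])
  \<comment> \<open>The error terms are obtained by solving for them in the split into
    \<open>small_part\<close> and the rest, so the identity is pure algebra and only their limits
    carry content.\<close>
  define e1 where "e1 t = small_part t / pmf P (int t) / E - 1" for t
  define e2 where "e2 t = \<mu> * ((stopped_prob t - small_part t) / p (center t)) - 1" for t
  have "(\<lambda>t. small_part t / pmf P (int t) / E - 1) \<longlonglongrightarrow> E / E - 1"
    unfolding E_def by (intro tendsto_intros small_part_tendsto[OF EN]) (use E E_def in simp)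
  then have e1: "e1 \<longlonglongrightarrow> 0" using E by (simp add: e1_def[abs_def])
  have "(\<lambda>t. \<mu> * ((stopped_prob t - small_part t) / p (center t)) - 1) \<longlonglongrightarrow> \<mu> * (1 / \<mu>) - 1"
    by (intro tendsto_intros main_part)
  then have e2: "e2 \<longlonglongrightarrow> 0" using mean_pos by (simp add: e2_def[abs_def])
  have evc: "eventually (\<lambda>t. center t \<ge> 1) sequentially" using center_at_top by (simp add: filterlim_at_top)
  have "eventually (\<lambda>t. stopped_prob t = E * pmf P (int t) * (1 + e1 t) + inverse \<mu> * p (center t) * (1 + e2 t)) sequentially"
    using evc pmf_int_pos_eventually
  proof eventually_elim
    case (elim t)
    have pc: "p (center t) > 0" using elim(1) by (rule p_pos)
    have "inverse \<mu> * p (center t) * (1 + e2 t)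
       = (inverse \<mu> * \<mu>) * (p (center t) * ((stopped_prob t - small_part t) / p (center t)))"
      unfolding e2_def by (simp only: add_diff_cancel_left' diff_add_cancel add.commute[of 1] mult_ac)
    then have "inverse \<mu> * p (center t) * (1 + e2 t) = stopped_prob t - small_part t"
      using pc mean_pos by simp
    moreover have "E * pmf P (int t) * (1 + e1 t) = small_part t"
      using E elim(2) by (simp add: e1_def)
    ultimately show ?case by simp
  qed
  then show ?thesis
    using e1 e2 unfolding E_def[symmetric] by (intro exI[of _ e1] exI[of _ e2]) (auto intro!: smalloI_tendsto)
qed

lemma pmf_smallo_center:
  assumes "(\<lambda>t::nat. pmf P (int t)) \<in> o(p)"
  shows "(\<lambda>t. pmf P (int t) / p (center t)) \<longlonglongrightarrow> 0"
proof -
  obtain c where c: "c > 0" "eventually (\<lambda>t. p t \<le> c * p (center t)) sequentially"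
    by (rule p_le_center) (rule that)
  have evc: "eventually (\<lambda>t. center t \<ge> 1) sequentially" using center_at_top by (simp add: filterlim_at_top)
  have lim: "(\<lambda>t. c * (pmf P (int t) / p t)) \<longlonglongrightarrow> 0"
    using smalloD_tendsto[OF assms] by (rule tendsto_mult_right_zero)
  have up: "eventually (\<lambda>t. pmf P (int t) / p (center t) \<le> c * (pmf P (int t) / p t)) sequentially"
    using c(2) evc eventually_ge_at_top[of 1]
  proof eventually_elim
    case (elim t)
    have pos: "p (center t) > 0" "p t > 0" using elim p_pos by auto
    then have "1 / p (center t) \<le> c / p t" using elim by (simp add: field_simps)
    from mult_left_mono[OF this, of "pmf P (int t)"] show ?case by (simp add: mult_ac)
  qed
  show ?thesis
    by (rule tendsto_sandwich[OF _ up tendsto_const lim]) (auto intro!: always_eventually divide_nonneg_nonneg p_nonneg)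
qed

text \<open>Writing $n = n^{1-s} n^s$ with $s$ slightly below $\gamma - 1$, the series $\sum n^s p_n$ converges,
  so the truncated mean of $N$ up to $t/\mu$ is $O(t^{1-s})$.\<close>

lemma cond_P_small_part:
  assumes "cond_P p" and EN: "\<not> summable (\<lambda>n. real n * p n)"
  shows "(\<lambda>t. small_part t / p (center t)) \<longlonglongrightarrow> 0"
proof -
  obtain \<gamma> L2 where L2: "slowly_varying L2" and pL2: "\<And>t. t \<ge> 1 \<Longrightarrow> p t = real t powr (-\<gamma>) * L2 (real t)"
    using assms(1) unfolding cond_P_def by blast
  \<comment> \<open>The final exponent loses \<open>\<delta>\<close> four times: once in each of the
    bounds for \<open>pmf P\<close> and \<open>p\<close>, twice in \<open>s\<close>. The total
    \<open>2 - \<alpha> + 4 * \<delta>\<close> must stay negative.\<close>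
  define \<delta> where "\<delta> = (\<alpha> - 2) / 8"
  have \<delta>: "\<delta> > 0" "2 - \<alpha> + 4 * \<delta> < 0" using alpha by (auto simp: \<delta>_def field_simps)
  have bounds: "eventually (\<lambda>t. real t powr (- \<gamma> - \<delta>) \<le> p t \<and> p t \<le> real t powr (- \<gamma> + \<delta>)) sequentially"
    using eventually_compose_filterlim[OF regularly_varying_bounds[OF L2 \<delta>(1), of \<gamma>] filterlim_real_sequentially] eventually_ge_at_top[of 1]
    by eventually_elim (simp add: pL2)
  \<comment> \<open>One \<open>\<delta>\<close> pays for \<open>L2\<close>, the other for
    convergence: the terms become at most \<open>n powr (- 1 - \<delta>)\<close>.\<close>
  define s where "s = \<gamma> - 1 - 2 * \<delta>"
  have sum_s: "summable (\<lambda>n. real n powr s * p n)"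
  proof (rule summable_comparison_test_ev)
    show "summable (\<lambda>n. real n powr (- 1 - \<delta>))" using \<delta> by (simp add: summable_real_powr_iff)
    show "eventually (\<lambda>n. norm (real n powr s * p n) \<le> real n powr (- 1 - \<delta>)) sequentially"
      using bounds
    proof eventually_elim
      case (elim n)
      have "real n powr s * p n \<le> real n powr s * real n powr (- \<gamma> + \<delta>)" using elim by (intro mult_left_mono) auto
      also have "\<dots> = real n powr (- 1 - \<delta>)"
        unfolding powr_add[symmetric] by (rule arg_cong2[where f = "(powr)"]) (simp_all add: s_def)
      finally show ?case using p_nonneg[of n] by simp
    qed
  qed
  \<comment> \<open>Otherwise \<open>n \<le> n powr s\<close> and \<open>N\<close> would have finite
    mean. Positivity of \<open>1 - s\<close> is what lets \<open>n powr (1 - s)\<close> be bounded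
    by its value at \<open>t / \<mu>\<close>.\<close>
  have s1: "s < 1"
  proof (rule ccontr)
    assume s: "\<not> s < 1"
    have "summable (\<lambda>n. real n * p n)"
    proof (rule summable_comparison_test'[OF sum_s, of 1])
      fix n :: nat assume "n \<ge> 1"
      then have "real n powr 1 \<le> real n powr s" using s by (intro powr_mono) auto
      then show "norm (real n * p n) \<le> real n powr s * p n"
        using p_nonneg[of n] \<open>n \<ge> 1\<close> by (simp add: mult_right_mono)
    qed
    then show False using EN by simp
  qed
  define Z where "Z = (\<Sum>n. real n powr s * p n)"
  have Z0: "Z \<ge> 0" unfolding Z_def by (rule suminf_nonneg[OF sum_s]) (simp add: p_nonneg)
  have truncated_mean: "(\<Sum>n | 2 * \<mu> * real n \<le> real t. real n * p n) \<le> (real t / \<mu>) powr (1 - s) * Z" for t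
  proof -
    have "(\<Sum>n | 2 * \<mu> * real n \<le> real t. real n * p n)
       \<le> (\<Sum>n | 2 * \<mu> * real n \<le> real t. (real t / \<mu>) powr (1 - s) * (real n powr s * p n))"
    proof (rule sum_mono)
      fix n assume n: "n \<in> {n. 2 * \<mu> * real n \<le> real t}"
      have "0 \<le> \<mu> * real n" using mean_pos by simp
      then have "real n \<le> real t / \<mu>" using n mean_pos by (simp add: field_simps)
      then have "real n powr (1 - s) \<le> (real t / \<mu>) powr (1 - s)" using s1 by (intro powr_mono2) auto
      then have "real n powr (1 - s) * (real n powr s * p n) \<le> (real t / \<mu>) powr (1 - s) * (real n powr s * p n)"
        using p_nonneg by (intro mult_right_mono) auto
      moreover have "real n powr (1 - s) * real n powr s = real n" by (simp add: powr_add[symmetric])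
      ultimately show "real n * p n \<le> (real t / \<mu>) powr (1 - s) * (real n powr s * p n)"
        by (simp add: mult.assoc[symmetric])
    qed
    also have "\<dots> = (real t / \<mu>) powr (1 - s) * (\<Sum>n | 2 * \<mu> * real n \<le> real t. real n powr s * p n)"
      by (simp add: sum_distrib_left)
    also have "\<dots> \<le> (real t / \<mu>) powr (1 - s) * Z"
      unfolding Z_def by (intro mult_left_mono sum_le_suminf sum_s finite_small) (auto simp: p_nonneg)
    finally show ?thesis .
  qed
  obtain C where C: "C > 0" and jump:
    "eventually (\<lambda>t. \<forall>n. 2 * \<mu> * real n \<le> real t \<longrightarrow> w n (int t) \<le> C * real n * pmf P (int t)) sequentially"
    by (rule local_one_big_jump) (rule that)
  obtain c where c: "c > 0" "eventually (\<lambda>t. p t \<le> c * p (center t)) sequentially"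
    by (rule p_le_center) (rule that)
  have evc: "eventually (\<lambda>t. center t \<ge> 1) sequentially" using center_at_top by (simp add: filterlim_at_top)
  define G where "G = c * C * Z * (1 / \<mu>) powr (1 - s)"
  have lim: "(\<lambda>t::nat. G * real t powr (2 - \<alpha> + 4 * \<delta>)) \<longlonglongrightarrow> 0"
    using \<delta>(2) by real_asymp
  have up: "eventually (\<lambda>t. small_part t / p (center t) \<le> G * real t powr (2 - \<alpha> + 4 * \<delta>)) sequentially"
    using c(2) evc eventually_ge_at_top[of 1] jump bounds pmf_bounds[OF \<delta>(1)]
  proof eventually_elim
    case (elim t)
    have pos: "p (center t) > 0" "p t > 0" using elim p_pos by auto
    have t: "real t > 0" using elim by simp
    have "small_part t \<le> (\<Sum>n | 2 * \<mu> * real n \<le> real t. C * pmf P (int t) * (real n * p n))"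
      unfolding small_part_def
    proof (rule sum_mono)
      fix n assume n: "n \<in> {n. 2 * \<mu> * real n \<le> real t}"
      have "w n (int t) \<le> C * real n * pmf P (int t)"
        using n elim by blast
      from mult_left_mono[OF this p_nonneg[of n]]
      show "p n * w n (int t) \<le> C * pmf P (int t) * (real n * p n)" by (simp add: mult_ac)
    qed
    also have "\<dots> = C * pmf P (int t) * (\<Sum>n | 2 * \<mu> * real n \<le> real t. real n * p n)"
      by (simp add: sum_distrib_left)
    also have "\<dots> \<le> C * real t powr (- \<alpha> + \<delta>) * ((real t / \<mu>) powr (1 - s) * Z)"
      using C elim by (intro mult_mono mult_left_mono truncated_mean) (auto intro!: sum_nonneg p_nonneg mult_nonneg_nonneg)
    also have "(real t / \<mu>) powr (1 - s) = (1 / \<mu>) powr (1 - s) * real t powr (1 - s)"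
      using mean_pos powr_mult[of "1 / \<mu>" "real t" "1 - s"] by simp
    finally have 1: "small_part t \<le> C * real t powr (- \<alpha> + \<delta>) * ((1 / \<mu>) powr (1 - s) * real t powr (1 - s) * Z)" .
    have 2: "1 / p (center t) \<le> c * real t powr (\<gamma> + \<delta>)"
    proof -
      have "1 / p (center t) \<le> c / p t" using elim pos by (simp add: field_simps)
      also have "\<dots> \<le> c / real t powr (- \<gamma> - \<delta>)" using elim c t pos by (intro divide_left_mono) auto
      also have "\<dots> = c * real t powr (\<gamma> + \<delta>)"
        using powr_minus_divide[of "real t" "\<gamma> + \<delta>"] by simp
      finally show ?thesis .
    qed
    have "small_part t * (1 / p (center t))
       \<le> (C * real t powr (- \<alpha> + \<delta>) * ((1 / \<mu>) powr (1 - s) * real t powr (1 - s) * Z)) * (c * real t powr (\<gamma> + \<delta>))"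
      using 1 2 pos C Z0 by (intro mult_mono) auto
    also have "\<dots> = G * (real t powr (- \<alpha> + \<delta>) * real t powr (1 - s) * real t powr (\<gamma> + \<delta>))"
      by (simp add: G_def mult_ac)
    also have "real t powr (- \<alpha> + \<delta>) * real t powr (1 - s) * real t powr (\<gamma> + \<delta>) = real t powr (2 - \<alpha> + 4 * \<delta>)"
      unfolding powr_add[symmetric] by (rule arg_cong2[where f = "(powr)"]) (simp_all add: s_def)
    finally show ?case by simp
  qed
  show ?thesis
    by (rule tendsto_sandwich[OF _ up tendsto_const lim])
       (auto intro!: always_eventually divide_nonneg_nonneg small_part_nonneg p_nonneg)
qed

text \<open>It remains to see that \<open>small_part\<close> is negligible. With finite mean it is
  of order \<open>pmf P t\<close>, which is \<open>o(p t)\<close>, and \<open>p t\<close> is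
  comparable to \<open>p (center t)\<close>; otherwise the estimate under (P) applies.\<close>

theorem light_jump_asymptotics:
  assumes small: "(\<lambda>t::nat. pmf P (int t)) \<in> o(p)"
    and "summable (\<lambda>n. real n * p n) \<or> cond_P p"
  shows "stopped_prob \<sim>[sequentially] (\<lambda>t. inverse \<mu> * p (center t))"
proof -
  have lim: "(\<lambda>t. small_part t / p (center t)) \<longlonglongrightarrow> 0"
  proof (cases "summable (\<lambda>n. real n * p n)")
    case True
    have "(\<lambda>t. small_part t / pmf P (int t) * (pmf P (int t) / p (center t))) \<longlonglongrightarrow> (\<Sum>n. real n * p n) * 0"
      by (intro tendsto_mult small_part_tendsto[OF True] pmf_smallo_center[OF small])
    moreover have "eventually (\<lambda>t. small_part t / pmf P (int t) * (pmf P (int t) / p (center t)) = small_part t / p (center t)) sequentially"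
      using pmf_int_pos_eventually by eventually_elim simp
    ultimately show ?thesis by (simp add: Lim_transform_eventually)
  qed (use assms(2) cond_P_small_part in blast)
  have "(\<lambda>t. \<mu> * ((stopped_prob t - small_part t) / p (center t) + small_part t / p (center t))) \<longlonglongrightarrow> \<mu> * (1 / \<mu> + 0)"
    by (intro tendsto_intros main_part lim)
  then have "(\<lambda>t. \<mu> * ((stopped_prob t - small_part t) / p (center t) + small_part t / p (center t))) \<longlonglongrightarrow> 1"
    using mean_pos by simp
  \<comment> \<open>The conditional is the convention in asymptotic equivalence that 0 / 0 counts as
    1; positivity of \<open>p (center t)\<close> rules this case out.\<close>
  moreover have "eventually (\<lambda>t. \<mu> * ((stopped_prob t - small_part t) / p (center t) + small_part t / p (center t))
      = (if stopped_prob t = 0 \<and> inverse \<mu> * p (center t) = 0 then 1 else stopped_prob t / (inverse \<mu> * p (center t)))) sequentially"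
  proof -
    have "eventually (\<lambda>t. center t \<ge> 1) sequentially" using center_at_top by (simp add: filterlim_at_top)
    then show ?thesis
    proof eventually_elim
      case (elim t)
      then have "p (center t) > 0" by (rule p_pos)
      then show ?case using mean_pos by (simp add: add_divide_distrib[symmetric] field_simps)
    qed
  qed
  ultimately show ?thesis unfolding asymp_equiv_def by (rule Lim_transform_eventually)
qed

end

section \<open>Transfer to random variables\<close>

text \<open>Summation by parts. It expresses moments through tails, the only form in which the left
  and right sides of the step law can be compared.\<close>

lemma integrable_iff_summable_tail:
  fixes Q :: "nat pmf" and f :: "nat \<Rightarrow> real"
  assumes "mono f" "f 0 = 0"
  shows "integrable Q f \<longleftrightarrow> summable (\<lambda>t. (f (Suc t) - f t) * measure Q {t<..})"
proof -
  have f0: "0 \<le> f k" for k using monoD[OF assms(1), of 0 k] assms(2) by simp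
  have inc: "0 \<le> f (Suc t) - f t" for t using monoD[OF assms(1), of t "Suc t"] by simp
  have "(\<integral>\<^sup>+k. ennreal (f k) \<partial>Q) = (\<integral>\<^sup>+k. (\<Sum>t. ennreal (f (Suc t) - f t) * indicator {t<..} k) \<partial>Q)"
  proof (rule nn_integral_cong)
    fix k
    have "(\<Sum>t. ennreal (f (Suc t) - f t) * indicator {t<..} k) = (\<Sum>t<k. ennreal (f (Suc t) - f t) * indicator {t<..} k)"
      by (rule suminf_finite) (auto simp: indicator_def)
    also have "\<dots> = (\<Sum>t<k. ennreal (f (Suc t) - f t))" by (intro sum.cong) auto
    also have "\<dots> = ennreal (\<Sum>t<k. f (Suc t) - f t)" using inc by (intro sum_ennreal) auto
    also have "\<dots> = ennreal (f k)" by (simp add: sum_lessThan_telescope assms(2))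
    finally show "ennreal (f k) = (\<Sum>t. ennreal (f (Suc t) - f t) * indicator {t<..} k)" by simp
  qed
  also have "\<dots> = (\<Sum>t. \<integral>\<^sup>+k. ennreal (f (Suc t) - f t) * indicator {t<..} k \<partial>Q)"
    by (rule nn_integral_suminf) auto
  also have "\<dots> = (\<Sum>t. ennreal ((f (Suc t) - f t) * measure Q {t<..}))"
    using inc by (intro suminf_cong) (simp add: nn_integral_cmult_indicator measure_pmf.emeasure_eq_measure ennreal_mult')
  finally have eq: "(\<integral>\<^sup>+k. ennreal (f k) \<partial>Q) = (\<Sum>t. ennreal ((f (Suc t) - f t) * measure Q {t<..}))" .
  have "integrable Q f \<longleftrightarrow> (\<integral>\<^sup>+k. ennreal (f k) \<partial>Q) \<noteq> \<infinity>"
    using f0 by (simp add: integrable_iff_bounded less_top)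
  also have "\<dots> \<longleftrightarrow> summable (\<lambda>t. (f (Suc t) - f t) * measure Q {t<..})"
    unfolding eq using inc by (auto intro!: summable_suminf_not_top simp: ennreal_suminf_neq_top)
  finally show ?thesis .
qed

lemma integrable_pmf_nat_iff:
  fixes Q :: "nat pmf" and f :: "nat \<Rightarrow> real"
  assumes "\<And>n. f n \<ge> 0"
  shows "integrable Q f \<longleftrightarrow> summable (\<lambda>n. f n * pmf Q n)"
    and "integrable Q f \<Longrightarrow> (\<integral>n. f n \<partial>Q) = (\<Sum>n. f n * pmf Q n)"
proof -
  show iff: "integrable Q f \<longleftrightarrow> summable (\<lambda>n. f n * pmf Q n)"
    unfolding measure_pmf_eq_density using assms
    by (subst integrable_density) (auto simp: integrable_count_space_nat_iff mult.commute)
  assume int: "integrable Q f"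
  then have "integrable (count_space UNIV) (\<lambda>n. f n * pmf Q n)"
    using iff assms by (simp add: integrable_count_space_nat_iff)
  then show "(\<integral>n. f n \<partial>Q) = (\<Sum>n. f n * pmf Q n)"
    unfolding measure_pmf_eq_density
    by (subst integral_density) (auto simp: integral_count_space_nat[symmetric] mult.commute)
qed

lemma positive_part_moment:
  fixes P :: "int pmf"
  assumes L: "slowly_varying L" and pmf_eq: "\<And>t::nat. t \<ge> 1 \<Longrightarrow> pmf P (int t) = real t powr (- \<alpha>) * L (real t)"
    and s: "0 < s" "s < \<alpha> - 1"
  shows "integrable P (\<lambda>z. real (nat z) powr s)"
proof -
  define Q where "Q = map_pmf nat P"
  have pmfQ: "pmf Q k = pmf P (int k)" if "k \<ge> 1" for k
  proof -
    have "nat -` {k} = {int k}" using that by auto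
    then show ?thesis by (simp add: Q_def pmf_map measure_pmf_single)
  qed
  define \<delta> where "\<delta> = (\<alpha> - 1 - s) / 2"
  have \<delta>: "\<delta> > 0" "s - \<alpha> + \<delta> < - 1" using s by (auto simp: \<delta>_def field_simps)
  have "summable (\<lambda>n. real n powr s * pmf Q n)"
  proof (rule summable_comparison_test_ev)
    show "summable (\<lambda>n. real n powr (s - \<alpha> + \<delta>))" using \<delta> by (simp add: summable_real_powr_iff)
    have "eventually (\<lambda>n::nat. real n powr (- \<alpha>) * L (real n) \<le> real n powr (- \<alpha> + \<delta>)) sequentially"
      using eventually_compose_filterlim[OF regularly_varying_bounds[OF L \<delta>(1), of \<alpha>] filterlim_real_sequentially]
      by (rule eventually_mono) auto
    then show "eventually (\<lambda>n. norm (real n powr s * pmf Q n) \<le> real n powr (s - \<alpha> + \<delta>)) sequentially"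
      using eventually_ge_at_top[of 1]
    proof eventually_elim
      case (elim n)
      have "real n powr s * pmf Q n \<le> real n powr s * real n powr (- \<alpha> + \<delta>)"
        using elim by (intro mult_left_mono) (auto simp: pmfQ pmf_eq)
      also have "\<dots> = real n powr (s - \<alpha> + \<delta>)" unfolding powr_add[symmetric] by (simp add: algebra_simps)
      finally show ?case by simp
    qed
  qed
  then have "integrable Q (\<lambda>n. real n powr s)"
    by (subst integrable_pmf_nat_iff) auto
  then show ?thesis by (simp add: Q_def map_pmf_rep_eq integrable_distr_eq)
qed

text \<open>The hypothesis gives no point masses on the negative side, only the ratio of tails. So
  the positive part is treated through its masses, and its moment is transferred to the negative
  part by comparing tail series, eventually with the factor \<open>l + 1\<close>.\<close>

lemma two_sided_moment:
  fixes P :: "int pmf"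
  assumes L: "slowly_varying L" and pmf_eq: "\<And>t::nat. t \<ge> 1 \<Longrightarrow> pmf P (int t) = real t powr (- \<alpha>) * L (real t)"
    and ratio: "(\<lambda>t::nat. measure P {z. z < - int t} / measure P {z. z > int t}) \<longlonglongrightarrow> l"
    and q: "0 < q" "q < \<alpha> - 1"
  shows "integrable P (\<lambda>z. \<bar>real_of_int z\<bar> powr q)"
proof -
  define f where "f k = real k powr q" for k :: nat
  have f: "mono f" "f 0 = 0" using q by (auto simp: f_def intro!: monoI powr_mono2)
  have pos_q: "integrable P (\<lambda>z. f (nat z))"
    unfolding f_def by (rule positive_part_moment[OF L pmf_eq q])
  obtain a where a: "\<And>x. x \<ge> a \<Longrightarrow> L x > 0" using L unfolding slowly_varying_def by blast
  \<comment> \<open>If the right tail were 0, the quotient would be 0 by convention and would say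
    nothing about the left tail.\<close>
  have tail_pos: "measure P {z. z > int t} > 0" for t
  proof -
    define n where "n = max (t + 1) (nat \<lceil>a\<rceil>)"
    have "real n \<ge> a" unfolding n_def by linarith
    then have "pmf P (int n) > 0" using a[of "real n"] by (subst pmf_eq) (auto simp: n_def)
    also have "pmf P (int n) \<le> measure P {z. z > int t}"
      unfolding measure_pmf_single[symmetric] by (intro measure_pmf.finite_measure_mono) (auto simp: n_def)
    finally show ?thesis .
  qed
  define Q where "Q = map_pmf (\<lambda>z. nat (- z)) P"
  define R where "R = map_pmf nat P"
  have "integrable R f" using pos_q by (simp add: R_def map_pmf_rep_eq integrable_distr_eq)
  then have "summable (\<lambda>t. (l + 1) * ((f (Suc t) - f t) * measure R {t<..}))"
    unfolding integrable_iff_summable_tail[OF f] by (rule summable_mult)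
  moreover have "eventually (\<lambda>t::nat. measure P {z. z < - int t} / measure P {z. z > int t} < l + 1) sequentially"
    by (rule order_tendstoD[OF ratio]) simp
  then have "eventually (\<lambda>t. norm ((f (Suc t) - f t) * measure Q {t<..}) \<le> (l + 1) * ((f (Suc t) - f t) * measure R {t<..})) sequentially"
  proof eventually_elim
    case (elim t)
    have "(\<lambda>z. nat (- z)) -` {t<..} = {z. z < - int t}" "nat -` {t<..} = {z. z > int t}" by auto
    then have "measure Q {t<..} \<le> (l + 1) * measure R {t<..}"
      using elim tail_pos[of t] by (simp add: Q_def R_def field_simps)
    from mult_left_mono[OF this, of "f (Suc t) - f t"] show ?case
      using monoD[OF f(1), of t "Suc t"] by (simp add: mult_ac)
  qed
  ultimately have "integrable Q f"
    unfolding integrable_iff_summable_tail[OF f] by (rule summable_comparison_test_ev[rotated])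
  then have neg_q: "integrable P (\<lambda>z. f (nat (- z)))"
    by (simp add: Q_def map_pmf_rep_eq integrable_distr_eq)
  have "\<bar>real_of_int z\<bar> powr q = f (nat z) + f (nat (- z))" for z
    by (cases "z \<ge> 0") (auto simp: f_def)
  then show ?thesis using pos_q neg_q by simp
qed

lemma integrable_of_powr_moment:
  fixes P :: "int pmf"
  assumes "integrable P (\<lambda>z. \<bar>real_of_int z\<bar> powr q)" "q \<ge> 1"
  shows "integrable P real_of_int"
proof (rule Bochner_Integration.integrable_bound[OF assms(1)])
  show "AE z in P. norm (real_of_int z) \<le> norm (\<bar>real_of_int z\<bar> powr q)"
  proof (rule AE_I2)
    fix z :: int
    show "norm (real_of_int z) \<le> norm (\<bar>real_of_int z\<bar> powr q)"
    proof (cases "z = 0")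
      case False
      then have "\<bar>real_of_int z\<bar> \<ge> 1" by linarith
      then have "\<bar>real_of_int z\<bar> powr 1 \<le> \<bar>real_of_int z\<bar> powr q" using assms(2) by (intro powr_mono)
      then show ?thesis using False by simp
    qed simp
  qed
qed simp

context prob_space
begin

section \<open>Laws of the partial sums and of the random sum\<close>

lemma law_pmf_exists:
  fixes Y :: "'a \<Rightarrow> 'b :: countable"
  assumes "Y \<in> measurable M (count_space UNIV)"
  obtains Q where "measure_pmf Q = distr M (count_space UNIV) Y" "\<And>x. pmf Q x = prob {\<omega>\<in>space M. Y \<omega> = x}"
proof -
  interpret D: prob_space "distr M (count_space UNIV) Y" by (rule prob_space_distr[OF assms])
  have "AE x in distr M (count_space UNIV) Y. measure (distr M (count_space UNIV) Y) {x} \<noteq> 0"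
    by (subst D.AE_support_countable) (auto intro!: exI[of _ UNIV])
  then have *: "measure_pmf (Abs_pmf (distr M (count_space UNIV) Y)) = distr M (count_space UNIV) Y"
    by (intro Abs_pmf_inverse) (auto intro: D.prob_space_axioms)
  show ?thesis
  proof (rule that[OF *])
    fix x
    show "pmf (Abs_pmf (distr M (count_space UNIV) Y)) x = prob {\<omega>\<in>space M. Y \<omega> = x}"
      unfolding measure_pmf_single[symmetric] * using assms
      by (subst measure_distr) (auto intro!: arg_cong[where f = prob])
  qed
qed

lemma iid_partial_sums:
  assumes iid: "iid_seq M X" and P: "\<And>x. pmf P x = prob {\<omega>\<in>space M. X 1 \<omega> = x}"
  shows "(\<lambda>\<omega>. \<Sum>i=1..n. X i \<omega>) \<in> measurable M (count_space UNIV)"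
    and "prob {\<omega>\<in>space M. (\<Sum>i=1..n. X i \<omega>) = x} = walk_prob P n x"
proof -
  define S where "S n \<omega> = (\<Sum>i=1..n. X i \<omega>)" for n \<omega>
  have S_Suc: "S (Suc n) \<omega> = S n \<omega> + X (Suc n) \<omega>" for n \<omega> by (simp add: S_def)
  have indep: "indep_vars (\<lambda>_. count_space UNIV) X {1..}"
    and ident: "\<And>i. i \<ge> 1 \<Longrightarrow> distr M (count_space UNIV) (X i) = distr M (count_space UNIV) (X 1)"
    using iid unfolding iid_seq_def by blast+
  from indep have "\<forall>i\<in>{1..}. X i \<in> measurable M (count_space UNIV)"
    unfolding indep_vars_def by (rule conjunct1)
  then have X_meas: "X i \<in> measurable M (count_space UNIV)" if "i \<ge> 1" for i using that by simp
  have law: "prob {\<omega>\<in>space M. X i \<omega> = x} = pmf P x" if "i \<ge> 1" for i x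
    using arg_cong[OF ident[OF that], of "\<lambda>N. measure N {x}"] X_meas[OF that] X_meas[of 1]
    by (simp add: measure_distr P vimage_def Int_def conj_commute)
  have S_meas: "S n \<in> measurable M (count_space UNIV)" for n
  proof (induction n)
    case 0
    show ?case by (simp add: S_def[abs_def])
  next
    case (Suc n)
    have "(\<lambda>\<omega>. S n \<omega> + X (Suc n) \<omega>) \<in> measurable M (count_space UNIV)"
      by (rule measurable_compose_countable[OF measurable_compose[OF X_meas] Suc]) auto
    then show ?case by (simp add: S_Suc[abs_def])
  qed
  then show "(\<lambda>\<omega>. \<Sum>i=1..n. X i \<omega>) \<in> measurable M (count_space UNIV)"
    by (simp add: S_def[abs_def])
  \<comment> \<open>Embedding the integers into the reals makes \<open>indep_vars_sum\<close>
    applicable; singletons recover the integer events.\<close>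
  have "indep_vars (\<lambda>_. borel) (\<lambda>i \<omega>. real_of_int (X i \<omega>)) {1..}"
    by (rule indep_vars_compose2[OF indep]) simp
  then have "indep_var borel (\<lambda>\<omega>. real_of_int (X (Suc n) \<omega>)) borel (\<lambda>\<omega>. \<Sum>i\<in>{1..n}. real_of_int (X i \<omega>))" for n
    by (intro indep_vars_sum) (auto intro: indep_vars_subset)
  then have indep_real: "indep_var borel (\<lambda>\<omega>. real_of_int (X (Suc n) \<omega>)) borel (\<lambda>\<omega>. real_of_int (S n \<omega>))" for n
    by (simp add: S_def)
  have prod: "prob {\<omega>\<in>space M. X (Suc n) \<omega> = z \<and> S n \<omega> = y} = pmf P z * prob {\<omega>\<in>space M. S n \<omega> = y}" for n z y
    using indep_varD[OF indep_real, of "{real_of_int z}" "{real_of_int y}" n] law[of "Suc n" z]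
    by (simp add: vimage_def Int_def conj_commute)
  have sets: "{\<omega>\<in>space M. X (Suc n) \<omega> = z \<and> S n \<omega> = y} \<in> sets M" for n z y
    using X_meas[of "Suc n"] S_meas[of n] by measurable
  have "prob {\<omega>\<in>space M. S n \<omega> = x} = walk_prob P n x"
  proof (induction n arbitrary: x)
    case 0
    then show ?case by (simp add: S_def walk_prob_0 indicator_def prob_space)
  next
    case (Suc n)
    have "{\<omega>\<in>space M. S (Suc n) \<omega> = x} = (\<Union>z. {\<omega>\<in>space M. X (Suc n) \<omega> = z \<and> S n \<omega> = x - z})"
      by (auto simp: S_Suc)
    then have "emeasure M {\<omega>\<in>space M. S (Suc n) \<omega> = x}
       = (\<integral>\<^sup>+z. emeasure M {\<omega>\<in>space M. X (Suc n) \<omega> = z \<and> S n \<omega> = x - z} \<partial>count_space UNIV)"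
      by (simp only:) (rule emeasure_UN_countable, rule sets, simp, auto simp: disjoint_family_on_def)
    also have "\<dots> = (\<integral>\<^sup>+z. ennreal (pmf P z) * ennreal (walk_prob P n (x - z)) \<partial>count_space UNIV)"
      unfolding emeasure_eq_measure prod Suc by (intro nn_integral_cong) (simp add: ennreal_mult' walk_prob_nonneg)
    also have "\<dots> = (\<integral>\<^sup>+z. ennreal (walk_prob P n (x - z)) \<partial>P)"
      by (rule nn_integral_measure_pmf[symmetric])
    also have "\<dots> = ennreal (\<integral>z. walk_prob P n (x - z) \<partial>P)"
      by (rule nn_integral_eq_integral) (auto intro: integrable_pmf_bounded[where A = 1] walk_prob_abs_le_1 walk_prob_nonneg)
    finally show ?case
      unfolding emeasure_eq_measure walk_prob_Suc walk_op_eq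
      by (subst (asm) ennreal_inj) (auto intro!: integral_nonneg_AE simp: walk_prob_nonneg)
  qed
  then show "prob {\<omega>\<in>space M. (\<Sum>i=1..n. X i \<omega>) = x} = walk_prob P n x" by (simp add: S_def)
qed

lemma random_sum_prob:
  assumes iid: "iid_seq M X" and N: "indep_of_seq M N X"
    and P: "\<And>x. pmf P x = prob {\<omega>\<in>space M. X 1 \<omega> = x}"
  shows "prob {\<omega>\<in>space M. random_sum X N \<omega> = x} = (\<Sum>n. prob {\<omega>\<in>space M. N \<omega> = n} * walk_prob P n x)"
proof -
  have N_meas[measurable]: "N \<in> measurable M (count_space UNIV)"
    and ind: "indep_set {N -` A \<inter> space M | A. A \<in> sets (count_space UNIV)}
       {(\<lambda>\<omega>. \<lambda>i\<in>{1..}. X i \<omega>) -` B \<inter> space M | B. B \<in> sets (PiM {1..} (\<lambda>_. count_space UNIV))}"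
    using N unfolding indep_of_seq_def by auto
  define A where "A n = {\<omega>\<in>space M. N \<omega> = n \<and> (\<Sum>i=1..n. X i \<omega>) = x}" for n
  have A_prob: "prob (A n) = prob {\<omega>\<in>space M. N \<omega> = n} * walk_prob P n x" for n
  proof -
    \<comment> \<open>Independence of \<open>N\<close> is stated for the whole sequence, so the
      event \<open>S_n = x\<close> is written as a preimage of a set in the infinite
      product.\<close>
    define B where "B = {f \<in> space (PiM {1..} (\<lambda>_. count_space UNIV)). (\<Sum>i=1..n. real_of_int (f i)) = real_of_int x}"
    have "(\<lambda>f. \<Sum>i=1..n. real_of_int (f i)) \<in> borel_measurable (PiM {1..} (\<lambda>_. count_space UNIV))"
    proof (rule borel_measurable_sum)
      fix i assume "i \<in> {1..n}"
      then have "(\<lambda>f. f i) \<in> measurable (PiM {1..} (\<lambda>_. count_space UNIV)) (count_space (UNIV :: int set))"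
        by (intro measurable_component_singleton) auto
      then show "(\<lambda>f. real_of_int (f i)) \<in> borel_measurable (PiM {1..} (\<lambda>_. count_space UNIV))"
        by (rule measurable_compose) simp
    qed
    then have B: "B \<in> sets (PiM {1..} (\<lambda>_. count_space UNIV))"
      unfolding B_def by measurable
    have S: "(\<lambda>\<omega>. \<lambda>i\<in>{1..}. X i \<omega>) -` B \<inter> space M = {\<omega>\<in>space M. (\<Sum>i=1..n. X i \<omega>) = x}"
      by (auto simp: B_def space_PiM of_int_sum[symmetric] simp del: of_int_sum)
    have "A n = (N -` {n} \<inter> space M) \<inter> ((\<lambda>\<omega>. \<lambda>i\<in>{1..}. X i \<omega>) -` B \<inter> space M)"
      unfolding S by (auto simp: A_def)
    then have "prob (A n) = prob ((N -` {n} \<inter> space M) \<inter> ((\<lambda>\<omega>. \<lambda>i\<in>{1..}. X i \<omega>) -` B \<inter> space M))"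
      by (rule arg_cong)
    also have "\<dots> = prob (N -` {n} \<inter> space M) * prob ((\<lambda>\<omega>. \<lambda>i\<in>{1..}. X i \<omega>) -` B \<inter> space M)"
      by (rule indep_setD[OF ind]) (use B in auto)
    also have "N -` {n} \<inter> space M = {\<omega>\<in>space M. N \<omega> = n}" by auto
    finally show ?thesis unfolding S iid_partial_sums(2)[OF iid P] .
  qed
  have A_sets: "A n \<in> sets M" for n
  proof -
    have [measurable]: "(\<lambda>\<omega>. \<Sum>i=1..n. X i \<omega>) \<in> measurable M (count_space UNIV)"
      by (rule iid_partial_sums(1)[OF iid P])
    show ?thesis unfolding A_def by measurable
  qed
  have "(\<lambda>n. prob (A n)) sums prob (\<Union>n. A n)"
    by (rule finite_measure_UNION) (use A_sets in \<open>auto simp: disjoint_family_on_def A_def\<close>)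
  moreover have "(\<Union>n. A n) = {\<omega>\<in>space M. random_sum X N \<omega> = x}"
    by (auto simp: A_def random_sum_def)
  ultimately show ?thesis unfolding A_prob by (simp add: sums_iff)
qed

end

theorem theorem7:
  fixes M :: "'a measure" and X :: "nat \<Rightarrow> 'a \<Rightarrow> int" and N :: "'a \<Rightarrow> nat"
    and \<alpha> \<mu> :: real and L1 :: "real \<Rightarrow> real"
  assumes "prob_space M"
    and "iid_seq M X"
    and "indep_of_seq M N X"
    and "2 < \<alpha>" and "\<alpha> < 3"
    and "\<mu> = (\<integral>\<omega>. real_of_int (X 1 \<omega>) \<partial>M)" and "\<mu> > 0"
    and "cond_R1 (\<lambda>t. \<P>(\<omega> in M. N \<omega> = t))"
    and "cond_R2 \<alpha> (\<lambda>t. \<P>(\<omega> in M. N \<omega> = t))"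
    and "\<exists>\<beta>. 0 < \<beta> \<and> \<beta> < \<alpha> - 2 \<and>
           (\<lambda>t::nat. \<Sum>\<^sub>\<infinity>n\<in>{t..}. real n powr (- 1 - \<beta>) * \<P>(\<omega> in M. N \<omega> = n))
             \<in> o(\<lambda>t. \<P>(\<omega> in M. N \<omega> = t))"
    and "\<forall>t::nat. t \<ge> 1 \<longrightarrow> \<P>(\<omega> in M. X 1 \<omega> = int t) = real t powr (-\<alpha>) * L1 (real t)"
    and "slowly_varying L1"
    and "(\<lambda>x. L1 (x * L1 x powr (1 / (\<alpha> - 1)))) \<sim>[at_top] L1"
    and "\<exists>l::real. (\<lambda>t::nat. \<P>(\<omega> in M. X 1 \<omega> < - int t) / \<P>(\<omega> in M. X 1 \<omega> > int t)) \<longlonglongrightarrow> l"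
  shows
    "(integrable M (\<lambda>\<omega>. real (N \<omega>)) \<longrightarrow>
       (\<exists>e1 e2 :: nat \<Rightarrow> real. e1 \<in> o(\<lambda>_. 1) \<and> e2 \<in> o(\<lambda>_. 1) \<and>
          (\<forall>\<^sub>F t in sequentially.
             \<P>(\<omega> in M. random_sum X N \<omega> = int t) =
               (\<integral>\<omega>. real (N \<omega>) \<partial>M) * \<P>(\<omega> in M. X 1 \<omega> = int t) * (1 + e1 t)
               + inverse \<mu> * \<P>(\<omega> in M. N \<omega> = nat \<lfloor>real t / \<mu>\<rfloor>) * (1 + e2 t))))
     \<and>
     ((\<lambda>t::nat. \<P>(\<omega> in M. X 1 \<omega> = int t)) \<in> o(\<lambda>t. \<P>(\<omega> in M. N \<omega> = t)) \<longrightarrow>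
      integrable M (\<lambda>\<omega>. real (N \<omega>)) \<or> cond_P (\<lambda>t. \<P>(\<omega> in M. N \<omega> = t)) \<longrightarrow>
        (\<lambda>t::nat. \<P>(\<omega> in M. random_sum X N \<omega> = int t))
          \<sim>[sequentially] (\<lambda>t. inverse \<mu> * \<P>(\<omega> in M. N \<omega> = nat \<lfloor>real t / \<mu>\<rfloor>)))"
proof -
  interpret M: prob_space M by fact
  have "M.indep_vars (\<lambda>_. count_space UNIV) X {1..}"
    using assms(2) unfolding iid_seq_def by blast
  then have "\<forall>i\<in>{1..}. X i \<in> measurable M (count_space UNIV)"
    unfolding M.indep_vars_def by (rule conjunct1)
  then have X_meas: "X 1 \<in> measurable M (count_space UNIV)" by blast
  have N_meas: "N \<in> measurable M (count_space UNIV)"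
    using assms(3) unfolding indep_of_seq_def by blast
  obtain P where P: "measure_pmf P = distr M (count_space UNIV) (X 1)" "\<And>x. pmf P x = M.prob {\<omega>\<in>space M. X 1 \<omega> = x}"
    using M.law_pmf_exists[OF X_meas] by blast
  obtain Q where Q: "measure_pmf Q = distr M (count_space UNIV) N" "\<And>n. pmf Q n = M.prob {\<omega>\<in>space M. N \<omega> = n}"
    using M.law_pmf_exists[OF N_meas] by blast
  define p where "p n = M.prob {\<omega>\<in>space M. N \<omega> = n}" for n
  have pQ: "p n = pmf Q n" for n by (simp add: p_def Q)
  obtain \<beta> where \<beta>: "0 < \<beta>" "\<beta> < \<alpha> - 2"
    "(\<lambda>t::nat. \<Sum>\<^sub>\<infinity>n\<in>{t..}. real n powr (- 1 - \<beta>) * p n) \<in> o(p)"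
    using assms(10) unfolding p_def[abs_def] by blast
  have P_eq: "pmf P (int t) = real t powr (- \<alpha>) * L1 (real t)" if "t \<ge> 1" for t
    using assms(11) that by (simp add: P)
  have set_prob: "measure P S = M.prob {\<omega>\<in>space M. X 1 \<omega> \<in> S}" for S
    unfolding P by (subst measure_distr[OF X_meas]) (auto intro!: arg_cong[where f = M.prob])
  obtain l where l: "(\<lambda>t::nat. measure P {z. z < - int t} / measure P {z. z > int t}) \<longlonglongrightarrow> l"
    using assms(14) by (auto simp: set_prob)
  have moments: "integrable P (\<lambda>z. \<bar>real_of_int z\<bar> powr q)" if "1 < q" "q < \<alpha> - 1" for q
    by (rule two_sided_moment[OF assms(12) P_eq l]) (use that in auto)
  have int_P: "integrable P real_of_int"
    by (rule integrable_of_powr_moment[OF moments[of "\<alpha> / 2"]]) (use assms(4,5) in auto)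
  have mean: "\<mu> = (\<integral>z. real_of_int z \<partial>P)"
    unfolding P assms(6) by (rule integral_distr[OF X_meas, symmetric]) simp
  obtain a where a: "\<And>x. x \<ge> a \<Longrightarrow> L1 x > 0" using assms(12) unfolding slowly_varying_def by blast
  \<comment> \<open>Slow variation gives positivity of \<open>L1\<close> only from \<open>a\<close>
    on, and the mass formula holds only from 1 on.\<close>
  define z0 where "z0 = max 1 \<lceil>a\<rceil>"
  have pos: "pmf P z > 0" if "z \<ge> z0" for z
  proof -
    have z: "z \<ge> 1" "real_of_int z \<ge> a" using that by (auto simp: z0_def ceiling_le_iff)
    then show ?thesis using P_eq[of "nat z"] a[of "real_of_int z"] by simp
  qed
  interpret stopped_heavy_walk P \<mu> z0 \<alpha> L1 p \<beta>
  proof unfold_locales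
    show "summable p"
      using integrable_pmf_nat_iff(1)[where f = "\<lambda>_. 1" and Q = Q] by (simp add: pQ[abs_def])
    show "p n \<ge> 0" for n by (simp add: p_def)
    show "cond_R1 p" "cond_R2 \<alpha> p" using assms(8,9) by (simp_all add: p_def[abs_def])
  qed (use int_P mean assms(4,5,7,12) pos P_eq moments \<beta> in auto)
  have N_int: "integrable M (\<lambda>\<omega>. real (N \<omega>)) \<longleftrightarrow> summable (\<lambda>n. real n * p n)"
    using integrable_distr_eq[OF N_meas, of real] integrable_pmf_nat_iff(1)[where f = real and Q = Q]
    by (simp add: Q(1) pQ[abs_def])
  have N_mean: "(\<integral>\<omega>. real (N \<omega>) \<partial>M) = (\<Sum>n. real n * p n)" if "integrable M (\<lambda>\<omega>. real (N \<omega>))"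
  proof -
    have "integrable Q real" using that integrable_distr_eq[OF N_meas, of real] by (simp add: Q(1))
    from integrable_pmf_nat_iff(2)[OF _ this] show ?thesis
      using integral_distr[OF N_meas, of real] by (simp add: Q(1)[symmetric] pQ[abs_def])
  qed
  have sum_eq: "M.prob {\<omega>\<in>space M. random_sum X N \<omega> = int t} = stopped_prob t" for t
    using M.random_sum_prob[OF assms(2,3) P(2), of "int t"] by (simp add: stopped_prob_def p_def)
  have center_eq: "M.prob {\<omega>\<in>space M. N \<omega> = nat \<lfloor>real t / \<mu>\<rfloor>} = p (center t)" for t
    by (simp add: p_def center_def)
  show ?thesis
    unfolding sum_eq center_eq P(2)[symmetric] p_def[symmetric]
    using finite_mean_asymptotics light_jump_asymptotics by (auto simp: N_int N_mean)
qed

end
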